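(* Let $F_n$ be the free group of rank $n$ and let $f_1,\dots,f_k$ be a generating set of the automorphism group $\mathrm{Aut}(F_n)$. Consider all words of length $L$ in $f_1,\dots,f_k$. Then, for any $n$, the probability that such a word is irreducible tends to $1$ as $L\to\infty$, and also the probability that such a word is strongly irreducible tends to $1$ as $L\to\infty$.
   Context: A word of length $L$ is a product $f_{i_1}f_{i_2}\cdots f_{i_L}$, and probability refers to the uniform distribution on the $k^L$ index sequences. A free factor of $F_n$ is a subgroup $H$ such that $F_n=H*K$ for some subgroup $K$; free factors below are nontrivial and proper. An automorphism $\phi$ of $F_n$ is strongly irreducible (also called irreducible with irreducible powers) if no positive power of $\phi$ sends a (proper nontrivial) free factor $H$ of $F_n$ to a conjugate of $H$. An automorphism $\phi$ is irreducible (in the standard sense of Bestvina–Handel) if there are no proper nontrivial free factors $H_1,\dots,H_r$ of $F_n$ whose conjugacy classes are transitively permuted by $\phi$ and such that $H_1*\cdots*H_r$ is a free factor of $F_n$ (possibly all of $F_n$). *)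

theory Defs
  imports
    "HOL-Algebra.Generated_Groups"
    "HOL-Algebra.Bij"
    "HOL-Probability.Probability_Mass_Function"
begin

definition word_prod :: "('a, 'b) monoid_scheme \<Rightarrow> 'a list \<Rightarrow> 'a" where
  "word_prod G ws = foldr (\<otimes>\<^bsub>G\<^esub>) ws \<one>\<^bsub>G\<^esub>"


section \<open>Free groups\<close>

text \<open>A letter \<open>(x, True)\<close> stands for \<open>x\<close>, and \<open>(x, False)\<close> for its formal inverse.\<close>

definition freely_reduced_words :: "'a set \<Rightarrow> ('a \<times> bool) list set" where
  "freely_reduced_words X =
    {w. fst ` set w \<subseteq> X \<and> successively (\<lambda>(x, a) (y, b). x = y \<longrightarrow> a = b) w}"

definition letter_val :: "('a, 'b) monoid_scheme \<Rightarrow> 'a \<times> bool \<Rightarrow> 'a" where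
  "letter_val G = (\<lambda>(x, a). if a then x else inv\<^bsub>G\<^esub> x)"

text \<open>The canonical map from the group of freely reduced words on \<open>X\<close> to \<open>G\<close> is bijective.\<close>

definition free_basis :: "('a, 'b) monoid_scheme \<Rightarrow> 'a set \<Rightarrow> bool" where
  "free_basis G X \<longleftrightarrow> X \<subseteq> carrier G \<and>
     bij_betw (\<lambda>w. word_prod G (map (letter_val G) w)) (freely_reduced_words X) (carrier G)"

definition free_group_of_rank :: "('a, 'b) monoid_scheme \<Rightarrow> nat \<Rightarrow> bool" where
  "free_group_of_rank G n \<longleftrightarrow> group G \<and> (\<exists>X. finite X \<and> card X = n \<and> free_basis G X)"


section \<open>Free products and free factors\<close>

text \<open>Elements of the external free product of the groups \<open>H i\<close>, \<open>i \<in> I\<close>, are the words of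
  nontrivial elements in which consecutive letters come from factors with different indices.
  The subgroup \<open>P\<close> is the internal free product of the \<open>H i\<close> if the canonical map
  from these words to \<open>G\<close> is a bijection onto \<open>P\<close>.\<close>

definition free_product_words ::
    "('a, 'b) monoid_scheme \<Rightarrow> 'i set \<Rightarrow> ('i \<Rightarrow> 'a set) \<Rightarrow> ('i \<times> 'a) list set" where
  "free_product_words G I H =
    {w. set w \<subseteq> (SIGMA i:I. H i - {\<one>\<^bsub>G\<^esub>}) \<and> distinct_adj (map fst w)}"

definition is_free_product ::
    "('a, 'b) monoid_scheme \<Rightarrow> 'i set \<Rightarrow> ('i \<Rightarrow> 'a set) \<Rightarrow> 'a set \<Rightarrow> bool" where
  "is_free_product G I H P \<longleftrightarrow> (\<forall>i\<in>I. subgroup (H i) G) \<and>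
     bij_betw (\<lambda>w. word_prod G (map snd w)) (free_product_words G I H) P"

definition free_factor :: "('a, 'b) monoid_scheme \<Rightarrow> 'a set \<Rightarrow> bool" where
  "free_factor G H \<longleftrightarrow>
     (\<exists>K. is_free_product G UNIV (\<lambda>b::bool. if b then H else K) (carrier G))"

definition proper_free_factor :: "('a, 'b) monoid_scheme \<Rightarrow> 'a set \<Rightarrow> bool" where
  "proper_free_factor G H \<longleftrightarrow> free_factor G H \<and> H \<noteq> {\<one>\<^bsub>G\<^esub>} \<and> H \<noteq> carrier G"


section \<open>Irreducible and strongly irreducible automorphisms\<close>

definition conjugacy_class :: "('a, 'b) monoid_scheme \<Rightarrow> 'a set \<Rightarrow> 'a set set" where
  "conjugacy_class G H = {(\<lambda>h. g \<otimes>\<^bsub>G\<^esub> h \<otimes>\<^bsub>G\<^esub> inv\<^bsub>G\<^esub> g) ` H | g. g \<in> carrier G}"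

definition strongly_irreducible_aut :: "('a, 'b) monoid_scheme \<Rightarrow> ('a \<Rightarrow> 'a) \<Rightarrow> bool" where
  "strongly_irreducible_aut G \<phi> \<longleftrightarrow>
     \<not> (\<exists>m::nat. m > 0 \<and> (\<exists>H. proper_free_factor G H \<and>
            (\<phi> [^]\<^bsub>AutoGroup G\<^esub> m) ` H \<in> conjugacy_class G H))"

definition class_action :: "('a \<Rightarrow> 'a) \<Rightarrow> 'a set set \<Rightarrow> 'a set set" where
  "class_action \<phi> C = (\<lambda>H. \<phi> ` H) ` C"

text \<open>Below, the set of classes is finite, so nonnegative powers suffice for transitivity.\<close>

definition permutes_transitively :: "('a \<Rightarrow> 'a) \<Rightarrow> 'a set set set \<Rightarrow> bool" where
  "permutes_transitively \<phi> S \<longleftrightarrow> bij_betw (class_action \<phi>) S S \<and>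
     (\<forall>C\<in>S. \<forall>D\<in>S. \<exists>m::nat. (class_action \<phi> ^^ m) C = D)"

text \<open>The requirement \<open>r \<ge> 1\<close> excludes the empty family, which would make every
  automorphism reducible. The free factor \<open>P\<close> may be all of \<open>G\<close>.\<close>

definition irreducible_aut :: "('a, 'b) monoid_scheme \<Rightarrow> ('a \<Rightarrow> 'a) \<Rightarrow> bool" where
  "irreducible_aut G \<phi> \<longleftrightarrow>
     \<not> (\<exists>(r::nat) H. r \<ge> 1 \<and> (\<forall>i\<in>{1..r}. proper_free_factor G (H i)) \<and>
          permutes_transitively \<phi> (conjugacy_class G ` H ` {1..r}) \<and>
          (\<exists>P. is_free_product G {1..r} H P \<and> free_factor G P))"


section \<open>Random words\<close>

definition index_seqs :: "nat \<Rightarrow> nat \<Rightarrow> nat list set" where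
  "index_seqs k L = {is. length is = L \<and> set is \<subseteq> {1..k}}"

text \<open>The probability, for a uniformly random index sequence \<open>i\<^sub>1, \<dots>, i\<^sub>L\<close>, that the automorphism
  \<open>f i\<^sub>1 \<cdots> f i\<^sub>L\<close> has property \<open>Q\<close>.\<close>

definition word_probability ::
    "('a, 'b) monoid_scheme \<Rightarrow> nat \<Rightarrow> (nat \<Rightarrow> 'a \<Rightarrow> 'a) \<Rightarrow> nat \<Rightarrow> (('a \<Rightarrow> 'a) \<Rightarrow> bool) \<Rightarrow> real" where
  "word_probability G k f L Q =
     measure_pmf.prob (pmf_of_set (index_seqs k L)) {is. Q (word_prod (AutoGroup G) (map f is))}"

end

theory Submission
  imports
    Defs
    "HOL-Algebra.Product_Groups"
    "HOL-Number_Theory.Number_Theory"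
    "Jordan_Normal_Form.Determinant"
begin

text \<open>A strongly irreducible automorphism is irreducible, because a transitively permuted finite set of
  conjugacy classes is fixed elementwise by some positive power. It therefore suffices to bound the
  proportion of words that are not strongly irreducible, and this is done in homology, modulo several
  primes at once.

  The first half of the argument turns a failure of strong irreducibility into a condition modulo
  every prime. Suppose that \<open>\<phi>\<^sup>m\<close> maps a proper nontrivial free factor \<open>H\<close> to a conjugate, and let
  \<open>A = aut_mat \<phi>\<close> be the action on \<open>\<int>\<^sup>n\<close>. Then \<open>A\<^sup>m\<close> preserves the image of \<open>H\<close> and its saturation
  (double annihilator). The Magnus expansion shows that every nontrivial subgroup of a free group maps
  onto \<open>\<int>\<close>; extended by zero to a complementary free factor, such maps show that the saturation
  is nonzero and proper modulo every prime (\<open>free_factor_functional\<close>). If \<open>e\<close> annihilates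
  \<open>GL\<^sub>n(\<int>/6)\<close>, then \<open>A\<^sup>e\<close> is trivial modulo \<open>2\<close> and \<open>3\<close>, and such a matrix preserves every
  saturated subgroup that one of its powers preserves (\<open>stabilizer_of_power\<close>). Hence \<open>A\<^sup>e\<close> is
  reducible modulo every prime, with an exponent \<open>e\<close> that depends neither on \<open>m\<close> nor on \<open>\<phi>\<close>.

  The second half shows that this is rare. For a prime \<open>p \<ge> 2n\<^sup>2e\<close>, a Singer cycle, which is
  multiplication by a generator of \<open>GF(p\<^sup>n)\<close>, has many powers whose \<open>e\<close>-th power acts irreducibly;
  counting their conjugates shows that a proportion of at least \<open>1/(2n)\<close> of the matrices of a given
  determinant \<open>\<plusminus>1\<close> have an irreducible \<open>e\<close>-th power (\<open>irreducible_density\<close>). For determinant \<open>-1\<close> this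
  uses that \<open>-1\<close> is an \<open>n\<close>-th power modulo \<open>p\<close>, which holds for infinitely many \<open>p\<close>.

  A random word is a random walk on the finite group \<open>\<Prod>\<^sub>p GL\<^sub>n(\<int>/p)\<close>, where \<open>p\<close> ranges over a finite
  set \<open>S\<close> of such primes. After many steps it is nearly uniform on a coset, which depends on the
  length, of a subgroup that contains all commutators (\<open>walk_limsup\<close>), hence \<open>SL\<^sub>n(\<int>/p)\<close> for
  each \<open>p \<in> S\<close>. On such a coset the coordinates behave independently (\<open>independent_densities\<close>), so being reducible at all
  \<open>p \<in> S\<close> has proportion at most \<open>(1 - 1/(2n))\<close> to the power \<open>|S|\<close>, up to an error that
  vanishes as the length grows. Finally \<open>S\<close> is taken large.\<close>

hide_const (open) Polynomial.order
hide_const (open) Determinants.det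
unbundle no inner_syntax
unbundle no vec_syntax

section \<open>Random walks on finite groups\<close>

lemma sum_indicator_card:
  assumes "finite A"
  shows "(\<Sum>y\<in>A. indicator B (g y)) = real (card {y \<in> A. g y \<in> B})"
proof -
  have "(\<Sum>y\<in>A. indicator B (g y)) = (\<Sum>y\<in>{y \<in> A. g y \<in> B}. 1 :: real)"
    using assms by (intro sum.mono_neutral_cong_right) (auto simp: indicator_def)
  then show ?thesis by simp
qed

locale finite_walk = group G for G :: "('g, 'h) monoid_scheme" (structure) +
  fixes k :: nat and s :: "nat \<Rightarrow> 'g"
  assumes fin: "finite (carrier G)" and k_pos: "k \<ge> 1" and s_closed: "s ` {1..k} \<subseteq> carrier G"
begin

definition word_val :: "nat list \<Rightarrow> 'g" where
  "word_val is = word_prod G (map s is)"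

lemma word_val_Nil [simp]: "word_val [] = \<one>"
  by (simp add: word_val_def word_prod_def)

lemma word_val_Cons [simp]: "word_val (i # is) = s i \<otimes> word_val is"
  by (simp add: word_val_def word_prod_def)

lemma s_in_carrier: "i \<in> {1..k} \<Longrightarrow> s i \<in> carrier G"
  using s_closed by blast

lemma word_val_closed: "set is \<subseteq> {1..k} \<Longrightarrow> word_val is \<in> carrier G"
  by (induction "is") (use s_in_carrier in auto)

lemma word_val_append:
  "set u \<subseteq> {1..k} \<Longrightarrow> set v \<subseteq> {1..k} \<Longrightarrow> word_val (u @ v) = word_val u \<otimes> word_val v"
proof (induction u)
  case Nil then show ?case using word_val_closed by simp
next
  case (Cons a u)
  then have "s a \<in> carrier G" "word_val u \<in> carrier G" "word_val v \<in> carrier G"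
    using s_in_carrier word_val_closed by auto
  with Cons show ?case by (simp add: m_assoc)
qed

lemma index_seqs_append:
  "u \<in> index_seqs k a \<Longrightarrow> v \<in> index_seqs k b \<Longrightarrow> u @ v \<in> index_seqs k (a + b)"
  by (auto simp: index_seqs_def)

lemma index_seqs_closed: "u \<in> index_seqs k a \<Longrightarrow> word_val u \<in> carrier G"
  unfolding index_seqs_def using word_val_closed by blast

lemma index_seqs_val_append:
  "u \<in> index_seqs k a \<Longrightarrow> v \<in> index_seqs k b \<Longrightarrow> word_val (u @ v) = word_val u \<otimes> word_val v"
  unfolding index_seqs_def using word_val_append by blast

lemma finite_index_seqs: "finite (index_seqs k L)"
  using finite_lists_length_eq[of "{1..k}" L] by (simp add: index_seqs_def conj_commute)

lemma card_index_seqs: "card (index_seqs k L) = k ^ L"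
  using card_lists_length_eq[of "{1..k}" L] by (simp add: index_seqs_def conj_commute)

lemma sum_index_seqs_add:
  "(\<Sum>is\<in>index_seqs k (a + b). f is) = (\<Sum>u\<in>index_seqs k a. \<Sum>v\<in>index_seqs k b. f (u @ v))"
proof -
  have "bij_betw (\<lambda>(u, v). u @ v) (index_seqs k a \<times> index_seqs k b) (index_seqs k (a + b))"
  proof (rule bij_betwI[where g = "\<lambda>w. (take a w, drop a w)"])
    show "(\<lambda>w. (take a w, drop a w)) \<in> index_seqs k (a + b) \<rightarrow> index_seqs k a \<times> index_seqs k b"
      unfolding index_seqs_def by (auto dest!: in_set_takeD in_set_dropD)
    show "(\<lambda>(u, v). u @ v) \<in> index_seqs k a \<times> index_seqs k b \<rightarrow> index_seqs k (a + b)"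
      using index_seqs_append by auto
  qed (auto simp: index_seqs_def)
  from sum.reindex_bij_betw[OF this, of f] show ?thesis
    by (simp add: sum.cartesian_product case_prod_unfold)
qed

text \<open>The mean of \<open>h\<close> over the positions after \<open>L\<close> steps of the walk that starts at \<open>x\<close> and multiplies
  by random generators on the right.\<close>

definition avg :: "nat \<Rightarrow> ('g \<Rightarrow> real) \<Rightarrow> 'g \<Rightarrow> real" where
  "avg L h x = (\<Sum>is\<in>index_seqs k L. h (x \<otimes> word_val is)) / real k ^ L"

lemma avg_add:
  assumes "x \<in> carrier G"
  shows "avg (a + b) h x = avg a (avg b h) x"
proof -
  have "h (x \<otimes> word_val (u @ v)) = h (x \<otimes> word_val u \<otimes> word_val v)"
    if "u \<in> index_seqs k a" "v \<in> index_seqs k b" for u v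
    using that assms index_seqs_val_append index_seqs_closed by (simp add: m_assoc)
  then show ?thesis
    by (simp add: avg_def sum_index_seqs_add power_add sum_divide_distrib mult.commute)
qed

lemma avg_le:
  assumes "\<And>y. y \<in> carrier G \<Longrightarrow> h y \<le> c" and "x \<in> carrier G"
  shows "avg L h x \<le> c"
proof -
  have "(\<Sum>is\<in>index_seqs k L. h (x \<otimes> word_val is)) \<le> (\<Sum>is\<in>index_seqs k L. c)"
    using assms index_seqs_closed by (intro sum_mono) simp
  then show ?thesis using k_pos by (simp add: avg_def card_index_seqs divide_simps mult.commute)
qed

text \<open>Words whose length is a multiple of the group order are closed under concatenation and, since
  inverses are powers, their values form a subgroup. Restricting the lengths removes the periodicity of
  the walk: in this subgroup every element is reached by words of one common length.\<close>

definition return_subgroup :: "'g set" where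
  "return_subgroup = {word_val is | is j. is \<in> index_seqs k (order G * j)}"

lemma return_subgroupI: "is \<in> index_seqs k (order G * j) \<Longrightarrow> word_val is \<in> return_subgroup"
  by (auto simp: return_subgroup_def)

lemma order_pos: "order G > 0"
  using fin one_closed by (auto simp: Coset.order_def card_gt_0_iff)

lemma return_subgroup_subset: "return_subgroup \<subseteq> carrier G"
  by (auto simp: return_subgroup_def index_seqs_closed)

lemma finite_return_subgroup: "finite return_subgroup"
  using return_subgroup_subset fin by (rule finite_subset)

lemma one_in_return_subgroup: "\<one> \<in> return_subgroup"
  using return_subgroupI[of "[]" 0] by (simp add: index_seqs_def)

lemma return_subgroup_mult:
  "x \<in> return_subgroup \<Longrightarrow> y \<in> return_subgroup \<Longrightarrow> x \<otimes> y \<in> return_subgroup"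
proof -
  assume "x \<in> return_subgroup" "y \<in> return_subgroup"
  then obtain u i v j where uv: "u \<in> index_seqs k (order G * i)" "v \<in> index_seqs k (order G * j)"
    "x = word_val u" "y = word_val v" by (auto simp: return_subgroup_def)
  with return_subgroupI[of "u @ v" "i + j"] index_seqs_append[OF uv(1,2)] show ?thesis
    using index_seqs_val_append by (simp add: algebra_simps)
qed

lemma pow_in_set:
  assumes "\<one> \<in> S" "\<And>x y. x \<in> S \<Longrightarrow> y \<in> S \<Longrightarrow> x \<otimes> y \<in> S" "x \<in> S"
  shows "x [^] (n::nat) \<in> S"
  by (induction n) (use assms in auto)

lemma inv_eq_pow:
  assumes "x \<in> carrier G" shows "inv x = x [^] (order G - 1)"
proof -
  have "x [^] (order G - 1) \<otimes> x = x [^] (Suc (order G - 1))" by simp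
  also have "\<dots> = \<one>" using order_pos pow_order_eq_1[OF assms] by simp
  finally show ?thesis using assms by (intro inv_equality) auto
qed

lemma subgroup_return_subgroup: "subgroup return_subgroup G"
proof (rule subgroup.intro)
  show "inv x \<in> return_subgroup" if "x \<in> return_subgroup" for x
    using that inv_eq_pow return_subgroup_subset pow_in_set[of return_subgroup x]
      one_in_return_subgroup return_subgroup_mult by auto
qed (use return_subgroup_subset one_in_return_subgroup return_subgroup_mult in auto)

definition words :: "'g set" where "words = {word_val is | is. set is \<subseteq> {1..k}}"

lemma words_mult: "x \<in> words \<Longrightarrow> y \<in> words \<Longrightarrow> x \<otimes> y \<in> words"
  unfolding words_def using word_val_append
  by (smt (verit, ccfv_threshold) Un_subset_iff mem_Collect_eq set_append)

lemma one_in_words: "\<one> \<in> words"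
  by (auto simp: words_def intro!: exI[of _ "[]"])

lemma s_in_words: "i \<in> {1..k} \<Longrightarrow> s i \<in> words"
  by (auto simp: words_def s_in_carrier intro!: exI[of _ "[i]"])

lemma generate_subset_words: "generate G (s ` {1..k}) \<subseteq> words"
proof
  fix x assume "x \<in> generate G (s ` {1..k})"
  then show "x \<in> words"
  proof induction
    case (inv h)
    then have "h \<in> words" "h \<in> carrier G" using s_in_words s_in_carrier by auto
    then show ?case using inv_eq_pow pow_in_set[of words h] one_in_words words_mult by simp
  qed (use one_in_words s_in_words words_mult in auto)
qed

lemma word_val_pow:
  assumes "set u \<subseteq> {1..k}"
  shows "\<exists>v. set v \<subseteq> {1..k} \<and> length v = n * length u \<and> word_val v = word_val u [^] (n::nat)"
proof (induction n)
  case 0 show ?case by (intro exI[of _ "[]"]) simp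
next
  case (Suc n)
  then obtain v where "set v \<subseteq> {1..k}" "length v = n * length u" "word_val v = word_val u [^] n" by blast
  then show ?case using assms word_val_append by (intro exI[of _ "v @ u"]) simp
qed

text \<open>Writing \<open>inv x\<close> as \<open>x\<close> to the power \<open>order G - 1\<close> turns a commutator into a word in which every
  generator is used a multiple of \<open>order G\<close> times.\<close>

lemma commutator_in_return_subgroup:
  assumes "x \<in> words" "y \<in> words"
  shows "x \<otimes> y \<otimes> inv x \<otimes> inv y \<in> return_subgroup"
proof -
  from assms obtain u v where uv: "set u \<subseteq> {1..k}" "x = word_val u" "set v \<subseteq> {1..k}" "y = word_val v"
    by (auto simp: words_def)
  obtain u' v' where u': "set u' \<subseteq> {1..k}" "length u' = (order G - 1) * length u"
      "word_val u' = x [^] (order G - 1)"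
    and v': "set v' \<subseteq> {1..k}" "length v' = (order G - 1) * length v" "word_val v' = y [^] (order G - 1)"
    using word_val_pow uv by metis
  have xy: "x \<in> carrier G" "y \<in> carrier G" using uv word_val_closed by auto
  have "order G * l = l + (order G - 1) * l" for l using order_pos by (cases "order G") auto
  then have "u @ v @ u' @ v' \<in> index_seqs k (order G * (length u + length v))"
    using uv u' v' by (simp add: index_seqs_def distrib_left)
  from return_subgroupI[OF this] show ?thesis
    using uv u' v' xy inv_eq_pow by (simp add: word_val_append m_assoc)
qed

text \<open>Inserting \<open>order G\<close> copies of one generator does not change the value of a word, so the
  finitely many words that represent the elements can be padded to the same length.\<close>

lemma return_subgroup_uniform_length:
  "\<exists>m. \<forall>y\<in>return_subgroup. \<exists>is\<in>index_seqs k (order G * m). word_val is = y"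
proof -
  have step: "\<exists>is\<in>index_seqs k (order G * Suc j). word_val is = word_val u"
    if "u \<in> index_seqs k (order G * j)" for u j
  proof -
    obtain v where v: "set v \<subseteq> {1..k}" "length v = order G" "word_val v = s 1 [^] order G"
      using word_val_pow[of "[1]" "order G"] k_pos s_in_carrier by auto
    have "v @ u \<in> index_seqs k (order G * Suc j)" using v that by (auto simp: index_seqs_def)
    moreover have "word_val (v @ u) = word_val u"
      using v that k_pos s_in_carrier pow_order_eq_1[of "s 1"] word_val_closed word_val_append[of v u]
      by (auto simp: index_seqs_def)
    ultimately show ?thesis by blast
  qed
  have mono: "\<exists>is\<in>index_seqs k (order G * (j + d)). word_val is = word_val u"
    if "u \<in> index_seqs k (order G * j)" for u j d
  proof (induction d)
    case (Suc d) then show ?case using step by fastforce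
  qed (use that in auto)
  have "\<forall>y\<in>return_subgroup. \<exists>j. \<exists>is\<in>index_seqs k (order G * j). word_val is = y"
    unfolding return_subgroup_def by blast
  from bchoice[OF this] obtain f
    where f: "\<forall>y\<in>return_subgroup. \<exists>is\<in>index_seqs k (order G * f y). word_val is = y" ..
  define m where "m = Max (f ` return_subgroup)"
  have "\<exists>is\<in>index_seqs k (order G * m). word_val is = y" if y: "y \<in> return_subgroup" for y
  proof -
    have "f y \<le> m" using y finite_return_subgroup by (simp add: m_def)
    then obtain d where "m = f y + d" by (auto simp: le_iff_add)
    moreover obtain u where "u \<in> index_seqs k (order G * f y)" "word_val u = y" using f y by blast
    ultimately show ?thesis using mono[of u "f y" d] by simp
  qed
  then show ?thesis by blast
qed

lemma translate_return_subgroup: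
  assumes "w \<in> return_subgroup"
  shows "bij_betw (\<lambda>y. y \<otimes> w) return_subgroup return_subgroup"
proof (rule bij_betwI[where g = "\<lambda>y. y \<otimes> inv w"])
  interpret N: subgroup return_subgroup G by (rule subgroup_return_subgroup)
  have "w \<in> carrier G" "inv w \<in> return_subgroup" using assms by auto
  then show "(\<lambda>y. y \<otimes> w) \<in> return_subgroup \<rightarrow> return_subgroup"
    "(\<lambda>y. y \<otimes> inv w) \<in> return_subgroup \<rightarrow> return_subgroup"
    "\<And>x. x \<in> return_subgroup \<Longrightarrow> x \<otimes> w \<otimes> inv w = x"
    "\<And>x. x \<in> return_subgroup \<Longrightarrow> x \<otimes> inv w \<otimes> w = x"
    using assms by (auto simp: m_assoc)
qed

text \<open>Multiplication by an element of the subgroup permutes the coset, so averaging along the walk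
  preserves the mean of \<open>h\<close> over each coset.\<close>

lemma sum_avg_coset:
  assumes x: "x \<in> carrier G"
  shows "(\<Sum>y\<in>return_subgroup. avg (order G * j) h (x \<otimes> y)) = (\<Sum>y\<in>return_subgroup. h (x \<otimes> y))"
proof -
  let ?I = "index_seqs k (order G * j)"
  have "(\<Sum>y\<in>return_subgroup. avg (order G * j) h (x \<otimes> y))
      = (\<Sum>is\<in>?I. \<Sum>y\<in>return_subgroup. h (x \<otimes> y \<otimes> word_val is)) / real k ^ (order G * j)"
    unfolding avg_def sum_divide_distrib[symmetric] by (subst sum.swap) simp
  also have "(\<Sum>y\<in>return_subgroup. h (x \<otimes> y \<otimes> word_val is)) = (\<Sum>y\<in>return_subgroup. h (x \<otimes> y))"
    if "is \<in> ?I" for "is"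
  proof -
    have w: "word_val is \<in> return_subgroup" using that by (rule return_subgroupI)
    have "(\<Sum>y\<in>return_subgroup. h (x \<otimes> y \<otimes> word_val is))
        = (\<Sum>y\<in>return_subgroup. h (x \<otimes> (y \<otimes> word_val is)))"
      using x w return_subgroup_subset by (intro sum.cong) (auto simp: m_assoc subset_eq)
    also have "\<dots> = (\<Sum>y\<in>return_subgroup. h (x \<otimes> y))"
      by (rule sum.reindex_bij_betw[OF translate_return_subgroup[OF w]])
    finally show ?thesis .
  qed
  then have "(\<Sum>is\<in>?I. \<Sum>y\<in>return_subgroup. h (x \<otimes> y \<otimes> word_val is))
      = (\<Sum>is\<in>?I. \<Sum>y\<in>return_subgroup. h (x \<otimes> y))" by (rule sum.cong[OF refl])
  also have "(\<Sum>is\<in>?I. \<Sum>y\<in>return_subgroup. h (x \<otimes> y)) / real k ^ (order G * j)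
     = (\<Sum>y\<in>return_subgroup. h (x \<otimes> y))" using k_pos by (simp add: card_index_seqs)
  finally show ?thesis .
qed

text \<open>The oscillation of the averaged function on a coset contracts: from every point, one of the
  \<open>k ^ q\<close> words of length \<open>q = order G * m\<close> leads to a point where the function is minimal, so every
  further \<open>q\<close> steps multiply the oscillation by at most \<open>1 - 1 / k ^ q\<close>.\<close>

lemma avg_oscillation:
  assumes m: "\<forall>y\<in>return_subgroup. \<exists>is\<in>index_seqs k (order G * m). word_val is = y"
    and x: "x \<in> carrier G" and h: "\<And>y. 0 \<le> h y \<and> h y \<le> 1"
  shows "\<exists>a. \<forall>y\<in>return_subgroup. a \<le> avg (order G * m * j) h (x \<otimes> y) \<and>
     avg (order G * m * j) h (x \<otimes> y) \<le> a + (1 - 1 / real k ^ (order G * m)) ^ j"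
proof (induction j)
  case 0
  have "index_seqs k 0 = {[]}" by (auto simp: index_seqs_def)
  then show ?case using h x return_subgroup_subset
    by (intro exI[of _ 0]) (auto simp: avg_def subset_eq)
next
  case (Suc j)
  define q where "q = order G * m"
  define \<delta> where "\<delta> = 1 / real k ^ q"
  define u where "u y = avg (q * j) h (x \<otimes> y)" for y
  define c where "c = (1 - \<delta>) ^ j"
  have \<delta>: "0 < \<delta>" "\<delta> \<le> 1" using k_pos by (auto simp: \<delta>_def divide_simps)
  from Suc obtain a0 where a0: "\<And>y. y \<in> return_subgroup \<Longrightarrow> a0 \<le> u y \<and> u y \<le> a0 + c"
    unfolding u_def c_def \<delta>_def q_def by blast
  have ne: "return_subgroup \<noteq> {}" using one_in_return_subgroup by auto
  define a where "a = Min (u ` return_subgroup)"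
  have "a \<in> u ` return_subgroup"
    unfolding a_def using finite_return_subgroup ne by (intro Min_in) auto
  then obtain z where z: "z \<in> return_subgroup" "u z = a" by blast
  have lo: "a \<le> u y" if "y \<in> return_subgroup" for y
    using that finite_return_subgroup by (simp add: a_def)
  have hi: "u y \<le> a + c" if "y \<in> return_subgroup" for y
    using a0[OF that] a0[OF z(1)] z(2) by linarith
  have *: "avg (q * Suc j) h (x \<otimes> y) = (\<Sum>is\<in>index_seqs k q. u (y \<otimes> word_val is)) / real k ^ q"
    if "y \<in> return_subgroup" for y
  proof -
    have y: "y \<in> carrier G" using that return_subgroup_subset by auto
    have "avg (q + q * j) h (x \<otimes> y) = avg q (avg (q * j) h) (x \<otimes> y)" using x y by (intro avg_add) simp
    also have "\<dots> = (\<Sum>is\<in>index_seqs k q. u (y \<otimes> word_val is)) / real k ^ q"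
      unfolding avg_def[of q] u_def using x y index_seqs_closed by (simp add: m_assoc)
    finally show ?thesis by simp
  qed
  have cl: "y \<otimes> word_val is \<in> return_subgroup" if "y \<in> return_subgroup" "is \<in> index_seqs k q" for y "is"
    using that return_subgroupI[of "is" m] return_subgroup_mult by (simp add: q_def)
  have kq: "real k ^ q > 0" using k_pos by simp
  have "a \<le> avg (q * Suc j) h (x \<otimes> y) \<and> avg (q * Suc j) h (x \<otimes> y) \<le> a + (1 - \<delta>) ^ Suc j"
    if y: "y \<in> return_subgroup" for y
  proof
    have "(\<Sum>is\<in>index_seqs k q. a) \<le> (\<Sum>is\<in>index_seqs k q. u (y \<otimes> word_val is))"
      using y cl lo by (intro sum_mono) auto
    then show "a \<le> avg (q * Suc j) h (x \<otimes> y)"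
      unfolding *[OF y] using kq by (simp add: card_index_seqs le_divide_eq mult.commute)
    \<comment> \<open>The walk reaches the minimizer \<open>z\<close> from \<open>y\<close> with weight at least \<open>\<delta>\<close>.\<close>
    interpret N: subgroup return_subgroup G by (rule subgroup_return_subgroup)
    have "inv y \<otimes> z \<in> return_subgroup" using y z by auto
    then obtain i0 where i0: "i0 \<in> index_seqs k q" "word_val i0 = inv y \<otimes> z"
      using m unfolding q_def by blast
    have "y \<otimes> word_val i0 = z" using y z i0 by (simp add: m_assoc[symmetric])
    then have "(\<Sum>is\<in>index_seqs k q. u (y \<otimes> word_val is))
        = a + (\<Sum>is\<in>index_seqs k q - {i0}. u (y \<otimes> word_val is))"
      using sum.remove[OF finite_index_seqs i0(1), of "\<lambda>is. u (y \<otimes> word_val is)"] z by simp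
    also have "\<dots> \<le> a + (\<Sum>is\<in>index_seqs k q - {i0}. (a + c))"
      using y cl hi by (intro add_left_mono sum_mono) auto
    also have "\<dots> = a + (real k ^ q - 1) * (a + c)"
      using i0 k_pos by (simp add: card_Diff_singleton card_index_seqs of_nat_diff)
    finally have "avg (q * Suc j) h (x \<otimes> y) \<le> (a + (real k ^ q - 1) * (a + c)) / real k ^ q"
      unfolding *[OF y] using kq by (simp add: divide_right_mono)
    also have "\<dots> = a + (1 - \<delta>) * c" using kq by (simp add: \<delta>_def field_simps)
    finally show "avg (q * Suc j) h (x \<otimes> y) \<le> a + (1 - \<delta>) ^ Suc j" by (simp add: c_def)
  qed
  then show ?case unfolding q_def \<delta>_def by blast
qed

text \<open>The mean of the indicator function of \<open>B\<close> over every coset of \<open>return_subgroup\<close> is at most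
  \<open>\<beta>\<close>. Averaging keeps the means and makes the oscillations arbitrarily small, so after finitely many
  steps all averages are at most \<open>\<beta> + \<epsilon>\<close>, and additional steps preserve this bound. Only an upper bound is
  asserted because the coset on which the walk concentrates may depend on \<open>L\<close>.\<close>

theorem walk_limsup:
  assumes dens: "\<And>t. t \<in> carrier G \<Longrightarrow>
      real (card {y \<in> return_subgroup. t \<otimes> y \<in> B}) \<le> \<beta> * real (card return_subgroup)"
    and "\<epsilon> > 0"
  shows "\<exists>L0. \<forall>L\<ge>L0. real (card {is \<in> index_seqs k L. word_val is \<in> B}) / real k ^ L \<le> \<beta> + \<epsilon>"
proof -
  obtain m0 where m0: "\<forall>y\<in>return_subgroup. \<exists>is\<in>index_seqs k (order G * m0). word_val is = y"
    using return_subgroup_uniform_length by blast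
  define q where "q = order G * m0"
  define r where "r = 1 - 1 / real k ^ q"
  have r: "0 \<le> r" "r < 1" using k_pos by (auto simp: r_def divide_simps)
  define h :: "'g \<Rightarrow> real" where "h = indicator B"
  have h: "0 \<le> h y \<and> h y \<le> 1" for y by (simp add: h_def)
  have card_pos: "real (card return_subgroup) > 0"
    using finite_return_subgroup one_in_return_subgroup by (auto simp: card_gt_0_iff)
  have bound: "avg (q * j) h x \<le> \<beta> + r ^ j" if x: "x \<in> carrier G" for x j
  proof -
    let ?u = "\<lambda>y. avg (q * j) h (x \<otimes> y)"
    obtain a where a: "\<And>y. y \<in> return_subgroup \<Longrightarrow> a \<le> ?u y \<and> ?u y \<le> a + r ^ j"
      using avg_oscillation[OF m0 x, of h j] h unfolding q_def r_def by blast
    have "real (card return_subgroup) * a = (\<Sum>y\<in>return_subgroup. a)" by simp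
    also have "\<dots> \<le> (\<Sum>y\<in>return_subgroup. ?u y)" using a by (intro sum_mono) auto
    also have "\<dots> = (\<Sum>y\<in>return_subgroup. h (x \<otimes> y))"
      using sum_avg_coset[OF x, of "m0 * j" h] by (simp add: q_def mult.assoc)
    also have "\<dots> = real (card {y \<in> return_subgroup. x \<otimes> y \<in> B})"
      unfolding h_def by (rule sum_indicator_card[OF finite_return_subgroup])
    also have "\<dots> \<le> \<beta> * real (card return_subgroup)" by (rule dens[OF x])
    finally have "a \<le> \<beta>" using card_pos by (simp add: mult.commute)
    moreover have "?u \<one> \<le> a + r ^ j" using a one_in_return_subgroup by blast
    ultimately show ?thesis using x by simp
  qed
  obtain j0 where j0: "\<And>j. j \<ge> j0 \<Longrightarrow> r ^ j < \<epsilon>"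
  proof -
    have "(\<lambda>j. r ^ j) \<longlonglongrightarrow> 0" using r by (intro LIMSEQ_realpow_zero)
    then have "eventually (\<lambda>j. r ^ j < \<epsilon>) sequentially"
      using \<open>\<epsilon> > 0\<close> by (rule order_tendstoD(2))
    then show ?thesis using that by (auto simp: eventually_sequentially)
  qed
  have "real (card {is \<in> index_seqs k L. word_val is \<in> B}) / real k ^ L \<le> \<beta> + \<epsilon>" if L: "L \<ge> q * j0" for L
  proof -
    have "real (card {is \<in> index_seqs k L. word_val is \<in> B}) = (\<Sum>is\<in>index_seqs k L. h (\<one> \<otimes> word_val is))"
    proof -
      have "(\<Sum>is\<in>index_seqs k L. h (\<one> \<otimes> word_val is)) = (\<Sum>is\<in>index_seqs k L. h (word_val is))"
        using index_seqs_closed by (intro sum.cong) auto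
      then show ?thesis
        using sum_indicator_card[OF finite_index_seqs, where B = B and g = word_val] unfolding h_def by simp
    qed
    then have "real (card {is \<in> index_seqs k L. word_val is \<in> B}) / real k ^ L = avg L h \<one>"
      by (simp add: avg_def)
    also have "\<dots> = avg ((L - q * j0) + q * j0) h \<one>" using L by simp
    also have "\<dots> = avg (L - q * j0) (avg (q * j0) h) \<one>" by (rule avg_add) simp
    also have "\<dots> \<le> \<beta> + \<epsilon>"
    proof (rule avg_le)
      fix y assume "y \<in> carrier G"
      from bound[OF this, of j0] j0[of j0] show "avg (q * j0) h y \<le> \<beta> + \<epsilon>" by simp
    qed simp
    finally show ?thesis .
  qed
  then show ?thesis by blast
qed

end

section \<open>Independence along subgroups\<close>

lemma (in group) card_translate_subgroup:
  assumes N: "subgroup N G" and u: "u \<in> N" and S: "S \<subseteq> N"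
  shows "card {y \<in> N. y \<otimes> u \<in> S} = card S"
proof (rule bij_betw_same_card)
  interpret N: subgroup N G by (rule N)
  have c: "u \<in> carrier G" "inv u \<in> N" using u by auto
  show "bij_betw (\<lambda>y. y \<otimes> u) {y \<in> N. y \<otimes> u \<in> S} S"
    by (rule bij_betwI[where g = "\<lambda>y. y \<otimes> inv u"]) (use c S in \<open>auto simp: m_assoc subset_eq\<close>)
qed

text \<open>Right translation by \<open>U j\<close> moves only the condition \<open>B j\<close>. Adding one condition \<open>B a\<close> therefore
  multiplies the proportion by at most \<open>c\<close>: count the pairs of \<open>y \<in> N\<close> and \<open>u \<in> U a\<close> for which
  \<open>t \<otimes> y \<otimes> u\<close> satisfies all conditions, once by translating \<open>N\<close>, and once by first fixing \<open>y\<close>.\<close>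

lemma (in group) independent_densities:
  fixes B :: "'i \<Rightarrow> 'a set" and U :: "'i \<Rightarrow> 'a set" and c :: real
  assumes finG: "finite (carrier G)" and N: "subgroup N G" and I: "finite I"
    and U: "\<And>i. i \<in> I \<Longrightarrow> subgroup (U i) G" "\<And>i. i \<in> I \<Longrightarrow> U i \<subseteq> N"
    and inv: "\<And>i j x u. i \<in> I \<Longrightarrow> j \<in> I \<Longrightarrow> i \<noteq> j \<Longrightarrow> x \<in> carrier G \<Longrightarrow> u \<in> U j \<Longrightarrow>
        x \<otimes> u \<in> B i \<longleftrightarrow> x \<in> B i"
    and dens: "\<And>i t. i \<in> I \<Longrightarrow> t \<in> carrier G \<Longrightarrow>
        real (card {u \<in> U i. t \<otimes> u \<in> B i}) \<le> c * real (card (U i))"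
    and c: "0 \<le> c" and t: "t \<in> carrier G"
  shows "real (card {y \<in> N. \<forall>i\<in>I. t \<otimes> y \<in> B i}) \<le> c ^ card I * real (card N)"
  using I U inv dens
proof (induction I)
  case empty then show ?case by simp
next
  case (insert a I)
  interpret N: subgroup N G by (rule N)
  interpret Ua: subgroup "U a" G using insert.prems(1) by simp
  have finN: "finite N" using finG N.subset by (rule finite_subset[rotated])
  have UN: "U a \<subseteq> N" using insert.prems(2) by simp
  have finU: "finite (U a)" using UN finN by (rule finite_subset)
  define S where "S = {y \<in> N. \<forall>i\<in>I. t \<otimes> y \<in> B i}"
  define S' where "S' = {y \<in> N. \<forall>i\<in>insert a I. t \<otimes> y \<in> B i}"
  have IH: "real (card S) \<le> c ^ card I * real (card N)"
    unfolding S_def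
  proof (rule insert.IH)
    show "x \<otimes> u \<in> B i \<longleftrightarrow> x \<in> B i"
      if "i \<in> I" "j \<in> I" "i \<noteq> j" "x \<in> carrier G" "u \<in> U j" for i j x u
      by (rule insert.prems(3)) (use that in auto)
  qed (use insert.prems in auto)
  have finS: "finite S" using finN by (simp add: S_def)
  have mem: "y \<otimes> u \<in> S' \<longleftrightarrow> y \<in> S \<and> (t \<otimes> y) \<otimes> u \<in> B a" if "y \<in> N" "u \<in> U a" for y u
  proof -
    have c: "y \<in> carrier G" "u \<in> carrier G" "y \<otimes> u \<in> N" using that UN by auto
    have "t \<otimes> (y \<otimes> u) \<in> B i \<longleftrightarrow> t \<otimes> y \<in> B i" if "i \<in> I" for i
      using insert.prems(3)[of i a "t \<otimes> y" u] insert.hyps that c t \<open>u \<in> U a\<close> by (auto simp: m_assoc)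
    then show ?thesis using c t that by (auto simp: S_def S'_def m_assoc)
  qed
  have "U a \<noteq> {}" using Ua.one_closed by blast
  then have cardU: "0 < real (card (U a))" using finU by (simp add: card_gt_0_iff)
  have "real (card (U a)) * real (card S') = (\<Sum>u\<in>U a. real (card {y \<in> N. y \<otimes> u \<in> S'}))"
    using UN card_translate_subgroup[OF N, of _ S'] by (simp add: S'_def subset_eq)
  also have "\<dots> = (\<Sum>u\<in>U a. \<Sum>y\<in>S. if (t \<otimes> y) \<otimes> u \<in> B a then 1 else 0)"
  proof (rule sum.cong[OF refl])
    fix u assume u: "u \<in> U a"
    have "{y \<in> N. y \<otimes> u \<in> S'} = {y \<in> S. (t \<otimes> y) \<otimes> u \<in> B a}"
      using mem u by (auto simp: S_def)
    then show "real (card {y \<in> N. y \<otimes> u \<in> S'}) = (\<Sum>y\<in>S. if (t \<otimes> y) \<otimes> u \<in> B a then 1 else 0)"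
      using finS by (simp add: sum.inter_filter[symmetric])
  qed
  also have "\<dots> = (\<Sum>y\<in>S. \<Sum>u\<in>U a. if (t \<otimes> y) \<otimes> u \<in> B a then 1 else 0)"
    by (rule sum.swap)
  also have "\<dots> = (\<Sum>y\<in>S. real (card {u \<in> U a. (t \<otimes> y) \<otimes> u \<in> B a}))"
    using finU by (simp add: sum.inter_filter[symmetric])
  also have "\<dots> \<le> (\<Sum>y\<in>S. c * real (card (U a)))"
    using t by (intro sum_mono insert.prems(4)) (auto simp: S_def)
  also have "\<dots> = real (card (U a)) * (c * real (card S))" by simp
  finally have "real (card S') \<le> c * real (card S)"
    using cardU by (simp add: mult_le_cancel_left_pos)
  also have "\<dots> \<le> c * (c ^ card I * real (card N))" using IH c by (rule mult_left_mono)
  finally show ?case unfolding S'_def using insert.hyps by (simp add: mult.assoc)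
qed

section \<open>Homomorphisms from free groups\<close>

definition subst_val :: "('t, 'u) monoid_scheme \<Rightarrow> ('a \<Rightarrow> 't) \<Rightarrow> ('a \<times> bool) list \<Rightarrow> 't" where
  "subst_val T t w = word_prod T (map (\<lambda>(x, a). if a then t x else inv\<^bsub>T\<^esub> t x) w)"

lemma subst_val_Nil [simp]: "subst_val T t [] = \<one>\<^bsub>T\<^esub>"
  by (simp add: subst_val_def word_prod_def)

lemma subst_val_Cons [simp]:
  "subst_val T t (l # w) = (if snd l then t (fst l) else inv\<^bsub>T\<^esub> t (fst l)) \<otimes>\<^bsub>T\<^esub> subst_val T t w"
  by (cases l) (simp add: subst_val_def word_prod_def)

lemma (in group) subst_val_closed:
  "t ` X \<subseteq> carrier G \<Longrightarrow> fst ` set w \<subseteq> X \<Longrightarrow> subst_val G t w \<in> carrier G"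
  by (induction w) (auto simp: image_subset_iff)

lemma (in group) subst_val_append:
  assumes "t ` X \<subseteq> carrier G" "fst ` set w \<subseteq> X" "fst ` set w' \<subseteq> X"
  shows "subst_val G t (w @ w') = subst_val G t w \<otimes> subst_val G t w'"
  using assms(2)
proof (induction w)
  case Nil then show ?case using subst_val_closed[OF assms(1,3)] by simp
next
  case (Cons l w)
  have "t (fst l) \<in> carrier G" "subst_val G t w \<in> carrier G" "subst_val G t w' \<in> carrier G"
    using Cons.prems assms subst_val_closed[OF assms(1)] by auto
  with Cons show ?case by (simp add: m_assoc)
qed

text \<open>Free reduction from the right, needed because the bijection that defines a free basis
  speaks only of reduced words.\<close>

fun reduce :: "('a \<times> bool) list \<Rightarrow> ('a \<times> bool) list" where
  "reduce [] = []"
| "reduce (l # w) = (case reduce w of [] \<Rightarrow> [l]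
     | m # u \<Rightarrow> if fst l = fst m \<and> snd l \<noteq> snd m then u else l # m # u)"

lemma reduce_subset: "set (reduce w) \<subseteq> set w"
  by (induction w) (auto split: list.splits if_splits)

lemma reduce_letters: "fst ` set (reduce w) \<subseteq> fst ` set w"
  using reduce_subset by (rule image_mono)

lemma reduce_freely_reduced: "fst ` set w \<subseteq> X \<Longrightarrow> reduce w \<in> freely_reduced_words X"
proof -
  have "successively (\<lambda>(x, a) (y, b). x = y \<longrightarrow> a = b) (reduce w)"
    by (induction w) (auto split: list.splits if_splits simp: successively_Cons)
  then show "fst ` set w \<subseteq> X \<Longrightarrow> ?thesis"
    using reduce_letters[of w] by (auto simp: freely_reduced_words_def)
qed

lemma (in group) subst_val_reduce:
  assumes t: "t ` X \<subseteq> carrier G" and "fst ` set w \<subseteq> X"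
  shows "subst_val G t (reduce w) = subst_val G t w"
  using assms(2)
proof (induction w)
  case (Cons l w)
  show ?case
  proof (cases "reduce w")
    case Nil then show ?thesis using Cons by simp
  next
    case (Cons m u)
    then have sub: "fst ` set (m # u) \<subseteq> X" using reduce_letters[of w] Cons.prems by auto
    have c: "t (fst l) \<in> carrier G" "t (fst m) \<in> carrier G" "subst_val G t u \<in> carrier G"
      using Cons.prems t sub subst_val_closed[OF t, of u] by auto
    have IH: "subst_val G t w = subst_val G t (m # u)" using Cons.IH Cons.prems Cons by simp
    show ?thesis
    proof (cases "fst l = fst m \<and> snd l \<noteq> snd m")
      case True
      then show ?thesis using Cons IH c by (auto simp: m_assoc[symmetric])
    next
      case False
      then show ?thesis using Cons IH by auto
    qed
  qed
qed simp

lemma letter_val_word: "word_prod G (map (letter_val G) w) = subst_val G (\<lambda>x. x) w"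
  by (simp add: subst_val_def letter_val_def)

lemma hom_subst_val:
  assumes "group G" "group T" "h \<in> hom G T" "X \<subseteq> carrier G" "fst ` set w \<subseteq> X"
  shows "h (subst_val G (\<lambda>x. x) w) = subst_val T h w"
  using assms(5)
proof (induction w)
  case Nil then show ?case using hom_one[OF assms(3,1,2)] by simp
next
  case (Cons l w)
  interpret hh: group_hom G T h using assms by (simp add: group_hom_def group_hom_axioms_def)
  have "fst l \<in> carrier G" "subst_val G (\<lambda>x. x) w \<in> carrier G"
    using Cons.prems assms hh.G.subst_val_closed[of "\<lambda>x. x" X w] by auto
  then show ?case using Cons by simp
qed

locale free_group = group F for F :: "('a, 'b) monoid_scheme" (structure) +
  fixes X :: "'a set"
  assumes basis: "free_basis F X"
begin

lemma X_carrier: "X \<subseteq> carrier F" using basis by (simp add: free_basis_def)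

lemma normal_form:
  "bij_betw (subst_val F (\<lambda>x. x)) (freely_reduced_words X) (carrier F)"
  using basis by (simp add: free_basis_def letter_val_word)

lemma ex_word:
  assumes "g \<in> carrier F"
  shows "\<exists>w\<in>freely_reduced_words X. g = subst_val F (\<lambda>x. x) w"
  using normal_form assms by (auto simp: bij_betw_def)

lemma freely_reduced_letters: "w \<in> freely_reduced_words X \<Longrightarrow> fst ` set w \<subseteq> X"
  by (auto simp: freely_reduced_words_def)

text \<open>Substitution into the normal form is multiplicative because reducing a concatenation of two words
  does not change the result of the substitution in any group.\<close>

theorem universal_property:
  assumes T: "group T" and t: "t ` X \<subseteq> carrier T"
  shows "\<exists>h\<in>hom F T. \<forall>w. fst ` set w \<subseteq> X \<longrightarrow> h (subst_val F (\<lambda>x. x) w) = subst_val T t w"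
proof -
  interpret T: group T by (rule T)
  have X': "(\<lambda>x. x) ` X \<subseteq> carrier F" using X_carrier by simp
  define h where "h g = subst_val T t (the_inv_into (freely_reduced_words X) (subst_val F (\<lambda>x. x)) g)" for g
  have h: "h (subst_val F (\<lambda>x. x) w) = subst_val T t w" if w: "fst ` set w \<subseteq> X" for w
  proof -
    have "subst_val F (\<lambda>x. x) w = subst_val F (\<lambda>x. x) (reduce w)" using subst_val_reduce[OF X' w] ..
    moreover have "the_inv_into (freely_reduced_words X) (subst_val F (\<lambda>x. x))
        (subst_val F (\<lambda>x. x) (reduce w)) = reduce w"
      using normal_form reduce_freely_reduced[OF w] by (intro the_inv_into_f_f) (auto simp: bij_betw_def)
    ultimately show ?thesis using T.subst_val_reduce[OF t w] by (simp add: h_def)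
  qed
  have "h \<in> hom F T"
  proof (rule homI)
    fix g assume "g \<in> carrier F"
    then show "h g \<in> carrier T"
      using ex_word[of g] h freely_reduced_letters T.subst_val_closed[OF t] by auto
  next
    fix g g' assume "g \<in> carrier F" "g' \<in> carrier F"
    then obtain w w' where w: "fst ` set w \<subseteq> X" "g = subst_val F (\<lambda>x. x) w"
      "fst ` set w' \<subseteq> X" "g' = subst_val F (\<lambda>x. x) w'"
      using ex_word[of g] ex_word[of g'] freely_reduced_letters by blast
    have "g \<otimes> g' = subst_val F (\<lambda>x. x) (w @ w')" using subst_val_append[OF X' w(1,3)] w by simp
    then have "h (g \<otimes> g') = subst_val T t (w @ w')" using h[of "w @ w'"] w by (simp add: image_Un)
    then show "h (g \<otimes> g') = h g \<otimes>\<^bsub>T\<^esub> h g'" using T.subst_val_append[OF t w(1,3)] h w by simp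
  qed
  with h show ?thesis by blast
qed

corollary ex_hom_extending:
  assumes "group T" "t ` X \<subseteq> carrier T"
  shows "\<exists>h\<in>hom F T. \<forall>x\<in>X. h x = t x"
proof -
  interpret T: group T by (rule assms(1))
  obtain h where h: "h \<in> hom F T"
    "\<And>w. fst ` set w \<subseteq> X \<Longrightarrow> h (subst_val F (\<lambda>x. x) w) = subst_val T t w"
    using universal_property[OF assms] by blast
  have "h x = t x" if "x \<in> X" for x
    using h(2)[of "[(x, True)]"] that assms(2) X_carrier by (auto simp: subset_eq)
  with h(1) show ?thesis by blast
qed

lemma hom_eqI:
  assumes T: "group T" and h: "h \<in> hom F T" "h' \<in> hom F T" and eq: "\<And>x. x \<in> X \<Longrightarrow> h x = h' x"
    and g: "g \<in> carrier F"
  shows "h g = h' g"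
proof -
  obtain w where w: "fst ` set w \<subseteq> X" "g = subst_val F (\<lambda>x. x) w"
    using ex_word[OF g] freely_reduced_letters by blast
  have "subst_val T h w = subst_val T h' w"
    using w(1) eq by (induction w) auto
  then show ?thesis
    using hom_subst_val[OF is_group T h(1) X_carrier w(1)] hom_subst_val[OF is_group T h(2) X_carrier w(1)] w
    by simp
qed

end

section \<open>Additive functions on free products\<close>

context group begin

text \<open>Brings a word of syllables into the normal form by which free products are defined.\<close>

fun merge :: "('i \<times> 'a) list \<Rightarrow> ('i \<times> 'a) list" where
  "merge [] = []"
| "merge (l # w) = (if snd l = \<one> then merge w else case merge w of [] \<Rightarrow> [l]
     | m # u \<Rightarrow> if fst l \<noteq> fst m then l # m # u
         else if snd l \<otimes> snd m = \<one> then u else (fst l, snd l \<otimes> snd m) # u)"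

lemma word_prod_simps [simp]: "word_prod G [] = \<one>" "word_prod G (x # xs) = x \<otimes> word_prod G xs"
  by (auto simp: word_prod_def)

lemma word_prod_closed: "set xs \<subseteq> carrier G \<Longrightarrow> word_prod G xs \<in> carrier G"
  by (induction xs) auto

lemma word_prod_append:
  "set xs \<subseteq> carrier G \<Longrightarrow> set ys \<subseteq> carrier G \<Longrightarrow> word_prod G (xs @ ys) = word_prod G xs \<otimes> word_prod G ys"
  by (induction xs) (auto simp: m_assoc word_prod_closed)

lemma syllables_carrier:
  assumes "\<And>i. i \<in> I \<Longrightarrow> subgroup (H i) G" "set w \<subseteq> Sigma I H"
  shows "set (map snd w) \<subseteq> carrier G"
proof
  fix z assume "z \<in> set (map snd w)"
  then obtain i where "(i, z) \<in> set w" by auto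
  then have i: "i \<in> I" "z \<in> H i" using assms(2) by auto
  show "z \<in> carrier G" by (rule subgroup.mem_carrier[OF assms(1)[OF i(1)] i(2)])
qed

text \<open>Neither the product of the syllables nor the total of a family of additive functions on the
  factors is changed by normalization.\<close>

lemma merge_properties:
  fixes \<gamma> :: "'i \<Rightarrow> 'a \<Rightarrow> int"
  assumes H: "\<And>i. i \<in> I \<Longrightarrow> subgroup (H i) G"
    and \<gamma>: "\<And>i x y. i \<in> I \<Longrightarrow> x \<in> H i \<Longrightarrow> y \<in> H i \<Longrightarrow> \<gamma> i (x \<otimes> y) = \<gamma> i x + \<gamma> i y"
    and "set w \<subseteq> Sigma I H"
  shows "merge w \<in> free_product_words G I H \<and> word_prod G (map snd (merge w)) = word_prod G (map snd w)
     \<and> (\<Sum>l\<leftarrow>merge w. \<gamma> (fst l) (snd l)) = (\<Sum>l\<leftarrow>w. \<gamma> (fst l) (snd l))"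
  using assms(3)
proof (induction w)
  case Nil then show ?case by (simp add: free_product_words_def)
next
  case (Cons l w)
  obtain i x where l: "l = (i, x)" by (cases l)
  have i: "i \<in> I" "x \<in> H i" "x \<in> carrier G" using Cons.prems l H by (auto dest: subgroup.mem_carrier)
  interpret Hi: subgroup "H i" G using H i by simp
  have \<gamma>1: "\<gamma> i \<one> = 0" using \<gamma>[of i \<one> \<one>] i by simp
  have IH: "merge w \<in> free_product_words G I H" "word_prod G (map snd (merge w)) = word_prod G (map snd w)"
    "(\<Sum>l\<leftarrow>merge w. \<gamma> (fst l) (snd l)) = (\<Sum>l\<leftarrow>w. \<gamma> (fst l) (snd l))"
    using Cons.IH Cons.prems by auto
  have sub: "set (map snd (merge w)) \<subseteq> carrier G"
  proof (rule syllables_carrier[OF H])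
    show "set (merge w) \<subseteq> Sigma I H" using IH(1) by (auto simp: free_product_words_def)
  qed
  show ?case
  proof (cases "x = \<one>")
    case True
    then show ?thesis using IH l \<gamma>1 word_prod_closed[OF sub] by simp
  next
    case x1: False
    show ?thesis
    proof (cases "merge w")
      case Nil
      then show ?thesis using IH l x1 i by (auto simp: free_product_words_def)
    next
      case (Cons m u)
      obtain j y where m: "m = (j, y)" by (cases m)
      have y: "j \<in> I" "y \<in> H j" "y \<noteq> \<one>" "y \<in> carrier G" and u: "word_prod G (map snd u) \<in> carrier G"
        using IH(1) Cons m sub word_prod_closed[of "map snd u"] by (auto simp: free_product_words_def)
      show ?thesis
      proof (cases "i = j")
        case False
        then show ?thesis using IH l x1 i Cons m by (auto simp: free_product_words_def)
      next
        case True
        have xy: "x \<otimes> y \<in> H i" using Hi.m_closed[of x y] i y True by blast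
        have sum: "\<gamma> i (x \<otimes> y) = \<gamma> i x + \<gamma> i y" using \<gamma> i y True by simp
        have pr: "x \<otimes> y \<otimes> word_prod G (map snd u) = x \<otimes> word_prod G (map snd w)"
          using IH(2) Cons m i y u by (simp add: m_assoc)
        show ?thesis
        proof (cases "x \<otimes> y = \<one>")
          case xy1: True
          have "u \<in> free_product_words G I H"
            using IH(1) Cons by (auto simp: free_product_words_def distinct_adj_Cons)
          moreover have "word_prod G (map snd u) = x \<otimes> word_prod G (map snd w)"
            using pr xy1 u by simp
          moreover have "(\<Sum>l\<leftarrow>u. \<gamma> (fst l) (snd l)) = \<gamma> i x + (\<Sum>l\<leftarrow>w. \<gamma> (fst l) (snd l))"
            using IH(3) Cons m True sum xy1 \<gamma>1 by simp
          ultimately show ?thesis using l x1 Cons m True xy1 by simp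
        next
          case xy1: False
          have "(i, x \<otimes> y) # u \<in> free_product_words G I H"
            using IH(1) Cons m True xy xy1 i by (auto simp: free_product_words_def distinct_adj_Cons)
          moreover have "\<gamma> i (x \<otimes> y) + (\<Sum>l\<leftarrow>u. \<gamma> (fst l) (snd l)) = \<gamma> i x + (\<Sum>l\<leftarrow>w. \<gamma> (fst l) (snd l))"
            using IH(3) Cons m True sum by simp
          ultimately show ?thesis using l x1 Cons m True xy1 pr by simp
        qed
      qed
    qed
  qed
qed

text \<open>The universal property of free products, for homomorphisms to \<open>\<int>\<close>: the values of the
  syllables of the normal form are added up.\<close>

theorem free_product_extend_additive:
  fixes \<gamma> :: "'i \<Rightarrow> 'a \<Rightarrow> int"
  assumes fp: "is_free_product G I H (carrier G)"
    and \<gamma>: "\<And>i x y. i \<in> I \<Longrightarrow> x \<in> H i \<Longrightarrow> y \<in> H i \<Longrightarrow> \<gamma> i (x \<otimes> y) = \<gamma> i x + \<gamma> i y"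
  shows "\<exists>\<beta>\<in>hom G integer_group. \<forall>i\<in>I. \<forall>x\<in>H i. \<beta> x = \<gamma> i x"
proof -
  have H: "\<And>i. i \<in> I \<Longrightarrow> subgroup (H i) G"
    and bij: "bij_betw (\<lambda>w. word_prod G (map snd w)) (free_product_words G I H) (carrier G)"
    using fp by (auto simp: is_free_product_def)
  define s where "s w = (\<Sum>l\<leftarrow>w. \<gamma> (fst l) (snd l))" for w
  define \<beta> where "\<beta> g = s (the_inv_into (free_product_words G I H) (\<lambda>w. word_prod G (map snd w)) g)" for g
  have \<beta>: "\<beta> (word_prod G (map snd w)) = s w" if w: "set w \<subseteq> Sigma I H" for w
  proof -
    note mp = merge_properties[of I H \<gamma>, OF H \<gamma> w, simplified]
    have "the_inv_into (free_product_words G I H) (\<lambda>w. word_prod G (map snd w))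
        (word_prod G (map snd (merge w))) = merge w"
      using bij mp by (intro the_inv_into_f_f) (auto simp: bij_betw_def)
    then show ?thesis using mp by (simp add: \<beta>_def s_def)
  qed
  have words: "\<exists>w. set w \<subseteq> Sigma I H \<and> g = word_prod G (map snd w)" if "g \<in> carrier G" for g
  proof -
    have "g \<in> (\<lambda>w. word_prod G (map snd w)) ` free_product_words G I H"
      using bij that by (simp add: bij_betw_def)
    then obtain w where "w \<in> free_product_words G I H" "g = word_prod G (map snd w)" by blast
    then show ?thesis by (intro exI[of _ w]) (auto simp: free_product_words_def)
  qed
  have sub: "set (map snd w) \<subseteq> carrier G" if "set w \<subseteq> Sigma I H" for w
    by (rule syllables_carrier[OF H that])
  have "\<beta> \<in> hom G integer_group"
  proof (rule homI)
    fix g g' assume "g \<in> carrier G" "g' \<in> carrier G"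
    then obtain w w' where w: "set w \<subseteq> Sigma I H" "g = word_prod G (map snd w)"
      "set w' \<subseteq> Sigma I H" "g' = word_prod G (map snd w')" using words[of g] words[of g'] by blast
    have "g \<otimes> g' = word_prod G (map snd (w @ w'))"
      using word_prod_append[OF sub[OF w(1)] sub[OF w(3)]] w by simp
    then show "\<beta> (g \<otimes> g') = \<beta> g \<otimes>\<^bsub>integer_group\<^esub> \<beta> g'"
      using \<beta>[of "w @ w'"] \<beta>[OF w(1)] \<beta>[OF w(3)] w by (simp add: s_def)
  qed simp
  moreover have "\<beta> x = \<gamma> i x" if "i \<in> I" "x \<in> H i" for i x
    using \<beta>[of "[(i, x)]"] that sub[of "[(i, x)]"] by (simp add: s_def)
  ultimately show ?thesis by blast
qed

end

section \<open>The Magnus expansion\<close>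

text \<open>Functions on lists represent power series in noncommuting variables; a list is a monomial and
  \<open>conv\<close> is the product of series, which sums over all splittings of a monomial.\<close>

fun conv :: "('a list \<Rightarrow> int) \<Rightarrow> ('a list \<Rightarrow> int) \<Rightarrow> 'a list \<Rightarrow> int" where
  "conv f g [] = f [] * g []"
| "conv f g (x # u) = f [] * g (x # u) + conv (\<lambda>v. f (x # v)) g u"

definition conv_one :: "'a list \<Rightarrow> int" where
  "conv_one u = (if u = [] then 1 else 0)"

lemma conv_linear: "conv (\<lambda>v. c * f v + f' v) g u = c * conv f g u + conv f' g u"
  by (induction u arbitrary: f f') (auto simp: algebra_simps)

lemma conv_zero [simp]: "conv (\<lambda>v. 0) g u = 0"
  by (induction u) auto

lemma conv_assoc: "conv (conv f g) h u = conv f (conv g h) u"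
proof (induction u arbitrary: f)
  case (Cons x u)
  have "conv (conv f g) h (x # u) = f [] * g [] * h (x # u)
      + conv (\<lambda>v. f [] * g (x # v) + conv (\<lambda>v. f (x # v)) g v) h u" by simp
  also have "conv (\<lambda>v. f [] * g (x # v) + conv (\<lambda>v. f (x # v)) g v) h u
      = f [] * conv (\<lambda>v. g (x # v)) h u + conv (conv (\<lambda>v. f (x # v)) g) h u"
    by (rule conv_linear)
  finally show ?case using Cons by (simp add: algebra_simps)
qed simp

lemma conv_one_left: "conv conv_one g u = g u"
  by (cases u) (auto simp: conv_one_def)

lemma conv_one_right: "conv f conv_one u = f u"
  by (induction u arbitrary: f) (auto simp: conv_one_def)

definition series_monoid :: "('a list \<Rightarrow> int) monoid" where
  "series_monoid = \<lparr>carrier = UNIV, monoid.mult = conv, one = conv_one\<rparr>"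

lemma monoid_series: "monoid (series_monoid :: ('a list \<Rightarrow> int) monoid)"
  by unfold_locales (auto simp: series_monoid_def conv_assoc conv_one_left conv_one_right fun_eq_iff)

definition series_group :: "('a list \<Rightarrow> int) monoid" where
  "series_group = units_of series_monoid"

lemma group_series: "group series_group"
  unfolding series_group_def by (rule monoid.units_group[OF monoid_series])

lemma series_group_mult [simp]: "f \<otimes>\<^bsub>series_group\<^esub> g = conv f g"
  by (simp add: series_group_def series_monoid_def units_of_def)

lemma series_group_one [simp]: "\<one>\<^bsub>series_group\<^esub> = conv_one"
  by (simp add: series_group_def series_monoid_def units_of_def)

text \<open>The series \<open>1 + x\<close>, whose inverse is \<open>1 - x + x\<^sup>2 - \<dots>\<close>.\<close>

definition var_series :: "'a \<Rightarrow> 'a list \<Rightarrow> int" where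
  "var_series x u = (if u = [] \<or> u = [x] then 1 else 0)"

definition var_series_inv :: "'a \<Rightarrow> 'a list \<Rightarrow> int" where
  "var_series_inv x u = (if set u \<subseteq> {x} then (-1) ^ length u else 0)"

lemma conv_var_series: "conv (var_series x) g u = g u + (case u of [] \<Rightarrow> 0 | y # u' \<Rightarrow> if y = x then g u' else 0)"
proof (cases u)
  case (Cons y u')
  have "(\<lambda>v. var_series x (y # v)) = (if y = x then conv_one else (\<lambda>v. 0))"
    by (auto simp: var_series_def conv_one_def)
  then show ?thesis using Cons by (simp add: conv_one_left var_series_def)
qed (simp add: var_series_def)

lemma var_series_right_inv: "conv (var_series x) (var_series_inv x) = conv_one"
  by (rule ext) (auto simp: conv_var_series var_series_inv_def conv_one_def split: list.splits)

lemma var_series_left_inv: "conv (var_series_inv x) (var_series x) = conv_one"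
proof
  fix u :: "'a list"
  have base: "conv (\<lambda>v. c * var_series_inv x v) (var_series x) u = c * conv_one u" for c
  proof (induction u arbitrary: c)
    case (Cons y u)
    show ?case
    proof (cases "y = x")
      case True
      have "(\<lambda>v. c * var_series_inv x (y # v)) = (\<lambda>v. (- c) * var_series_inv x v)"
        using True by (auto simp: var_series_inv_def)
      then show ?thesis using Cons[of "- c"] True
        by (auto simp: var_series_inv_def var_series_def conv_one_def)
    next
      case False
      then have "(\<lambda>v. c * var_series_inv x (y # v)) = (\<lambda>v. 0)" by (auto simp: var_series_inv_def)
      then show ?thesis using False by (auto simp: var_series_def conv_one_def)
    qed
  qed (simp add: var_series_inv_def var_series_def conv_one_def)
  from base[of 1] show "conv (var_series_inv x) (var_series x) u = conv_one u" by simp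
qed

lemma var_series_carrier: "var_series x \<in> carrier series_group"
  unfolding series_group_def units_of_def Units_def series_monoid_def
  using var_series_left_inv[of x] var_series_right_inv[of x] by auto

lemma inv_var_series: "inv\<^bsub>series_group\<^esub> (var_series x) = var_series_inv x"
proof (rule group.inv_equality[OF group_series])
  show "var_series_inv x \<in> carrier series_group"
    unfolding series_group_def units_of_def Units_def series_monoid_def
    using var_series_left_inv[of x] var_series_right_inv[of x] by auto
qed (use var_series_left_inv var_series_carrier in auto)

text \<open>The Magnus expansion substitutes \<open>1 + x\<close> for each basis element \<open>x\<close>.\<close>

definition magnus :: "('a \<times> bool) list \<Rightarrow> 'a list \<Rightarrow> int" where
  "magnus w = subst_val series_group var_series w"

lemma magnus_Nil: "magnus [] = conv_one"
  by (simp add: magnus_def)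

lemma magnus_Cons: "magnus (l # w) = conv (if snd l then var_series (fst l) else var_series_inv (fst l)) (magnus w)"
  by (simp add: magnus_def inv_var_series)

text \<open>The series that involve only the variable \<open>x\<close> and agree with \<open>(1 + x)\<^sup>e\<close> up to terms divisible
  by \<open>x\<^sup>2\<close>.\<close>

definition power_shape :: "'a \<Rightarrow> int \<Rightarrow> ('a list \<Rightarrow> int) \<Rightarrow> bool" where
  "power_shape x e f \<longleftrightarrow> f [] = 1 \<and> f [x] = e \<and> (\<forall>v. \<not> set v \<subseteq> {x} \<longrightarrow> f v = 0)"

lemma conv_eq_0:
  assumes "\<forall>v. \<not> set v \<subseteq> {x} \<longrightarrow> f v = 0" "\<forall>v. \<not> set v \<subseteq> {x} \<longrightarrow> g v = 0" "\<not> set u \<subseteq> {x}"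
  shows "conv f g u = 0"
  using assms
proof (induction u arbitrary: f)
  case (Cons y u)
  show ?case
  proof (cases "y = x")
    case True
    then have "conv (\<lambda>v. f (y # v)) g u = 0" using Cons.prems by (intro Cons.IH) auto
    then show ?thesis using Cons.prems by simp
  next
    case False
    then have "(\<lambda>v. f (y # v)) = (\<lambda>v. 0)" using Cons.prems by auto
    then show ?thesis using Cons.prems by simp
  qed
qed simp

lemma power_shape_conv: "power_shape x e f \<Longrightarrow> power_shape x e' g \<Longrightarrow> power_shape x (e + e') (conv f g)"
  unfolding power_shape_def using conv_eq_0[of x f g] by auto

lemma magnus_replicate:
  "power_shape x (if a then int m else - int m) (magnus (replicate m (x, a)))"
proof (induction m)
  case 0 show ?case by (auto simp: power_shape_def magnus_Nil conv_one_def)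
next
  case (Suc m)
  have "power_shape x (if a then 1 else -1) (if a then var_series x else var_series_inv x)"
    by (auto simp: power_shape_def var_series_def var_series_inv_def)
  from power_shape_conv[OF this Suc] show ?case by (cases a) (simp_all add: magnus_Cons)
qed

lemma magnus_append:
  fixes w w' :: "('a \<times> bool) list"
  shows "magnus (w @ w') = conv (magnus w) (magnus w')"
proof -
  have "range (var_series :: 'a \<Rightarrow> _) \<subseteq> carrier series_group"
    by (simp add: image_subset_iff var_series_carrier)
  from group.subst_val_append[OF group_series this, of w w'] show ?thesis by (simp add: magnus_def)
qed

lemma conv_power_shape:
  assumes f: "power_shape x e f" and u: "distinct_adj u"
  shows "conv f g u = g u + (case u of [] \<Rightarrow> 0 | y # u' \<Rightarrow> if y = x then e * g u' else 0)"
proof (cases u)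
  case Nil then show ?thesis using f by (simp add: power_shape_def)
next
  case (Cons y u')
  show ?thesis
  proof (cases "y = x")
    case False
    then have "(\<lambda>v. f (y # v)) = (\<lambda>v. 0)" using f by (auto simp: power_shape_def)
    then show ?thesis using f Cons False by (simp add: power_shape_def)
  next
    case True
    have "conv (\<lambda>v. f (y # v)) g u' = e * g u'"
    proof (cases u')
      case Nil then show ?thesis using f True by (simp add: power_shape_def)
    next
      case (Cons z u'')
      then have "z \<noteq> x" using u True \<open>u = y # u'\<close> by (auto simp: distinct_adj_Cons)
      then have "(\<lambda>v. f (y # z # v)) = (\<lambda>v. 0)" using f by (auto simp: power_shape_def)
      then show ?thesis using f Cons True by (simp add: power_shape_def)
    qed
    then show ?thesis using f Cons True by (simp add: power_shape_def)
  qed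
qed

lemma reduced_block_decomposition:
  assumes "w \<in> freely_reduced_words X" "w \<noteq> []"
  shows "\<exists>x a m r. w = replicate (Suc m) (x, a) @ r \<and> r \<in> freely_reduced_words X \<and> (r = [] \<or> fst (hd r) \<noteq> x)"
  using assms
proof (induction w)
  case (Cons l w)
  obtain x a where l: "l = (x, a)" by (cases l)
  have w: "w \<in> freely_reduced_words X"
    using Cons.prems by (auto simp: freely_reduced_words_def successively_Cons)
  show ?case
  proof (cases "w = [] \<or> fst (hd w) \<noteq> x")
    case True
    then show ?thesis using l w
      by (intro exI[of _ x] exI[of _ a] exI[of _ 0] exI[of _ w]) auto
  next
    case False
    then obtain y b m r where d: "w = replicate (Suc m) (y, b) @ r" "r \<in> freely_reduced_words X"
      "r = [] \<or> fst (hd r) \<noteq> y" using Cons.IH[OF w] by blast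
    have "y = x" using False d(1) by simp
    moreover have "b = a" using Cons.prems l d(1) \<open>y = x\<close>
      by (auto simp: freely_reduced_words_def successively_Cons)
    ultimately show ?thesis using d l
      by (intro exI[of _ x] exI[of _ a] exI[of _ "Suc m"] exI[of _ r]) auto
  qed
qed simp

text \<open>The bases of the maximal powers in a reduced word, in order.\<close>

definition syllables :: "('a \<times> bool) list \<Rightarrow> 'a list" where
  "syllables w = remdups_adj (map fst w)"

lemma syllables_block:
  assumes "r = [] \<or> fst (hd r) \<noteq> x"
  shows "syllables (replicate (Suc m) (x, a) @ r) = x # syllables r"
proof (induction m)
  case 0 show ?case using assms by (cases r) (auto simp: syllables_def remdups_adj_Cons split: list.splits)
next
  case (Suc m) then show ?case by (simp add: syllables_def)
qed

text \<open>If a reduced word is a product of \<open>r\<close> maximal powers \<open>x\<^sub>i\<close> to the \<open>e\<^sub>i\<close>, then only by taking the linear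
  term \<open>e\<^sub>i x\<^sub>i\<close> from each factor does one reach a monomial of degree at least \<open>r\<close> without repeated adjacent
  letters. The coefficient of \<open>x\<^sub>1 \<cdots> x\<^sub>r\<close> is thus \<open>e\<^sub>1 \<cdots> e\<^sub>r\<close>, which is nonzero.\<close>

lemma magnus_top_coefficient:
  assumes "w \<in> freely_reduced_words X" "distinct_adj u" "length u \<ge> length (syllables w)"
  shows "magnus w u \<noteq> 0 \<longleftrightarrow> u = syllables w"
  using assms
proof (induction "length w" arbitrary: w u rule: less_induct)
  case less
  show ?case
  proof (cases "w = []")
    case True then show ?thesis by (auto simp: magnus_Nil conv_one_def syllables_def)
  next
    case False
    obtain x a m r where w: "w = replicate (Suc m) (x, a) @ r" and r: "r \<in> freely_reduced_words X"
      "r = [] \<or> fst (hd r) \<noteq> x" using reduced_block_decomposition[OF less.prems(1) False] by blast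
    have syl: "syllables w = x # syllables r" unfolding w by (rule syllables_block[OF r(2)])
    obtain e where e: "power_shape x e (magnus (replicate (Suc m) (x, a)))" "e \<noteq> 0"
      using magnus_replicate[of x a "Suc m"] by (cases a) auto
    have len: "length r < length w" using w by simp
    obtain y u' where u: "u = y # u'" using less.prems(3) syl by (cases u) auto
    have u': "distinct_adj u'" using less.prems(2) u by (auto simp: distinct_adj_Cons)
    have "magnus r u = 0"
      using less.hyps[OF len r(1) less.prems(2)] less.prems(3) syl by auto
    moreover have "magnus r u' \<noteq> 0 \<longleftrightarrow> u' = syllables r"
      using less.hyps[OF len r(1) u'] less.prems(3) syl u by simp
    moreover have "magnus w u = magnus r u + (if y = x then e * magnus r u' else 0)"
      unfolding w magnus_append conv_power_shape[OF e(1) less.prems(2)] using u by simp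
    ultimately show ?thesis using e(2) u syl by auto
  qed
qed

text \<open>In \<open>(1 + f') (1 + g')\<close> the cross terms have higher degree than the lowest terms of \<open>f'\<close> and
  \<open>g'\<close>, so the coefficients of lowest degree are additive.\<close>

lemma conv_lowest_degree:
  assumes "f [] = 1" "g [] = 1"
    and "\<And>v. v \<noteq> [] \<Longrightarrow> length v < length u \<Longrightarrow> f v = 0"
    and "\<And>v. v \<noteq> [] \<Longrightarrow> length v < length u \<Longrightarrow> g v = 0" and "u \<noteq> []"
  shows "conv f g u = f u + g u"
proof -
  have *: "conv h g v = h v" if "\<And>v'. length v' < length v \<Longrightarrow> h v' = 0" for h v
    using that
  proof (induction v arbitrary: h)
    case (Cons y v)
    have "conv (\<lambda>v. h (y # v)) g v = h (y # v)" using Cons.prems by (intro Cons.IH) auto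
    then show ?case using Cons.prems[of "[]"] by simp
  qed (use assms in simp)
  obtain y u' where u: "u = y # u'" using assms(5) by (cases u) auto
  have "conv (\<lambda>v. f (y # v)) g u' = f (y # u')" using assms(3) u by (intro *) auto
  then show ?thesis using u assms by simp
qed

context free_group begin

text \<open>Among the nonconstant monomials with a nonzero coefficient in the Magnus expansion of some
  element of \<open>H\<close>, one of least degree has a coefficient that is additive on \<open>H\<close>. Such a monomial exists
  because the Magnus expansion of a nontrivial element is not \<open>1\<close>.\<close>

theorem ex_additive_nonzero_on_subgroup:
  assumes H: "subgroup H F" "H \<noteq> {\<one>}"
  shows "\<exists>\<gamma> :: 'a \<Rightarrow> int. (\<forall>x\<in>H. \<forall>y\<in>H. \<gamma> (x \<otimes> y) = \<gamma> x + \<gamma> y) \<and> (\<exists>h\<in>H. \<gamma> h \<noteq> 0)"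
proof -
  interpret H: subgroup H F by (rule H(1))
  have "var_series ` X \<subseteq> carrier series_group" by (simp add: image_subset_iff var_series_carrier)
  from universal_property[OF group_series this] obtain M where M: "M \<in> hom F series_group"
    and "\<forall>w. fst ` set w \<subseteq> X \<longrightarrow> M (subst_val F (\<lambda>x. x) w) = subst_val series_group var_series w"
    by (rule bexE)
  then have Mw: "M (subst_val F (\<lambda>x. x) w) = magnus w" if "fst ` set w \<subseteq> X" for w
    using that by (simp add: magnus_def)
  have M1: "M g [] = 1" if "g \<in> carrier F" for g
  proof -
    have "magnus w [] = 1" for w :: "('a \<times> bool) list"
      by (induction w) (auto simp: magnus_Nil magnus_Cons conv_one_def var_series_def var_series_inv_def)
    then show ?thesis using ex_word[OF that] Mw freely_reduced_letters by auto
  qed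
  obtain h0 where h0: "h0 \<in> H" "h0 \<noteq> \<one>" using H(2) H.one_closed by blast
  have "h0 \<in> carrier F" using h0 H.subset by blast
  then obtain w where w: "w \<in> freely_reduced_words X" "h0 = subst_val F (\<lambda>x. x) w"
    using ex_word by blast
  have "w \<noteq> []" using h0 w by auto
  then have "syllables w \<noteq> []" by (simp add: syllables_def)
  moreover have "M h0 (syllables w) \<noteq> 0"
    using magnus_top_coefficient[OF w(1), of "syllables w"] Mw[OF freely_reduced_letters[OF w(1)]] w(2)
    by (simp add: syllables_def)
  ultimately have ex: "\<exists>d u h. length u = d \<and> u \<noteq> [] \<and> h \<in> H \<and> M h u \<noteq> 0"
    using h0(1) by (intro exI[of _ "length (syllables w)"] exI[of _ "syllables w"] exI[of _ h0]) simp
  define d where "d = (LEAST d. \<exists>u h. length u = d \<and> u \<noteq> [] \<and> h \<in> H \<and> M h u \<noteq> 0)"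
  obtain u h where u: "length u = d" "u \<noteq> []" "h \<in> H" "M h u \<noteq> 0"
    using LeastI_ex[OF ex] unfolding d_def by blast
  have low: "M g v = 0" if "v \<noteq> []" "length v < d" "g \<in> H" for v g
    using not_less_Least[of "length v" "\<lambda>d. \<exists>u h. length u = d \<and> u \<noteq> [] \<and> h \<in> H \<and> M h u \<noteq> 0"] that
    unfolding d_def by blast
  have "M (x \<otimes> y) u = M x u + M y u" if "x \<in> H" "y \<in> H" for x y
  proof -
    have c: "x \<in> carrier F" "y \<in> carrier F" using that H.subset by auto
    have "M (x \<otimes> y) u = conv (M x) (M y) u" using hom_mult[OF M c] by simp
    also have "\<dots> = M x u + M y u"
      by (rule conv_lowest_degree) (use M1 c low that u in auto)
    finally show ?thesis .
  qed
  with u show ?thesis by (intro exI[of _ "\<lambda>g. M g u"]) blast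
qed

text \<open>The image of a nonzero additive function is generated by its least positive value; divide by it.\<close>

lemma ex_additive_one_on_subgroup:
  assumes H: "subgroup H F" "H \<noteq> {\<one>}"
  shows "\<exists>\<gamma> :: 'a \<Rightarrow> int. (\<forall>x\<in>H. \<forall>y\<in>H. \<gamma> (x \<otimes> y) = \<gamma> x + \<gamma> y) \<and> (\<exists>h\<in>H. \<gamma> h = 1)"
proof -
  interpret H: subgroup H F by (rule H(1))
  obtain \<gamma> :: "'a \<Rightarrow> int" where \<gamma>: "\<And>x y. x \<in> H \<Longrightarrow> y \<in> H \<Longrightarrow> \<gamma> (x \<otimes> y) = \<gamma> x + \<gamma> y" "\<exists>h\<in>H. \<gamma> h \<noteq> 0"
    using ex_additive_nonzero_on_subgroup[OF H] by blast
  have one: "\<gamma> \<one> = 0" using \<gamma>(1)[of \<one> \<one>] by simp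
  have inv: "\<gamma> (inv x) = - \<gamma> x" if "x \<in> H" for x
  proof -
    have "\<gamma> (inv x \<otimes> x) = \<gamma> (inv x) + \<gamma> x" using that by (intro \<gamma>(1)) auto
    then show ?thesis using one that H.subset by auto
  qed
  have pos: "\<exists>h\<in>H. \<gamma> h > 0"
    using \<gamma>(2) inv by (metis H.m_inv_closed linorder_neqE_linordered_idom neg_0_less_iff_less)
  have "\<exists>m h. h \<in> H \<and> \<gamma> h = int (Suc m)"
    using pos by (metis zero_less_imp_eq_int gr0_conv_Suc)
  define m where "m = (LEAST m. \<exists>h. h \<in> H \<and> \<gamma> h = int (Suc m))"
  obtain h where h: "h \<in> H" "\<gamma> h = int (Suc m)"
    using LeastI_ex[OF \<open>\<exists>m h. h \<in> H \<and> \<gamma> h = int (Suc m)\<close>] unfolding m_def by blast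
  have npow: "g [^] (n::nat) \<in> H \<and> \<gamma> (g [^] n) = int n * \<gamma> g" if "g \<in> H" for g n
    by (induction n) (use that \<gamma>(1) one in \<open>auto simp: algebra_simps\<close>)
  have mult: "\<exists>g\<in>H. \<gamma> g = c * \<gamma> h" for c
  proof (cases "c \<ge> 0")
    case True then show ?thesis using npow[OF h(1), of "nat c"] by auto
  next
    case False
    have "inv h \<in> H" using h by simp
    from npow[OF this, of "nat (- c)"] False inv[OF h(1)] show ?thesis by auto
  qed
  have dvd: "\<gamma> h dvd \<gamma> g" if g: "g \<in> H" for g
  proof (rule ccontr)
    assume nd: "\<not> \<gamma> h dvd \<gamma> g"
    obtain g' where g': "g' \<in> H" "\<gamma> g' = - (\<gamma> g div \<gamma> h) * \<gamma> h" using mult by blast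
    define r where "r = \<gamma> (g \<otimes> g')"
    have "r = \<gamma> g mod \<gamma> h" using \<gamma>(1)[OF g g'(1)] g'(2) by (simp add: r_def minus_div_mult_eq_mod[symmetric])
    moreover have "\<gamma> h > 0" using h by simp
    moreover have "\<gamma> g mod \<gamma> h \<noteq> 0" using nd by (simp add: dvd_eq_mod_eq_0)
    ultimately have "r > 0" "r < \<gamma> h"
      using pos_mod_sign[of "\<gamma> h" "\<gamma> g"] pos_mod_bound[of "\<gamma> h" "\<gamma> g"] by linarith+
    then obtain m' where m': "r = int (Suc m')" by (metis zero_less_imp_eq_int gr0_conv_Suc)
    have "m' < m" using m' \<open>r < \<gamma> h\<close> h by simp
    then show False using not_less_Least[of m'] m' g g'(1) unfolding m_def r_def by blast
  qed
  define \<gamma>' where "\<gamma>' g = \<gamma> g div \<gamma> h" for g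
  have "\<gamma>' (x \<otimes> y) = \<gamma>' x + \<gamma>' y" if "x \<in> H" "y \<in> H" for x y
    using that \<gamma>(1) dvd by (simp add: \<gamma>'_def div_plus_div_distrib_dvd_left)
  moreover have "\<gamma>' h = 1" using h by (simp add: \<gamma>'_def)
  ultimately show ?thesis using h by blast
qed

text \<open>The additive function on \<open>H i\<close> is extended by zero to the other factors. This is what
  separates the images of complementary free factors in the abelianization, modulo every prime.\<close>

theorem free_factor_functional:
  assumes fp: "is_free_product F I H (carrier F)" and i: "i \<in> I" "H i \<noteq> {\<one>}"
  shows "\<exists>\<beta>\<in>hom F integer_group. (\<exists>h\<in>H i. \<beta> h = 1) \<and> (\<forall>j\<in>I - {i}. \<forall>x\<in>H j. \<beta> x = 0)"
proof -
  have "subgroup (H i) F" using fp i by (simp add: is_free_product_def)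
  from ex_additive_one_on_subgroup[OF this i(2)] obtain \<gamma> :: "'a \<Rightarrow> int"
    where \<gamma>: "\<forall>x\<in>H i. \<forall>y\<in>H i. \<gamma> (x \<otimes> y) = \<gamma> x + \<gamma> y" "\<exists>h\<in>H i. \<gamma> h = 1"
    by (elim exE conjE)
  define \<delta> where "\<delta> j x = (if j = i then \<gamma> x else 0)" for j x
  have "\<delta> j (x \<otimes> y) = \<delta> j x + \<delta> j y" if "x \<in> H j" "y \<in> H j" for j x y
    using that \<gamma>(1) by (cases "j = i") (auto simp: \<delta>_def)
  from free_product_extend_additive[OF fp this] obtain \<beta>
    where \<beta>: "\<beta> \<in> hom F integer_group" "\<forall>j\<in>I. \<forall>x\<in>H j. \<beta> x = \<delta> j x" by (rule bexE)
  show ?thesis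
  proof (intro bexI[OF _ \<beta>(1)] conjI ballI)
    show "\<exists>h\<in>H i. \<beta> h = 1" using \<gamma>(2) \<beta>(2) i(1) by (auto simp: \<delta>_def)
    show "\<beta> x = 0" if "j \<in> I - {i}" "x \<in> H j" for j x
      using that(1) \<beta>(2)[rule_format, of j x] that(2) by (auto simp: \<delta>_def)
  qed
qed

end

section \<open>Matrices of determinant one modulo a prime\<close>

definition cong_mat :: "nat \<Rightarrow> int \<Rightarrow> int mat \<Rightarrow> int mat \<Rightarrow> bool" where
  "cong_mat n m A B \<longleftrightarrow> (\<forall>i<n. \<forall>j<n. [A $$ (i, j) = B $$ (i, j)] (mod m))"

lemma cong_mat_refl [simp]: "cong_mat n m A A"
  by (simp add: cong_mat_def)

lemma cong_mat_sym: "cong_mat n m A B \<Longrightarrow> cong_mat n m B A"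
  by (simp add: cong_mat_def cong_sym)

lemma cong_mat_trans [trans]: "cong_mat n m A B \<Longrightarrow> cong_mat n m B C \<Longrightarrow> cong_mat n m A C"
  by (simp add: cong_mat_def) (meson cong_trans)

lemma cong_mat_mult:
  assumes "A \<in> carrier_mat n n" "A' \<in> carrier_mat n n" "B \<in> carrier_mat n n" "B' \<in> carrier_mat n n"
    and "cong_mat n m A A'" "cong_mat n m B B'"
  shows "cong_mat n m (A * B) (A' * B')"
  using assms unfolding cong_mat_def
  by (auto simp: scalar_prod_def intro!: cong_sum cong_mult)

lemma cong_mat_pow:
  assumes "A \<in> carrier_mat n n" "A' \<in> carrier_mat n n" "cong_mat n m A A'"
  shows "cong_mat n m (A ^\<^sub>m k) (A' ^\<^sub>m k)"
  by (induction k) (use assms in \<open>auto intro!: cong_mat_mult\<close>)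

lemma cong_mat_dvd: "cong_mat n m A B \<Longrightarrow> d dvd m \<Longrightarrow> cong_mat n d A B"
  by (simp add: cong_mat_def) (meson cong_dvd_modulus)

lemma cong_mat_det:
  assumes "A \<in> carrier_mat n n" "B \<in> carrier_mat n n" "cong_mat n m A B"
  shows "[det A = det B] (mod m)"
  unfolding det_def'[OF assms(1)] det_def'[OF assms(2)]
proof (intro cong_sum cong_mult cong_prod)
  fix p i assume "p \<in> {p. p permutes {0..<n}}" "i \<in> {0..<n}"
  then have "p i < n" "i < n" using permutes_in_image[of p "{0..<n}" i] by auto
  then show "[A $$ (i, p i) = B $$ (i, p i)] (mod m)" using assms(3) by (simp add: cong_mat_def)
qed auto

text \<open>Products of transvections, over the integers so that they can be realized by automorphisms.\<close>

inductive_set elementary_products :: "nat \<Rightarrow> int mat set" for n where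
  one: "1\<^sub>m n \<in> elementary_products n"
| step: "P \<in> elementary_products n \<Longrightarrow> k < n \<Longrightarrow> l < n \<Longrightarrow> k \<noteq> l \<Longrightarrow>
    addrow_mat n a k l * P \<in> elementary_products n"

lemma elementary_products_carrier: "P \<in> elementary_products n \<Longrightarrow> P \<in> carrier_mat n n"
  by (induction rule: elementary_products.induct) auto

context
  fixes n :: nat and p :: int
  assumes p: "prime p"
begin

definition reducible_to_one :: "int mat \<Rightarrow> bool" where
  "reducible_to_one A \<longleftrightarrow> (\<exists>P\<in>elementary_products n. cong_mat n p A P)"

lemma reducible_addrow:
  assumes A: "A \<in> carrier_mat n n" and kl: "k < n" "l < n" "k \<noteq> l"
    and red: "reducible_to_one (addrow a k l A)"
  shows "reducible_to_one A"
proof -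
  obtain P where P: "P \<in> elementary_products n" "cong_mat n p (addrow a k l A) P"
    using red by (auto simp: reducible_to_one_def)
  have carr: "P \<in> carrier_mat n n" "addrow a k l A \<in> carrier_mat n n"
    using A elementary_products_carrier[OF P(1)] by auto
  have "A = addrow (-a) k l (addrow a k l A)" using A kl by (intro eq_matI) auto
  also have "\<dots> = addrow_mat n (-a) k l * addrow a k l A" by (rule addrow_mat[OF carr(2) kl(2)])
  finally have "cong_mat n p A (addrow_mat n (-a) k l * P)"
    using cong_mat_mult[OF addrow_mat_carrier addrow_mat_carrier carr(2,1) cong_mat_refl P(2), of "-a" k l] by simp
  then show ?thesis
    unfolding reducible_to_one_def using elementary_products.step[OF P(1) kl, of "-a"] by blast
qed

text \<open>The state of the column elimination, which proceeds from the last column to the first: the columns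
  from \<open>m\<close> on already agree with those of the identity matrix.\<close>

definition unit_columns_from :: "nat \<Rightarrow> int mat \<Rightarrow> bool" where
  "unit_columns_from m A \<longleftrightarrow> A \<in> carrier_mat n n \<and> [det A = 1] (mod p) \<and>
     (\<forall>i<n. \<forall>j<n. m \<le> j \<longrightarrow> [A $$ (i, j) = (if i = j then 1 else 0)] (mod p))"

lemma unit_columns_addrow:
  assumes A: "unit_columns_from (Suc m) A" and kl: "k < n" "l < n" "k \<noteq> l" "l \<le> m"
  shows "unit_columns_from (Suc m) (addrow a k l A)"
  unfolding unit_columns_from_def
proof (intro conjI allI impI)
  have c: "A \<in> carrier_mat n n" using A by (simp add: unit_columns_from_def)
  then show "addrow a k l A \<in> carrier_mat n n" by simp
  show "[det (addrow a k l A) = 1] (mod p)"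
    using A det_addrow[OF kl(2,3) c] by (simp add: unit_columns_from_def)
  fix i j assume ij: "i < n" "j < n" "Suc m \<le> j"
  have e: "[A $$ (i, j) = (if i = j then 1 else 0)] (mod p)" "[A $$ (l, j) = 0] (mod p)"
    proof -
    have "\<And>i. i < n \<Longrightarrow> [A $$ (i, j) = (if i = j then 1 else 0)] (mod p)"
      using A ij unfolding unit_columns_from_def by blast
    from this[OF ij(1)] this[OF kl(2)] show "[A $$ (i, j) = (if i = j then 1 else 0)] (mod p)"
      "[A $$ (l, j) = 0] (mod p)" using kl ij by auto
  qed
  show "[addrow a k l A $$ (i, j) = (if i = j then 1 else 0)] (mod p)"
  proof (cases "k = i")
    case True
    have "[a * A $$ (l, j) + A $$ (i, j) = a * 0 + (if i = j then 1 else 0)] (mod p)"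
      using e by (intro cong_add cong_mult) auto
    then show ?thesis using True ij c by simp
  qed (use e ij c in simp)
qed

text \<open>With pivot \<open>1\<close>, the other entries of column \<open>m\<close> are cleared one row at a time, where \<open>t\<close> is the
  number of rows that remain to be treated. Adding multiples of row \<open>m\<close> leaves the later columns unchanged,
  since row \<open>m\<close> vanishes there.\<close>

lemma clear_column:
  assumes IH: "\<And>A. unit_columns_from m A \<Longrightarrow> reducible_to_one A" and m: "m < n"
  shows "t \<le> n \<Longrightarrow> unit_columns_from (Suc m) A \<Longrightarrow> [A $$ (m, m) = 1] (mod p) \<Longrightarrow>
    (\<forall>i<n. t \<le> i \<longrightarrow> i \<noteq> m \<longrightarrow> [A $$ (i, m) = 0] (mod p)) \<Longrightarrow> reducible_to_one A"
proof (induction t arbitrary: A)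
  case 0
  have "unit_columns_from m A"
    using 0 unfolding unit_columns_from_def
  proof (intro conjI allI impI)
    fix i j assume ij: "i < n" "j < n" "m \<le> j"
    show "[A $$ (i, j) = (if i = j then 1 else 0)] (mod p)"
    proof (cases "j = m")
      case True
      then show ?thesis using 0(3,4) ij by (cases "i = m") simp_all
    next
      case False
      then have "Suc m \<le> j" using ij by simp
      then show ?thesis using 0(2) ij unfolding unit_columns_from_def by blast
    qed
  qed (use 0 in \<open>auto simp: unit_columns_from_def\<close>)
  then show ?case by (rule IH)
next
  case (Suc t)
  show ?case
  proof (cases "t = m")
    case True
    show ?thesis
    proof (rule Suc.IH)
      show "\<forall>i<n. t \<le> i \<longrightarrow> i \<noteq> m \<longrightarrow> [A $$ (i, m) = 0] (mod p)"
        using Suc.prems(4) True by (metis Suc_leI le_neq_implies_less)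
    qed (use Suc.prems in simp_all)
  next
    case False
    have c: "A \<in> carrier_mat n n" and t: "t < n" using Suc.prems by (auto simp: unit_columns_from_def)
    define B where "B = addrow (- A $$ (t, m)) t m A"
    have "reducible_to_one B"
    proof (rule Suc.IH)
      show "t \<le> n" using t by simp
      show "unit_columns_from (Suc m) B"
        unfolding B_def using Suc.prems(2) t m False by (intro unit_columns_addrow) auto
      show "[B $$ (m, m) = 1] (mod p)" using Suc.prems(3) c m t False by (simp add: B_def)
      show "\<forall>i<n. t \<le> i \<longrightarrow> i \<noteq> m \<longrightarrow> [B $$ (i, m) = 0] (mod p)"
      proof (intro allI impI)
        fix i assume i: "i < n" "t \<le> i" "i \<noteq> m"
        show "[B $$ (i, m) = 0] (mod p)"
        proof (cases "i = t")
          case True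
          have "[- A $$ (t, m) * A $$ (m, m) + A $$ (t, m) = - A $$ (t, m) * 1 + A $$ (t, m)] (mod p)"
            using Suc.prems(3) by (intro cong_add cong_mult) auto
          then show ?thesis using True i c m t by (simp add: B_def)
        next
          case False
          then show ?thesis using Suc.prems(4) i c m t by (simp add: B_def)
        qed
      qed
    qed
    then show ?thesis using c t m False unfolding B_def by (intro reducible_addrow[of A t m]) auto
  qed
qed

text \<open>When only the first column is left, the determinant is the first entry.\<close>

lemma det_unit_columns:
  assumes "unit_columns_from (Suc 0) A" "0 < n"
  shows "[A $$ (0, 0) = 1] (mod p)"
proof -
  define A' where "A' = mat n n (\<lambda>(i, j). if j = 0 then A $$ (i, j) else if i = j then 1 else 0)"
  have A: "A \<in> carrier_mat n n" "[det A = 1] (mod p)" using assms by (auto simp: unit_columns_from_def)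
  have A': "A' \<in> carrier_mat n n" by (simp add: A'_def)
  have "cong_mat n p A A'" using assms by (auto simp: cong_mat_def A'_def unit_columns_from_def)
  then have "[det A = det A'] (mod p)" by (rule cong_mat_det[OF A(1) A'])
  moreover have "det A' = A $$ (0, 0)"
  proof -
    have "det A' = prod_list (diag_mat A')"
      by (rule det_lower_triangular[OF _ A']) (auto simp: A'_def)
    also have "\<dots> = (\<Prod>i = 0..<n. A' $$ (i, i))" using A' by (simp add: prod_list_diag_prod)
    also have "\<dots> = A' $$ (0, 0) * (\<Prod>i = Suc 0..<n. A' $$ (i, i))"
      using assms(2) by (rule prod.atLeast_Suc_lessThan)
    also have "(\<Prod>i = Suc 0..<n. A' $$ (i, i)) = 1" by (rule prod.neutral) (auto simp: A'_def)
    finally show ?thesis using assms(2) by (simp add: A'_def)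
  qed
  ultimately show ?thesis using A(2) by (metis cong_sym cong_trans)
qed

text \<open>If the entries of column \<open>m\<close> vanished on and above the diagonal, the column would be a
  combination of the later columns, and the determinant would be zero. In terms of the adjugate, row \<open>m\<close> of
  the adjugate would annihilate column \<open>m\<close>.\<close>

lemma ex_nonzero_in_column:
  assumes A: "unit_columns_from (Suc m) A" and m: "m < n"
  shows "\<exists>i\<le>m. \<not> [A $$ (i, m) = 0] (mod p)"
proof (rule ccontr)
  assume "\<not> ?thesis"
  then have z: "[A $$ (i, m) = 0] (mod p)" if "i \<le> m" for i using that by auto
  have c: "A \<in> carrier_mat n n" and d: "[det A = 1] (mod p)"
    using A by (auto simp: unit_columns_from_def)
  define B where "B = adj_mat A"
  have Bc: "B \<in> carrier_mat n n" and BA: "B * A = det A \<cdot>\<^sub>m 1\<^sub>m n"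
    using adj_mat[OF c] by (auto simp: B_def)
  have ent: "(B * A) $$ (i, j) = (\<Sum>l<n. B $$ (i, l) * A $$ (l, j))" if "i < n" "j < n" for i j
    using that c Bc by (simp add: scalar_prod_def atLeast0LessThan)
  have Bm: "[B $$ (m, j) = 0] (mod p)" if j: "m < j" "j < n" for j
  proof -
    have "[(\<Sum>l<n. B $$ (m, l) * A $$ (l, j)) = (\<Sum>l<n. B $$ (m, l) * (if l = j then 1 else 0))] (mod p)"
      using A j by (intro cong_sum cong_mult) (auto simp: unit_columns_from_def)
    moreover have "(\<Sum>l<n. B $$ (m, l) * A $$ (l, j)) = 0"
      using ent[of m j] BA j m by simp
    moreover have "(\<Sum>l<n. B $$ (m, l) * (if l = j then 1 else 0)) = B $$ (m, j)"
      using j by (simp add: if_distrib sum.delta cong: if_cong)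
    ultimately show ?thesis by (simp add: cong_sym)
  qed
  have "[(\<Sum>l<n. B $$ (m, l) * A $$ (l, m)) = (\<Sum>l<n. 0)] (mod p)"
  proof (intro cong_sum)
    fix l assume "l \<in> {..<n}"
    then show "[B $$ (m, l) * A $$ (l, m) = 0] (mod p)"
      using z[of l] Bm[of l] by (cases "l \<le> m") (auto simp: cong_0_iff)
  qed
  moreover have "(\<Sum>l<n. B $$ (m, l) * A $$ (l, m)) = det A"
    using ent[of m m] BA m by simp
  ultimately have "p dvd 1" using d by (simp add: cong_0_iff cong_dvd_iff)
  then show False using p by (simp add: not_prime_unit)
qed

text \<open>Gaussian elimination using transvections only. The pivot is made equal to \<open>1\<close> by adding a multiple of
  another row with a nonzero entry; if the pivot is the only usable entry, row \<open>m\<close> is first added to row \<open>0\<close>.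
  In the first column the pivot is already \<open>1\<close> because of the determinant.\<close>

lemma reducible_if_unit_columns:
  "m \<le> n \<Longrightarrow> unit_columns_from m A \<Longrightarrow> reducible_to_one A"
proof (induction m arbitrary: A)
  case 0
  then have "cong_mat n p A (1\<^sub>m n)" by (auto simp: unit_columns_from_def cong_mat_def)
  then show ?case unfolding reducible_to_one_def using elementary_products.one by blast
next
  case (Suc m)
  then have m: "m < n" by simp
  have IH: "\<And>A. unit_columns_from m A \<Longrightarrow> reducible_to_one A" using Suc by simp
  have pivot_one: "reducible_to_one B"
    if "unit_columns_from (Suc m) B" "[B $$ (m, m) = 1] (mod p)" for B
    using clear_column[OF IH m, of n B] that by simp
  have c: "A \<in> carrier_mat n n" using Suc.prems by (simp add: unit_columns_from_def)
  \<comment> \<open>A nonzero entry strictly above the pivot can be used to make the pivot equal to one.\<close>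
  have above: "reducible_to_one B"
    if B: "unit_columns_from (Suc m) B" and i: "i < m" "\<not> [B $$ (i, m) = 0] (mod p)" for B i
  proof -
    have cB: "B \<in> carrier_mat n n" using B by (simp add: unit_columns_from_def)
    have "coprime (B $$ (i, m)) p"
      using i p by (metis cong_0_iff coprime_commute prime_imp_coprime)
    then obtain y where y: "[B $$ (i, m) * y = 1] (mod p)" using cong_solve_coprime_int by blast
    define a where "a = (1 - B $$ (m, m)) * y"
    have "[a * B $$ (i, m) + B $$ (m, m) = (1 - B $$ (m, m)) * 1 + B $$ (m, m)] (mod p)"
      unfolding a_def mult.assoc using y by (intro cong_add cong_mult) (auto simp: mult.commute)
    then have "[addrow a m i B $$ (m, m) = 1] (mod p)" using cB m by simp
    then have "reducible_to_one (addrow a m i B)"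
      using B m i by (intro pivot_one unit_columns_addrow) auto
    then show ?thesis using cB m i by (intro reducible_addrow[of B m i]) auto
  qed
  obtain i where i: "i \<le> m" "\<not> [A $$ (i, m) = 0] (mod p)"
    using ex_nonzero_in_column[OF Suc.prems(2) m] by blast
  show ?case
  proof (cases "i < m")
    case True then show ?thesis using above Suc.prems i by blast
  next
    case False
    then have im: "i = m" using i by simp
    show ?thesis
    proof (cases "m = 0")
      case True
      then show ?thesis using det_unit_columns Suc.prems pivot_one m by simp
    next
      case m0: False
      show ?thesis
      proof (cases "[A $$ (0, m) = 0] (mod p)")
        case False then show ?thesis using above[of A 0] Suc.prems m0 by simp
      next
        case True
        have "[addrow 1 0 m A $$ (0, m) = A $$ (m, m)] (mod p)"
          using True c m m0 cong_add[OF cong_refl[of "A $$ (m, m)"] True] by simp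
        then have "\<not> [addrow 1 0 m A $$ (0, m) = 0] (mod p)"
          using i im by (metis cong_sym cong_trans)
        then have "reducible_to_one (addrow 1 0 m A)"
          using above[of "addrow 1 0 m A" 0] unit_columns_addrow[OF Suc.prems(2), of 0 m 1] m m0 by simp
        then show ?thesis using c m m0 by (intro reducible_addrow[of A 0 m 1]) auto
      qed
    qed
  qed
qed

end

theorem det_one_imp_elementary_product:
  fixes p :: int
  assumes "prime p" "A \<in> carrier_mat n n" "[det A = 1] (mod p)"
  shows "\<exists>P\<in>elementary_products n. cong_mat n p A P"
  using reducible_if_unit_columns[OF assms(1), of n n A] assms
  by (simp add: unit_columns_from_def[OF assms(1)] reducible_to_one_def[OF assms(1)])

section \<open>Matrices that are trivial modulo six\<close>

lemma pow_mat_add: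
  "A \<in> carrier_mat n n \<Longrightarrow> A ^\<^sub>m (i + j) = A ^\<^sub>m i * A ^\<^sub>m j"
proof (induction j)
  case (Suc j)
  then have "A ^\<^sub>m i * A ^\<^sub>m j * A = A ^\<^sub>m i * (A ^\<^sub>m j * A)"
    by (intro assoc_mult_mat[of _ n n _ n _ n]) auto
  with Suc show ?case by simp
qed simp

lemma pow_mat_mult:
  "A \<in> carrier_mat n n \<Longrightarrow> A ^\<^sub>m (i * j) = (A ^\<^sub>m i) ^\<^sub>m j"
proof (induction j)
  case (Suc j)
  then show ?case using pow_mat_add[of A n "i * j" i] by (simp add: add.commute)
qed simp

lemma pow_mat_one: "(1\<^sub>m n :: int mat) ^\<^sub>m k = 1\<^sub>m n"
  by (induction k) auto

lemma one_add_mult_mat: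
  fixes Y Z :: "int mat"
  assumes "Y \<in> carrier_mat n n" "Z \<in> carrier_mat n n"
  shows "(1\<^sub>m n + Y) * Z = Z + Y * Z" "Z * (1\<^sub>m n + Y) = Z + Z * Y"
  using assms add_mult_distrib_mat[of "1\<^sub>m n" n n Y Z n] mult_add_distrib_mat[of Z n n "1\<^sub>m n" n Y]
  by auto

text \<open>\<open>(1 + Y)\<^sup>2 = 1 + 2 Y + Y\<^sup>2\<close>, and both correction terms gain a factor \<open>2\<close>.\<close>

lemma cong_one_imp_square:
  assumes D: "D \<in> carrier_mat n n" "cong_mat n q D (1\<^sub>m n)" and q: "2 dvd q"
  shows "cong_mat n (2 * q) (D ^\<^sub>m 2) (1\<^sub>m n)"
proof -
  define Y where "Y = D - 1\<^sub>m n"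
  have Y: "Y \<in> carrier_mat n n" and D_eq: "D = 1\<^sub>m n + Y" using D by (auto simp: Y_def)
  have div: "q dvd Y $$ (i, j)" if "i < n" "j < n" for i j
    using D that by (simp add: cong_mat_def Y_def cong_iff_dvd_diff)
  have D2: "D ^\<^sub>m 2 = (1\<^sub>m n + Y) + (Y + Y * Y)"
    using Y by (simp add: numeral_2_eq_2 D_eq one_add_mult_mat)
  have "2 * q dvd (D ^\<^sub>m 2) $$ (i, j) - 1\<^sub>m n $$ (i, j)" if ij: "i < n" "j < n" for i j
  proof -
    have "2 * q dvd (Y * Y) $$ (i, j)"
      using ij Y div q by (auto simp: scalar_prod_def intro!: dvd_sum mult_dvd_mono elim: dvd_trans)
    moreover have "(D ^\<^sub>m 2) $$ (i, j) - 1\<^sub>m n $$ (i, j) = 2 * Y $$ (i, j) + (Y * Y) $$ (i, j)"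
      using ij Y by (simp add: D2)
    ultimately show ?thesis using div[OF ij] by simp
  qed
  then show ?thesis by (auto simp: cong_mat_def cong_iff_dvd_diff)
qed

text \<open>\<open>(1 + Y)\<^sup>3 = 1 + 3 Y + 3 Y\<^sup>2 + Y\<^sup>3\<close>, and all correction terms gain a factor \<open>3\<close>.\<close>

lemma cong_one_imp_cube:
  assumes D: "D \<in> carrier_mat n n" "cong_mat n q D (1\<^sub>m n)" and q: "3 dvd q"
  shows "cong_mat n (3 * q) (D ^\<^sub>m 3) (1\<^sub>m n)"
proof -
  define Y where "Y = D - 1\<^sub>m n"
  have Y: "Y \<in> carrier_mat n n" and D_eq: "D = 1\<^sub>m n + Y" using D by (auto simp: Y_def)
  have div: "q dvd Y $$ (i, j)" if "i < n" "j < n" for i j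
    using D that by (simp add: cong_mat_def Y_def cong_iff_dvd_diff)
  define Z where "Z = Y * Y"
  have Z: "Z \<in> carrier_mat n n" using Y by (simp add: Z_def)
  have divZ: "3 * q dvd Z $$ (i, j)" if "i < n" "j < n" for i j
    unfolding Z_def using that Y div q
    by (auto simp: scalar_prod_def intro!: dvd_sum mult_dvd_mono elim: dvd_trans)
  define E where "E = (1\<^sub>m n + Y) + (Y + Z)"
  have E: "E \<in> carrier_mat n n" using Y Z by (simp add: E_def)
  have D2: "D * D = E"
    using Y by (simp add: E_def Z_def D_eq one_add_mult_mat)
  have EY: "E * Y = (Y + Z) + (Z + Z * Y)"
    using Y Z add_mult_distrib_mat[of "1\<^sub>m n + Y" n n "Y + Z" Y n] add_mult_distrib_mat[of Y n n Z Y n]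
    by (simp add: E_def one_add_mult_mat Z_def)
  have "D ^\<^sub>m 3 = D * D * D" using D by (simp add: numeral_3_eq_3)
  also have "\<dots> = E + E * Y" unfolding D2 using one_add_mult_mat(2)[OF Y E] by (simp add: D_eq)
  finally have D3: "D ^\<^sub>m 3 = E + ((Y + Z) + (Z + Z * Y))" by (simp add: EY)
  have "3 * q dvd (D ^\<^sub>m 3) $$ (i, j) - 1\<^sub>m n $$ (i, j)" if ij: "i < n" "j < n" for i j
  proof -
    have "3 * q dvd (Z * Y) $$ (i, j)"
      using ij Y Z divZ by (auto simp: scalar_prod_def intro!: dvd_sum)
    moreover have "(D ^\<^sub>m 3) $$ (i, j) - 1\<^sub>m n $$ (i, j)
        = 3 * Y $$ (i, j) + (3 * Z $$ (i, j) + (Z * Y) $$ (i, j))"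
      using ij Y Z by (simp add: D3 E_def)
    moreover have "3 * q dvd 3 * Y $$ (i, j)" using div[OF ij] by simp
    moreover have "3 * q dvd 3 * Z $$ (i, j)" using divZ[OF ij] by (rule dvd_mult)
    ultimately show ?thesis by (simp add: dvd_add)
  qed
  then show ?thesis by (auto simp: cong_mat_def cong_iff_dvd_diff)
qed

lemma cong_one_imp_pow:
  assumes D: "D \<in> carrier_mat n n" "cong_mat n (int p) D (1\<^sub>m n)" and p: "p = 2 \<or> p = 3"
  shows "cong_mat n (int p ^ Suc k) (D ^\<^sub>m (p ^ k)) (1\<^sub>m n)"
proof (induction k)
  case 0 then show ?case using D by simp
next
  case (Suc k)
  have "D ^\<^sub>m (p ^ Suc k) = (D ^\<^sub>m (p ^ k)) ^\<^sub>m p"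
    using pow_mat_mult[OF D(1), of "p ^ k" p] by (simp add: mult.commute)
  moreover have "D ^\<^sub>m (p ^ k) \<in> carrier_mat n n" using D by simp
  ultimately show ?case
    using p Suc cong_one_imp_square[of "D ^\<^sub>m (p ^ k)" n "int p ^ Suc k"]
      cong_one_imp_cube[of "D ^\<^sub>m (p ^ k)" n "int p ^ Suc k"] by (auto simp: mult_ac)
qed

lemma image_mult_mat_vec:
  assumes "A \<in> carrier_mat n n" "B \<in> carrier_mat n n" "L \<subseteq> carrier_vec n"
  shows "(\<lambda>v. (A * B) *\<^sub>v v) ` L = (\<lambda>v. A *\<^sub>v v) ` ((\<lambda>v. B *\<^sub>v v) ` L)"
proof -
  have "(A * B) *\<^sub>v v = A *\<^sub>v (B *\<^sub>v v)" if "v \<in> L" for v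
    using that assms by (intro assoc_mult_mat_vec[of _ n n _ n]) auto
  then show ?thesis by (simp add: image_image)
qed

lemma image_pow_mat:
  assumes A: "A \<in> carrier_mat n n" and L: "L \<subseteq> carrier_vec n" "(\<lambda>v. A *\<^sub>v v) ` L = L"
  shows "(\<lambda>v. A ^\<^sub>m k *\<^sub>v v) ` L = L"
proof (induction k)
  case 0
  have "(1\<^sub>m n :: 'a mat) *\<^sub>v v = v" if "v \<in> L" for v using that L by auto
  then show ?case using A by simp
next
  case (Suc k)
  have "(\<lambda>v. (A ^\<^sub>m k * A) *\<^sub>v v) ` L = (\<lambda>v. A ^\<^sub>m k *\<^sub>v v) ` ((\<lambda>v. A *\<^sub>v v) ` L)"
    using A L by (intro image_mult_mat_vec) auto
  then show ?case using Suc L by simp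
qed

text \<open>Subgroups of the form \<open>annihilator n S\<close> are the saturated subgroups of \<open>\<int>\<^sup>n\<close>. They are handled by
  their equations \<open>S\<close>, and membership can be tested modulo all powers of a prime.\<close>

definition annihilator :: "nat \<Rightarrow> int vec set \<Rightarrow> int vec set" where
  "annihilator n S = {v \<in> carrier_vec n. \<forall>\<alpha>\<in>S. \<alpha> \<bullet> v = 0}"

lemma cong_mat_one_mult_vec:
  assumes "cong_mat n q C (1\<^sub>m n)" "C \<in> carrier_mat n n" "v \<in> carrier_vec n" "i < n"
  shows "[(C *\<^sub>v v) $ i = v $ i] (mod q)"
proof -
  have "[(\<Sum>j<n. C $$ (i, j) * v $ j) = (\<Sum>j<n. (1\<^sub>m n) $$ (i, j) * v $ j)] (mod q)"
    using assms by (intro cong_sum cong_mult) (auto simp: cong_mat_def)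
  moreover have "(\<Sum>j<n. (1\<^sub>m n) $$ (i, j) * v $ j) = v $ i"
    using assms by (simp add: if_distrib[of "\<lambda>x. x * _"] sum.delta cong: if_cong)
  ultimately show ?thesis using assms by (simp add: scalar_prod_def atLeast0LessThan)
qed

text \<open>The powers of \<open>C\<close> whose exponent is \<open>1\<close> modulo \<open>l\<close> differ from \<open>C\<close> by an automorphism of the saturated
  subgroup. Since \<open>C\<close> is trivial modulo \<open>p \<noteq> l\<close>, some of these powers are arbitrarily close to the identity in the
  \<open>p\<close>-adic topology. Hence \<open>C\<close> maps the subgroup into every \<open>p\<close>-adic neighbourhood of it, and thus into
  itself because it is saturated.\<close>

lemma stabilizer_root:
  assumes C: "C \<in> carrier_mat n n" "cong_mat n (int p) C (1\<^sub>m n)" and p: "p = 2 \<or> p = 3"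
    and l: "prime l" "l \<noteq> p" and S: "S \<subseteq> carrier_vec n"
    and stab: "(\<lambda>v. C ^\<^sub>m l *\<^sub>v v) ` annihilator n S = annihilator n S"
  shows "(\<lambda>v. C *\<^sub>v v) ` annihilator n S = annihilator n S"
proof -
  let ?L = "annihilator n S"
  have L: "?L \<subseteq> carrier_vec n" by (auto simp: annihilator_def)
  have sub: "C *\<^sub>v v \<in> ?L" if v: "v \<in> ?L" for v
  proof -
    have Cv: "C *\<^sub>v v \<in> carrier_vec n" using v L C by auto
    have "\<alpha> \<bullet> (C *\<^sub>v v) = 0" if \<alpha>: "\<alpha> \<in> S" for \<alpha>
    proof -
      have dvd: "int p ^ Suc k dvd \<alpha> \<bullet> (C *\<^sub>v v)" for k
      proof -
        \<comment> \<open>Choose an exponent that is \<open>1\<close> modulo \<open>l\<close> and divisible by \<open>p ^ k\<close>.\<close>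
        have "prime p" using p by auto
        then have "coprime (p ^ k) l" using l by (simp add: primes_coprime)
        from cong_solve_coprime_nat[OF this] obtain u where u: "[p ^ k * u = 1] (mod l)" by auto
        have "u \<noteq> 0"
        proof
          assume "u = 0"
          then have "[1 = 0] (mod l)" using u cong_sym by auto
          then show False using l by (simp add: cong_0_iff)
        qed
        then have "p ^ k * u \<ge> 1" using \<open>prime p\<close> \<open>u \<noteq> 0\<close> prime_gt_0_nat[of p] by (simp add: Suc_le_eq)
        then have "l dvd p ^ k * u - 1" using u cong_altdef_nat by blast
        then obtain j where "p ^ k * u - 1 = l * j" by (auto simp: dvd_def)
        with \<open>p ^ k * u \<ge> 1\<close> have j: "p ^ k * u = 1 + l * j" by linarith
        have "(\<lambda>v. C ^\<^sub>m (l * j) *\<^sub>v v) ` ?L = ?L"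
          using image_pow_mat[OF _ L stab, of j] C pow_mat_mult[OF C(1), of l j] by simp
        then obtain v' where v': "v' \<in> ?L" "v = C ^\<^sub>m (l * j) *\<^sub>v v'" using v by blast
        have v'c: "v' \<in> carrier_vec n" using v' L by auto
        have "C *\<^sub>v v = (C ^\<^sub>m 1 * C ^\<^sub>m (l * j)) *\<^sub>v v'"
          using C v'c v' by (simp add: assoc_mult_mat_vec[of _ n n _ n])
        also have "\<dots> = C ^\<^sub>m (p ^ k * u) *\<^sub>v v'" unfolding j pow_mat_add[OF C(1)] ..
        finally have Cv_eq: "C *\<^sub>v v = C ^\<^sub>m (p ^ k * u) *\<^sub>v v'" .
        have cong: "cong_mat n (int p ^ Suc k) (C ^\<^sub>m (p ^ k * u)) (1\<^sub>m n)"
          using cong_mat_pow[OF _ one_carrier_mat cong_one_imp_pow[OF C p], of k u] C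
            pow_mat_mult[OF C(1), of "p ^ k" u] by (simp add: pow_mat_one)
        have "[(\<Sum>i<n. \<alpha> $ i * (C *\<^sub>v v) $ i) = (\<Sum>i<n. \<alpha> $ i * v' $ i)] (mod (int p ^ Suc k))"
          unfolding Cv_eq using C v'c
          by (intro cong_sum cong_mult cong_refl cong_mat_one_mult_vec[OF cong]) auto
        moreover have "(\<Sum>i<n. \<alpha> $ i * v' $ i) = 0"
          using v' \<alpha> v'c by (auto simp: annihilator_def scalar_prod_def atLeast0LessThan)
        moreover have "\<alpha> \<bullet> (C *\<^sub>v v) = (\<Sum>i<n. \<alpha> $ i * (C *\<^sub>v v) $ i)"
          unfolding scalar_prod_def[of \<alpha> "C *\<^sub>v v"] carrier_vecD[OF Cv] atLeast0LessThan ..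
        ultimately show ?thesis by (simp only: cong_0_iff)
      qed
      show ?thesis
      proof (rule ccontr)
        assume nz: "\<alpha> \<bullet> (C *\<^sub>v v) \<noteq> 0"
        define x where "x = nat \<bar>\<alpha> \<bullet> (C *\<^sub>v v)\<bar>"
        have "int (p ^ Suc x) dvd int x" using dvd[of x] by (simp add: x_def del: power_Suc)
        then have "p ^ Suc x dvd x" by (simp only: int_dvd_int_iff)
        then have "p ^ Suc x \<le> x" using nz by (intro dvd_imp_le) (auto simp: x_def)
        moreover have "x < p ^ x" using p by (intro power_gt_expt) auto
        moreover have "p ^ x \<le> p ^ Suc x" using p by (intro power_increasing) auto
        ultimately show False by linarith
      qed
    qed
    then show ?thesis using Cv by (simp add: annihilator_def)
  qed
  show ?thesis
  proof
    show "(\<lambda>v. C *\<^sub>v v) ` ?L \<subseteq> ?L" using sub by blast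
    have sub_pow: "C ^\<^sub>m k *\<^sub>v v \<in> ?L" if "v \<in> ?L" for v k
    proof (induction k)
      case 0 then show ?case using C that L by auto
    next
      case (Suc k)
      have "C ^\<^sub>m Suc k = C ^\<^sub>m (1 + k)" by simp
      also have "\<dots> = C * C ^\<^sub>m k" using pow_mat_add[OF C(1), of 1 k] C by simp
      finally show ?case using sub[OF Suc] C that L
        by (simp add: assoc_mult_mat_vec[of _ n n _ n] subset_eq)
    qed
    show "?L \<subseteq> (\<lambda>v. C *\<^sub>v v) ` ?L"
    proof
      fix v assume "v \<in> ?L"
      then obtain w where w: "w \<in> ?L" "v = C ^\<^sub>m l *\<^sub>v w" using stab by blast
      obtain k where k: "l = Suc k" using l prime_gt_0_nat by (cases l) auto
      have "C ^\<^sub>m l = C ^\<^sub>m (1 + k)" using k by simp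
      also have "\<dots> = C * C ^\<^sub>m k" using pow_mat_add[OF C(1), of 1 k] C by simp
      finally have "v = C *\<^sub>v (C ^\<^sub>m k *\<^sub>v w)"
        using w C L by (simp add: assoc_mult_mat_vec[of _ n n _ n] subset_eq)
      then show "v \<in> (\<lambda>v. C *\<^sub>v v) ` ?L" using sub_pow[OF w(1)] by blast
    qed
  qed
qed

text \<open>The prime factors \<open>l\<close> of \<open>m\<close> are removed one by one by taking \<open>l\<close>-th roots. At least one of \<open>2\<close> and \<open>3\<close>
  differs from \<open>l\<close>, which is why triviality modulo \<open>6\<close> is required.\<close>

theorem stabilizer_of_power:
  assumes B: "B \<in> carrier_mat n n" "cong_mat n 6 B (1\<^sub>m n)" and S: "S \<subseteq> carrier_vec n"
    and "m > 0" "(\<lambda>v. B ^\<^sub>m m *\<^sub>v v) ` annihilator n S = annihilator n S"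
  shows "(\<lambda>v. B *\<^sub>v v) ` annihilator n S = annihilator n S"
  using assms(4,5)
proof (induction m rule: less_induct)
  case (less m)
  show ?case
  proof (cases "m = 1")
    case True then show ?thesis using less.prems B by simp
  next
    case False
    then obtain l where l: "prime l" "l dvd m" using prime_factor_nat by blast
    then obtain m' where m': "m = m' * l" by (auto simp: dvd_def mult.commute)
    then have m'2: "0 < m'" "m' < m" using less.prems(1) prime_gt_1_nat[OF l(1)] by auto
    define p :: nat where "p = (if l = 2 then 3 else 2)"
    have p: "p = 2 \<or> p = 3" "l \<noteq> p" "int p dvd 6" by (auto simp: p_def)
    have "cong_mat n (int p) B (1\<^sub>m n)" using cong_mat_dvd[OF B(2) p(3)] .
    then have "cong_mat n (int p) (B ^\<^sub>m m') (1\<^sub>m n)"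
      using cong_mat_pow[OF B(1) one_carrier_mat, of "int p" m'] by (simp add: pow_mat_one)
    then have "(\<lambda>v. B ^\<^sub>m m' *\<^sub>v v) ` annihilator n S = annihilator n S"
      using B less.prems(2) p l S pow_mat_mult[OF B(1), of m' l] unfolding m'
      by (intro stabilizer_root[of "B ^\<^sub>m m'" n p l]) auto
    then show ?thesis using less.IH m'2 by blast
  qed
qed

section \<open>The action on the abelianization\<close>

text \<open>Invariant proper nonzero subspaces of \<open>(\<int>/p)\<^sup>n\<close>, described by their preimages \<open>W\<close> in \<open>\<int>\<^sup>n\<close>.\<close>

definition reducible_mod :: "nat \<Rightarrow> int \<Rightarrow> int mat \<Rightarrow> bool" where
  "reducible_mod n p A \<longleftrightarrow> (\<exists>W \<subseteq> carrier_vec n.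
     (\<forall>v\<in>W. \<forall>w\<in>W. v + w \<in> W) \<and> (\<forall>v\<in>carrier_vec n. p \<cdot>\<^sub>v v \<in> W) \<and> (\<forall>v\<in>W. A *\<^sub>v v \<in> W) \<and>
     W \<noteq> carrier_vec n \<and> (\<exists>w\<in>W. \<exists>i<n. \<not> p dvd w $ i))"

locale based_free_group = free_group +
  fixes n :: nat and b :: "nat \<Rightarrow> 'a"
  assumes b: "bij_betw b {..<n} X"
begin

lemma b_in_X: "i < n \<Longrightarrow> b i \<in> X"
  using b by (auto simp: bij_betw_def)

lemma b_carrier [simp]: "i < n \<Longrightarrow> b i \<in> carrier F"
  using b_in_X X_carrier by blast

lemma X_eq: "x \<in> X \<Longrightarrow> \<exists>i<n. x = b i"
  using b by (auto simp: bij_betw_def)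

text \<open>The \<open>j\<close>-th exponent sum.\<close>

definition coord :: "nat \<Rightarrow> 'a \<Rightarrow> int" where
  "coord j = (SOME h. h \<in> hom F integer_group \<and> (\<forall>i<n. h (b i) = (if i = j then 1 else 0)))"

lemma coord: "coord j \<in> hom F integer_group" "i < n \<Longrightarrow> coord j (b i) = (if i = j then 1 else 0)"
proof -
  have "\<exists>h\<in>hom F integer_group. \<forall>x\<in>X. h x = (if x = b j then 1 else (0::int))" if "j < n"
    by (rule ex_hom_extending) auto
  moreover have "b i = b j \<longleftrightarrow> i = j" if "i < n" "j < n" for i
    using b that by (auto simp: bij_betw_def inj_on_def)
  ultimately have "\<exists>h. h \<in> hom F integer_group \<and> (\<forall>i<n. h (b i) = (if i = j then 1 else 0))" if "j < n"
    using that b_in_X by (metis (no_types, lifting))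
  moreover have "\<exists>h. h \<in> hom F integer_group \<and> (\<forall>i<n. h (b i) = (if i = j then 1 else 0))" if "\<not> j < n"
    using that by (intro exI[of _ "\<lambda>_. 0"]) (auto simp: hom_def)
  ultimately have "\<exists>h. h \<in> hom F integer_group \<and> (\<forall>i<n. h (b i) = (if i = j then 1 else 0))" by blast
  from someI_ex[OF this] show "coord j \<in> hom F integer_group"
    "i < n \<Longrightarrow> coord j (b i) = (if i = j then 1 else 0)" unfolding coord_def by auto
qed

lemma int_hom_mult:
  "h \<in> hom F integer_group \<Longrightarrow> x \<in> carrier F \<Longrightarrow> y \<in> carrier F \<Longrightarrow> h (x \<otimes> y) = h x + h y"
  using hom_mult by fastforce

lemma int_hom_one: "h \<in> hom F integer_group \<Longrightarrow> h \<one> = 0"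
  using hom_one[of h F integer_group] by simp

lemma int_hom_inv:
  assumes "h \<in> hom F integer_group" "x \<in> carrier F"
  shows "h (inv x) = - h x"
  using int_hom_mult[OF assms(1), of "inv x" x] int_hom_one[OF assms(1)] assms by simp

lemma int_hom_expand:
  assumes "h \<in> hom F integer_group" "g \<in> carrier F"
  shows "h g = (\<Sum>j<n. h (b j) * coord j g)"
proof (rule hom_eqI[OF group_integer_group assms(1) _ _ assms(2)])
  show "(\<lambda>g. \<Sum>j<n. h (b j) * coord j g) \<in> hom F integer_group"
    by (rule homI) (auto simp: int_hom_mult[OF coord(1)] algebra_simps sum.distrib)
  show "h x = (\<Sum>j<n. h (b j) * coord j x)" if x: "x \<in> X" for x
  proof -
    obtain i where i: "i < n" "x = b i" using X_eq[OF x] by blast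
    have "(\<Sum>j<n. h (b j) * coord j (b i)) = (\<Sum>j<n. if j = i then h (b j) else 0)"
      using i by (intro sum.cong) (auto simp: coord(2))
    then show ?thesis using i by simp
  qed
qed

definition ab :: "'a \<Rightarrow> int vec" where
  "ab g = vec n (\<lambda>j. coord j g)"

lemma ab_carrier [simp]: "ab g \<in> carrier_vec n"
  by (simp add: ab_def)

lemma ab_conj:
  "g \<in> carrier F \<Longrightarrow> h \<in> carrier F \<Longrightarrow> ab (g \<otimes> h \<otimes> inv g) = ab h"
  by (auto simp: ab_def int_hom_mult[OF coord(1)] int_hom_inv[OF coord(1)])

text \<open>Homomorphisms to \<open>\<int>\<close> are row vectors on the abelianization.\<close>

definition hom_vec :: "('a \<Rightarrow> int) \<Rightarrow> int vec" where
  "hom_vec h = vec n (\<lambda>j. h (b j))"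

lemma hom_vec_carrier [simp]: "hom_vec h \<in> carrier_vec n"
  by (simp add: hom_vec_def)

lemma hom_vec_ab:
  "h \<in> hom F integer_group \<Longrightarrow> g \<in> carrier F \<Longrightarrow> hom_vec h \<bullet> ab g = h g"
  using int_hom_expand[of h g] by (simp add: hom_vec_def ab_def scalar_prod_def atLeast0LessThan)

definition aut_mat :: "('a \<Rightarrow> 'a) \<Rightarrow> int mat" where
  "aut_mat \<phi> = mat n n (\<lambda>(i, j). coord i (\<phi> (b j)))"

lemma aut_mat_carrier [simp]: "aut_mat \<phi> \<in> carrier_mat n n"
  by (simp add: aut_mat_def)

lemma ab_aut:
  assumes \<phi>: "\<phi> \<in> hom F F" and g: "g \<in> carrier F"
  shows "ab (\<phi> g) = aut_mat \<phi> *\<^sub>v ab g"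
proof (rule eq_vecI)
  fix i assume "i < dim_vec (aut_mat \<phi> *\<^sub>v ab g)"
  then have i: "i < n" by (simp add: aut_mat_def)
  have "coord i \<circ> \<phi> \<in> hom F integer_group"
    using \<phi> coord(1)[of i] by (auto simp: hom_def)
  from int_hom_expand[OF this g] show "ab (\<phi> g) $ i = (aut_mat \<phi> *\<^sub>v ab g) $ i"
    using i by (simp add: aut_mat_def ab_def scalar_prod_def atLeast0LessThan)
qed (simp add: ab_def aut_mat_def)

abbreviation "AutF \<equiv> AutoGroup F"

lemma group_AutF: "group AutF" by (rule AutoGroup)

lemma AutF_carrier: "\<phi> \<in> carrier AutF \<longleftrightarrow> \<phi> \<in> hom F F \<and> \<phi> \<in> extensional (carrier F) \<and> bij_betw \<phi> (carrier F) (carrier F)"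
  by (auto simp: AutoGroup_def auto_def Bij_def)

lemma AutF_mult: "\<phi> \<in> carrier AutF \<Longrightarrow> \<psi> \<in> carrier AutF \<Longrightarrow> \<phi> \<otimes>\<^bsub>AutF\<^esub> \<psi> = compose (carrier F) \<phi> \<psi>"
  by (auto simp: AutoGroup_def BijGroup_def auto_def)

lemma AutF_one: "\<one>\<^bsub>AutF\<^esub> = (\<lambda>x\<in>carrier F. x)"
  by (simp add: AutoGroup_def BijGroup_def)

lemma AutF_closed: "\<phi> \<in> carrier AutF \<Longrightarrow> g \<in> carrier F \<Longrightarrow> \<phi> g \<in> carrier F"
  using AutF_carrier hom_in_carrier by metis

lemma aut_mat_mult:
  assumes "\<phi> \<in> carrier AutF" "\<psi> \<in> carrier AutF"
  shows "aut_mat (\<phi> \<otimes>\<^bsub>AutF\<^esub> \<psi>) = aut_mat \<phi> * aut_mat \<psi>"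
proof (rule eq_matI)
  fix i j assume "i < dim_row (aut_mat \<phi> * aut_mat \<psi>)" "j < dim_col (aut_mat \<phi> * aut_mat \<psi>)"
  then have ij: "i < n" "j < n" by (auto simp: aut_mat_def)
  have "aut_mat (\<phi> \<otimes>\<^bsub>AutF\<^esub> \<psi>) $$ (i, j) = ab (\<phi> (\<psi> (b j))) $ i"
    using ij assms by (simp add: AutF_mult compose_def aut_mat_def ab_def)
  also have "\<dots> = (aut_mat \<phi> *\<^sub>v ab (\<psi> (b j))) $ i"
    using ij assms by (subst ab_aut) (auto simp: AutF_carrier AutF_closed)
  also have "\<dots> = (aut_mat \<phi> * aut_mat \<psi>) $$ (i, j)"
    using ij by (simp add: aut_mat_def ab_def scalar_prod_def)
  finally show "aut_mat (\<phi> \<otimes>\<^bsub>AutF\<^esub> \<psi>) $$ (i, j) = (aut_mat \<phi> * aut_mat \<psi>) $$ (i, j)" .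
qed (auto simp: aut_mat_def)

lemma aut_mat_one: "aut_mat \<one>\<^bsub>AutF\<^esub> = 1\<^sub>m n"
  by (rule eq_matI) (auto simp: aut_mat_def AutF_one coord)

lemma aut_mat_pow:
  assumes "\<phi> \<in> carrier AutF"
  shows "aut_mat (\<phi> [^]\<^bsub>AutF\<^esub> (m::nat)) = aut_mat \<phi> ^\<^sub>m m"
proof -
  interpret A: group AutF by (rule group_AutF)
  show ?thesis
  proof (induction m)
    case 0 then show ?case using carrier_matD[OF aut_mat_carrier[of \<phi>]] by (simp add: aut_mat_one)
  next
    case (Suc m) then show ?case using assms by (simp add: aut_mat_mult)
  qed
qed

text \<open>Two substitutions of the basis that undo each other define an automorphism. The hypothesis
  is phrased with arbitrary extensions \<open>h\<close> and \<open>h'\<close> so that it can be checked on the basis.\<close>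

lemma ex_automorphism_of_inverse_substitutions:
  assumes t: "\<And>i. i < n \<Longrightarrow> t i \<in> carrier F" and t': "\<And>i. i < n \<Longrightarrow> t' i \<in> carrier F"
    and inv: "\<And>h h' i. h \<in> hom F F \<Longrightarrow> h' \<in> hom F F \<Longrightarrow> (\<And>i. i < n \<Longrightarrow> h (b i) = t i) \<Longrightarrow>
       (\<And>i. i < n \<Longrightarrow> h' (b i) = t' i) \<Longrightarrow> i < n \<Longrightarrow> h (t' i) = b i \<and> h' (t i) = b i"
  shows "\<exists>\<phi>\<in>carrier AutF. \<forall>i<n. \<phi> (b i) = t i"
proof -
  have ex: "\<exists>h\<in>hom F F. \<forall>i<n. h (b i) = s i" if "\<And>i. i < n \<Longrightarrow> s i \<in> carrier F" for s
  proof -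
    define s' where "s' x = s (the_inv_into {..<n} b x)" for x
    have s': "s' (b i) = s i" if "i < n" for i
      using b that by (simp add: s'_def the_inv_into_f_f bij_betw_def)
    have "s' ` X \<subseteq> carrier F" using X_eq s' that by force
    from ex_hom_extending[OF is_group this] obtain h where h: "h \<in> hom F F" "\<forall>x\<in>X. h x = s' x" by (rule bexE)
    have "\<forall>i<n. h (b i) = s i" using h(2) s' b_in_X by simp
    with h(1) show ?thesis by blast
  qed
  obtain h where h: "h \<in> hom F F" "\<And>i. i < n \<Longrightarrow> h (b i) = t i" using ex[of t] t by auto
  obtain h' where h': "h' \<in> hom F F" "\<And>i. i < n \<Longrightarrow> h' (b i) = t' i" using ex[of t'] t' by auto
  note I = inv[OF h(1) h'(1) h(2) h'(2)]
  have hh': "h (h' g) = g" "h' (h g) = g" if "g \<in> carrier F" for g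
  proof -
    have id: "(\<lambda>g. g) \<in> hom F F" by (simp add: hom_def)
    have c: "(\<lambda>g. h (h' g)) \<in> hom F F" "(\<lambda>g. h' (h g)) \<in> hom F F"
      using h(1) h'(1) by (auto simp: hom_def Pi_iff)
    have "h (h' x) = x" if "x \<in> X" for x using X_eq[OF that] I h'(2) by auto
    then show "h (h' g) = g" using hom_eqI[OF is_group c(1) id _ that] by simp
    have "h' (h x) = x" if "x \<in> X" for x using X_eq[OF that] I h(2) by auto
    then show "h' (h g) = g" using hom_eqI[OF is_group c(2) id _ that] by simp
  qed
  define \<phi> where "\<phi> = restrict h (carrier F)"
  have "bij_betw \<phi> (carrier F) (carrier F)"
    by (rule bij_betwI[where g = h']) (use h h' hh' in \<open>auto simp: \<phi>_def hom_in_carrier\<close>)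
  moreover have "\<phi> \<in> hom F F" using h(1) by (auto simp: hom_def \<phi>_def)
  ultimately have "\<phi> \<in> carrier AutF" by (simp add: AutF_carrier \<phi>_def)
  moreover have "\<forall>i<n. \<phi> (b i) = t i" using h by (simp add: \<phi>_def)
  ultimately show ?thesis by blast
qed

text \<open>The Nielsen automorphism that multiplies \<open>b k\<close> on the right by the \<open>a\<close>-th power of \<open>b l\<close>.\<close>

lemma ex_transvection:
  assumes kl: "k < n" "l < n" "k \<noteq> l"
  shows "\<exists>\<phi>\<in>carrier AutF. aut_mat \<phi> = addrow_mat n a l k"
proof -
  define t where "t c i = (if i = k then b k \<otimes> b l [^] (c::int) else b i)" for c i
  have t: "t c i \<in> carrier F" if "i < n" for c i using that kl by (simp add: t_def)
  have inv: "h (t (- c) i) = b i"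
    if h: "h \<in> hom F F" "\<And>i. i < n \<Longrightarrow> h (b i) = t c i" and i: "i < n" for h c i
  proof (cases "i = k")
    case True
    interpret hh: group_hom F F h using h(1) is_group by (simp add: group_hom_def group_hom_axioms_def)
    have "h (t (- c) k) = h (b k) \<otimes> h (b l) [^] (- c)"
      using kl by (simp add: t_def hh.hom_mult hh.hom_int_pow del: int_pow_neg)
    also have "\<dots> = b k \<otimes> b l [^] c \<otimes> b l [^] (- c)" using h(2) kl by (simp add: t_def del: int_pow_neg)
    also have "\<dots> = b k \<otimes> (b l [^] c \<otimes> b l [^] (- c))" using kl by (intro m_assoc) auto
    also have "\<dots> = b k" using kl int_pow_mult[of "b l" c "- c"] by (simp del: int_pow_neg)
    finally show ?thesis using True by simp
  next
    case False then show ?thesis using h i by (simp add: t_def)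
  qed
  have "\<exists>\<phi>\<in>carrier AutF. \<forall>i<n. \<phi> (b i) = t a i"
  proof (rule ex_automorphism_of_inverse_substitutions[where t' = "t (- a)"])
    fix h h' i
    assume "h \<in> hom F F" "h' \<in> hom F F" "\<And>i. i < n \<Longrightarrow> h (b i) = t a i"
      "\<And>i. i < n \<Longrightarrow> h' (b i) = t (- a) i" "i < n"
    then show "h (t (- a) i) = b i \<and> h' (t a i) = b i" using inv[of h a i] inv[of h' "- a" i] by simp
  qed (use t in auto)
  then obtain \<phi> where \<phi>: "\<phi> \<in> carrier AutF" "\<forall>i<n. \<phi> (b i) = t a i" by blast
  have pw: "coord i (b m [^] c) = c * coord i (b m)" if "m < n" for i m and c :: int
  proof -
    interpret cc: group_hom F integer_group "coord i"
      using coord(1) by (simp add: group_hom_def group_hom_axioms_def)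
    show ?thesis using that cc.hom_int_pow[of "b m" c] by simp
  qed
  have "aut_mat \<phi> = addrow_mat n a l k"
  proof (rule eq_matI)
    fix i j assume "i < dim_row (addrow_mat n a l k)" "j < dim_col (addrow_mat n a l k)"
    then have ij: "i < n" "j < n" by auto
    show "aut_mat \<phi> $$ (i, j) = addrow_mat n a l k $$ (i, j)"
      using ij \<phi>(2) kl by (auto simp: aut_mat_def t_def coord(2) int_hom_mult[OF coord(1)] pw)
  qed (auto simp: aut_mat_def)
  with \<phi> show ?thesis by blast
qed

lemma ex_sign_change:
  assumes k: "k < n"
  shows "\<exists>\<phi>\<in>carrier AutF. aut_mat \<phi> = mat n n (\<lambda>(i, j). if i = j then if i = k then -1 else 1 else 0)"
proof -
  define t where "t i = (if i = k then inv (b k) else b i)" for i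
  have inv: "h (t i) = b i" if h: "h \<in> hom F F" "\<And>i. i < n \<Longrightarrow> h (b i) = t i" and i: "i < n" for h i
  proof -
    interpret hh: group_hom F F h using h(1) is_group by (simp add: group_hom_def group_hom_axioms_def)
    show ?thesis using h(2)[OF i] h(2)[OF k] i k by (auto simp: t_def)
  qed
  have "\<exists>\<phi>\<in>carrier AutF. \<forall>i<n. \<phi> (b i) = t i"
  proof (rule ex_automorphism_of_inverse_substitutions[where t' = t])
    fix h h' i
    assume "h \<in> hom F F" "h' \<in> hom F F" "\<And>i. i < n \<Longrightarrow> h (b i) = t i"
      "\<And>i. i < n \<Longrightarrow> h' (b i) = t i" "i < n"
    then show "h (t i) = b i \<and> h' (t i) = b i" using inv[of h i] inv[of h' i] by simp
  qed (use k in \<open>auto simp: t_def\<close>)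
  then obtain \<phi> where \<phi>: "\<phi> \<in> carrier AutF" "\<forall>i<n. \<phi> (b i) = t i" by blast
  have "aut_mat \<phi> = mat n n (\<lambda>(i, j). if i = j then if i = k then -1 else 1 else 0)"
    by (rule eq_matI) (use \<phi>(2) k in \<open>auto simp: aut_mat_def t_def coord(2) int_hom_inv[OF coord(1)]\<close>)
  with \<phi> show ?thesis by blast
qed

text \<open>The transpose of \<open>D\<close> preserves the annihilator of \<open>L0\<close>.\<close>

lemma annihilator_stable:
  assumes D: "D \<in> carrier_mat n n" and L: "L0 \<subseteq> carrier_vec n" "(\<lambda>v. D *\<^sub>v v) ` L0 \<subseteq> L0"
    and v: "v \<in> annihilator n (annihilator n L0)"
  shows "D *\<^sub>v v \<in> annihilator n (annihilator n L0)"
proof -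
  have vc: "v \<in> carrier_vec n" using v by (simp add: annihilator_def)
  have "\<alpha> \<bullet> (D *\<^sub>v v) = 0" if \<alpha>: "\<alpha> \<in> annihilator n L0" for \<alpha>
  proof -
    have \<alpha>c: "\<alpha> \<in> carrier_vec n" using \<alpha> by (simp add: annihilator_def)
    have tr: "(transpose_mat D *\<^sub>v \<alpha>) \<bullet> w = \<alpha> \<bullet> (D *\<^sub>v w)" if "w \<in> carrier_vec n" for w
      using transpose_vec_mult_scalar[OF D that \<alpha>c] by simp
    have "transpose_mat D *\<^sub>v \<alpha> \<in> annihilator n L0"
    proof -
      have "w \<bullet> (transpose_mat D *\<^sub>v \<alpha>) = 0" if w: "w \<in> L0" for w
      proof -
        have wc: "w \<in> carrier_vec n" "D *\<^sub>v w \<in> L0" using w L by auto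
        have "w \<bullet> (transpose_mat D *\<^sub>v \<alpha>) = \<alpha> \<bullet> (D *\<^sub>v w)"
          using tr[OF wc(1)] comm_scalar_prod[OF wc(1), of "transpose_mat D *\<^sub>v \<alpha>"] D \<alpha>c by simp
        also have "\<dots> = (D *\<^sub>v w) \<bullet> \<alpha>" using D \<alpha>c wc by (intro comm_scalar_prod[of _ n]) auto
        also have "\<dots> = 0" using \<alpha> wc by (simp add: annihilator_def)
        finally show ?thesis .
      qed
      then show ?thesis using D \<alpha>c by (simp add: annihilator_def)
    qed
    then show ?thesis using v tr[OF vc] by (simp add: annihilator_def)
  qed
  then show ?thesis using D vc by (simp add: annihilator_def)
qed

text \<open>Let \<open>H\<close> be a free factor that a power \<open>\<psi>\<close> of \<open>\<phi>\<close> maps to a conjugate, and \<open>K\<close> a complement. Conjugation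
  acts trivially on the abelianization, so the matrix of \<open>\<psi>\<close> preserves the image of \<open>H\<close> and its saturation
  \<open>L\<close>; by \<open>stabilizer_of_power\<close> so does \<open>aut_mat \<phi> ^\<^sub>m e\<close>. The invariant subgroup is \<open>W = L + p \<int>\<^sup>n\<close>. A functional
  with value \<open>1\<close> on \<open>H\<close> shows that \<open>W\<close> contains a vector that is nonzero modulo \<open>p\<close>; a functional that vanishes on
  \<open>H\<close> and has value \<open>1\<close> on \<open>K\<close> shows that \<open>W\<close> is proper.\<close>

theorem not_strongly_irreducible_imp_reducible_mod:
  assumes \<phi>: "\<phi> \<in> carrier AutF" and red: "\<not> strongly_irreducible_aut F \<phi>"
    and e: "cong_mat n 6 (aut_mat \<phi> ^\<^sub>m e) (1\<^sub>m n)" and p: "prime (p :: int)"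
  shows "reducible_mod n p (aut_mat \<phi> ^\<^sub>m e)"
proof -
  interpret A: group AutF by (rule group_AutF)
  obtain m H where m: "m > 0" and H: "proper_free_factor F H"
    and conj: "(\<phi> [^]\<^bsub>AutF\<^esub> (m::nat)) ` H \<in> conjugacy_class F H"
    using red by (auto simp: strongly_irreducible_aut_def)
  obtain K where K: "is_free_product F UNIV (\<lambda>c::bool. if c then H else K) (carrier F)"
    using H by (auto simp: proper_free_factor_def free_factor_def)
  have sub: "subgroup H F" "subgroup K F"
    using K by (auto simp: is_free_product_def split: if_splits)
  have Hc: "H \<subseteq> carrier F" using sub by (simp add: subgroup.subset)
  have Kn: "K \<noteq> {\<one>}"
  proof
    assume K1: "K = {\<one>}"
    have "carrier F \<subseteq> H"
    proof
      fix g assume "g \<in> carrier F"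
      then obtain w where w: "w \<in> free_product_words F UNIV (\<lambda>c::bool. if c then H else K)"
        "g = word_prod F (map snd w)" using K by (auto simp: is_free_product_def bij_betw_def)
      have "set (map snd w) \<subseteq> H"
        using w(1) K1 by (auto simp: free_product_words_def dest!: subsetD split: if_splits)
      then have "word_prod F (map snd w) \<in> H"
        by (induction w) (use sub(1) in \<open>auto simp: subgroup.one_closed subgroup.m_closed\<close>)
      then show "g \<in> H" using w by simp
    qed
    then show False using H Hc by (auto simp: proper_free_factor_def)
  qed
  have Hn: "H \<noteq> {\<one>}" using H by (simp add: proper_free_factor_def)
  obtain \<beta> h where \<beta>: "\<beta> \<in> hom F integer_group" "h \<in> H" "\<beta> h = 1"
    using free_factor_functional[OF K, of True] Hn by auto
  obtain \<beta>' k where \<beta>': "\<beta>' \<in> hom F integer_group" "k \<in> K" "\<beta>' k = 1" "\<And>x. x \<in> H \<Longrightarrow> \<beta>' x = 0"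
    using free_factor_functional[OF K, of False] Kn by auto
  define L0 where "L0 = ab ` H"
  have L0: "L0 \<subseteq> carrier_vec n" by (auto simp: L0_def)
  define C where "C = aut_mat \<phi> ^\<^sub>m m"
  have C: "C \<in> carrier_mat n n" by (simp add: C_def)
  define \<psi> where "\<psi> = \<phi> [^]\<^bsub>AutF\<^esub> m"
  have \<psi>: "\<psi> \<in> carrier AutF" "aut_mat \<psi> = C" using \<phi> by (auto simp: \<psi>_def C_def aut_mat_pow)
  obtain g where g: "g \<in> carrier F" "\<psi> ` H = (\<lambda>h. g \<otimes> h \<otimes> inv g) ` H"
    using conj unfolding \<psi>_def conjugacy_class_def by blast
  have "(\<lambda>v. C *\<^sub>v v) ` L0 = ab ` (\<psi> ` H)"
    unfolding L0_def image_image using \<psi> Hc by (intro image_cong) (auto simp: ab_aut AutF_carrier)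
  also have "\<dots> = L0" unfolding g(2) L0_def image_image using g Hc
    by (intro image_cong) (auto simp: ab_conj)
  finally have CL0: "(\<lambda>v. C *\<^sub>v v) ` L0 = L0" .
  define C' where "C' = aut_mat (inv\<^bsub>AutF\<^esub> \<psi>)"
  have C': "C' \<in> carrier_mat n n" "C' * C = 1\<^sub>m n" "C * C' = 1\<^sub>m n"
    using aut_mat_mult[of "inv\<^bsub>AutF\<^esub> \<psi>" \<psi>] aut_mat_mult[of \<psi> "inv\<^bsub>AutF\<^esub> \<psi>"] \<psi>
    by (auto simp: C'_def aut_mat_one)
  have "(\<lambda>v. C' *\<^sub>v v) ` L0 = (\<lambda>v. (C' * C) *\<^sub>v v) ` L0"
    using image_mult_mat_vec[OF C'(1) C L0] CL0 by simp
  also have "\<dots> = L0"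
  proof -
    have "(1\<^sub>m n :: int mat) *\<^sub>v v = v" if "v \<in> L0" for v using that L0 by auto
    then show ?thesis using C' by simp
  qed
  finally have C'L0: "(\<lambda>v. C' *\<^sub>v v) ` L0 = L0" .
  define S where "S = annihilator n L0"
  have S: "S \<subseteq> carrier_vec n" by (auto simp: S_def annihilator_def)
  define L where "L = annihilator n S"
  have Lc: "L \<subseteq> carrier_vec n" by (auto simp: L_def annihilator_def)
  have CL: "(\<lambda>v. C *\<^sub>v v) ` L = L"
  proof
    show "(\<lambda>v. C *\<^sub>v v) ` L \<subseteq> L"
      unfolding L_def S_def using annihilator_stable[OF C L0] CL0 by auto
    show "L \<subseteq> (\<lambda>v. C *\<^sub>v v) ` L"
    proof
      fix v assume v: "v \<in> L"
      then have "C' *\<^sub>v v \<in> L"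
        unfolding L_def S_def using annihilator_stable[OF C'(1) L0] C'L0 by auto
      moreover have "C *\<^sub>v (C' *\<^sub>v v) = v"
        using assoc_mult_mat_vec[OF C C'(1), of v] C' v Lc by auto
      ultimately show "v \<in> (\<lambda>v. C *\<^sub>v v) ` L" by (metis image_eqI)
    qed
  qed
  define B where "B = aut_mat \<phi> ^\<^sub>m e"
  have B: "B \<in> carrier_mat n n" by (simp add: B_def)
  have "B ^\<^sub>m m = C ^\<^sub>m e"
    unfolding B_def C_def using pow_mat_mult[OF aut_mat_carrier, of \<phi> e m] pow_mat_mult[OF aut_mat_carrier, of \<phi> m e]
    by (simp add: mult.commute)
  then have "(\<lambda>v. B ^\<^sub>m m *\<^sub>v v) ` L = L" using image_pow_mat[OF C Lc CL, of e] by simp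
  then have BL: "(\<lambda>v. B *\<^sub>v v) ` L = L"
    unfolding L_def using stabilizer_of_power[OF B _ S m] e by (simp add: B_def)
  define W where "W = {v \<in> carrier_vec n. \<exists>u\<in>L. \<exists>x\<in>carrier_vec n. v = u + p \<cdot>\<^sub>v x}"
  have L_add: "u + u' \<in> L" if "u \<in> L" "u' \<in> L" for u u'
  proof -
    have "\<alpha> \<bullet> (u + u') = 0" if "\<alpha> \<in> S" for \<alpha>
      using that \<open>u \<in> L\<close> \<open>u' \<in> L\<close> S scalar_prod_add_distrib[of \<alpha> n u u'] by (auto simp: L_def annihilator_def)
    then show ?thesis using that Lc by (auto simp: L_def annihilator_def)
  qed
  have L0L: "L0 \<subseteq> L"
  proof
    fix v assume v: "v \<in> L0"
    have "\<alpha> \<bullet> v = 0" if "\<alpha> \<in> S" for \<alpha>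
      using that v L0 comm_scalar_prod[of \<alpha> n v] by (auto simp: S_def annihilator_def)
    then show "v \<in> L" using v L0 by (auto simp: L_def annihilator_def)
  qed
  have zero_L: "0\<^sub>v n \<in> L" using S by (auto simp: L_def annihilator_def)
  have W1: "v + w \<in> W" if vw: "v \<in> W" "w \<in> W" for v w
  proof -
    obtain u x u' x' where ux: "u \<in> L" "x \<in> carrier_vec n" "v = u + p \<cdot>\<^sub>v x"
      "u' \<in> L" "x' \<in> carrier_vec n" "w = u' + p \<cdot>\<^sub>v x'" using vw by (auto simp: W_def)
    have "v + w = (u + u') + p \<cdot>\<^sub>v (x + x')"
      using ux Lc by (intro eq_vecI) (auto simp: algebra_simps)
    then show ?thesis using ux L_add[OF ux(1,4)] Lc unfolding W_def
      by (intro CollectI conjI bexI[of _ "u + u'"] bexI[of _ "x + x'"]) auto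
  qed
  have W2: "p \<cdot>\<^sub>v v \<in> W" if "v \<in> carrier_vec n" for v
    using that zero_L unfolding W_def by (intro CollectI conjI bexI[of _ "0\<^sub>v n"] bexI[of _ v]) auto
  have W3: "B *\<^sub>v v \<in> W" if v: "v \<in> W" for v
  proof -
    obtain u x where ux: "u \<in> L" "x \<in> carrier_vec n" "v = u + p \<cdot>\<^sub>v x" using v by (auto simp: W_def)
    have "B *\<^sub>v (p \<cdot>\<^sub>v x) = p \<cdot>\<^sub>v (B *\<^sub>v x)"
      using B ux(2) by (intro eq_vecI) (auto simp: scalar_prod_smult_distrib[of _ n])
    then have "B *\<^sub>v v = B *\<^sub>v u + p \<cdot>\<^sub>v (B *\<^sub>v x)"
      using ux Lc B mult_add_distrib_mat_vec[OF B, of u "p \<cdot>\<^sub>v x"] by auto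
    then show ?thesis using ux BL B Lc unfolding W_def
      by (intro CollectI conjI bexI[of _ "B *\<^sub>v u"] bexI[of _ "B *\<^sub>v x"]) auto
  qed
  have dvd_prod: "p dvd \<alpha> \<bullet> v" if "\<And>i. i < n \<Longrightarrow> p dvd v $ i" "v \<in> carrier_vec n" for \<alpha> v
    using that by (auto simp: scalar_prod_def intro!: dvd_sum)
  have abh: "ab h \<in> W"
    using L0L \<beta>(2) unfolding W_def L0_def
    by (intro CollectI conjI bexI[of _ "ab h"] bexI[of _ "0\<^sub>v n"]) auto
  have W4: "\<exists>w\<in>W. \<exists>i<n. \<not> p dvd w $ i"
  proof (rule ccontr)
    assume "\<not> ?thesis"
    then have "p dvd hom_vec \<beta> \<bullet> ab h" using abh by (intro dvd_prod) auto
    then have "p dvd 1" using hom_vec_ab[OF \<beta>(1), of h] \<beta> Hc by auto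
    then show False using p not_prime_unit by blast
  qed
  have W5: "W \<noteq> carrier_vec n"
  proof
    assume "W = carrier_vec n"
    then have "ab k \<in> W" using ab_carrier[of k] by blast
    then obtain u x where ux: "u \<in> L" "x \<in> carrier_vec n" "ab k = u + p \<cdot>\<^sub>v x"
      unfolding W_def by blast
    have kc: "k \<in> carrier F" using \<beta>'(2) sub(2) subgroup.mem_carrier by metis
    have "hom_vec \<beta>' \<in> S"
    proof -
      have "v \<bullet> hom_vec \<beta>' = 0" if "v \<in> L0" for v
        using that hom_vec_ab[OF \<beta>'(1)] \<beta>'(4) Hc comm_scalar_prod[of v n "hom_vec \<beta>'"]
        by (auto simp: L0_def)
      then show ?thesis by (simp add: S_def annihilator_def)
    qed
    then have "hom_vec \<beta>' \<bullet> u = 0" using ux(1) by (simp add: L_def annihilator_def)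
    moreover have "hom_vec \<beta>' \<bullet> ab k = 1" using hom_vec_ab[OF \<beta>'(1) kc] \<beta>' by simp
    moreover have "hom_vec \<beta>' \<bullet> (u + p \<cdot>\<^sub>v x) = hom_vec \<beta>' \<bullet> u + p * (hom_vec \<beta>' \<bullet> x)"
      using ux Lc scalar_prod_add_distrib[of "hom_vec \<beta>'" n u "p \<cdot>\<^sub>v x"] by auto
    ultimately have "p dvd 1" using ux(3) by (metis add_0 dvd_triv_left)
    then show False using p not_prime_unit by blast
  qed
  have "W \<subseteq> carrier_vec n" by (auto simp: W_def)
  then show ?thesis
    unfolding reducible_mod_def B_def[symmetric]
    using W1 W2 W3 W4 W5 by (intro exI[of _ W]) blast
qed

end

section \<open>Finite fields as residue rings of cyclotomic integers\<close>

definition cong_vec :: "nat \<Rightarrow> int \<Rightarrow> int vec \<Rightarrow> int vec \<Rightarrow> bool" where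
  "cong_vec n m v w \<longleftrightarrow> (\<forall>i<n. [v $ i = w $ i] (mod m))"

text \<open>The properties of a Singer cycle \<open>C\<close> that are used below: it permutes the nonzero vectors of
  \<open>(\<int>/p)\<^sup>n\<close> in a single cycle, and its powers are the nonzero elements of a field, in which a
  nonzero polynomial of degree at most \<open>n\<close> has at most \<open>n\<close> roots.\<close>

locale singer_matrix =
  fixes p n N :: nat and C :: "int mat"
  assumes p: "prime p" and n: "n > 0" and N: "p ^ n = Suc N" and C: "C \<in> carrier_mat n n"
    and C_N: "cong_mat n (int p) (C ^\<^sub>m N) (1\<^sub>m n)"
    and orbit: "\<And>v. v \<in> carrier_vec n \<Longrightarrow> (\<exists>i<n. \<not> int p dvd v $ i) \<Longrightarrow>
        \<exists>k<N. cong_vec n (int p) v (C ^\<^sub>m k *\<^sub>v unit_vec n 0)"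
    and nonzero: "\<And>k. \<exists>i<n. \<not> int p dvd (C ^\<^sub>m k *\<^sub>v unit_vec n 0) $ i"
    and inj: "\<And>j k. cong_vec n (int p) (C ^\<^sub>m j *\<^sub>v unit_vec n 0) (C ^\<^sub>m k *\<^sub>v unit_vec n 0) \<Longrightarrow>
        j mod N = k mod N"
    and roots: "\<And>g :: nat \<Rightarrow> int. (\<exists>l\<le>n. \<not> int p dvd g l) \<Longrightarrow>
        card {k. k < N \<and> (\<forall>i<n. int p dvd (\<Sum>l\<le>n. g l * (C ^\<^sub>m (k * l) *\<^sub>v unit_vec n 0) $ i))} \<le> n"

text \<open>The field with \<open>p\<^sup>n\<close> elements is realized as \<open>R/P\<close>, where \<open>R = \<int>[\<zeta>]\<close> for a primitive
  root of unity \<open>\<zeta>\<close> of order \<open>N = p\<^sup>n - 1\<close>, and \<open>P\<close> is a maximal ideal that contains \<open>p\<close>. In this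
  model the multiplicative group is cyclic by construction, generated by the class of \<open>\<zeta>\<close>.\<close>

locale singer =
  fixes p n :: nat
  assumes p: "prime p" and n: "n > 0"
begin

definition N :: nat where "N = p ^ n - 1"

lemma p_pow: "p ^ n = Suc N" and N_pos: "N > 0"
proof -
  have "p ^ n > 1" using p n prime_gt_1_nat one_less_power by blast
  then show "p ^ n = Suc N" "N > 0" by (auto simp: N_def)
qed

definition \<zeta> :: complex where "\<zeta> = cis (2 * pi / real N)"

lemma zeta_pow: "\<zeta> ^ k = cis (2 * pi * real k / real N)"
proof -
  have "\<zeta> ^ k = cis (real k * (2 * pi / real N))" unfolding \<zeta>_def by (rule Complex.DeMoivre)
  also have "real k * (2 * pi / real N) = 2 * pi * real k / real N" by simp
  finally show ?thesis .
qed

lemma zeta_pow_N: "\<zeta> ^ N = 1"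
  using N_pos by (simp add: zeta_pow)

lemma zeta_pow_mod: "\<zeta> ^ (k mod N) = \<zeta> ^ k"
proof -
  have "\<zeta> ^ k = \<zeta> ^ (N * (k div N) + k mod N)" by simp
  also have "\<dots> = \<zeta> ^ (k mod N)" unfolding power_add power_mult zeta_pow_N by simp
  finally show ?thesis ..
qed

lemma zeta_pow_neq_1: "0 < i \<Longrightarrow> i < N \<Longrightarrow> \<zeta> ^ i \<noteq> 1"
proof
  assume i: "0 < i" "i < N" "\<zeta> ^ i = 1"
  have "inj_on (\<lambda>k. cis (2 * pi * real k / real N)) {..<N}"
    using Complex.bij_betw_roots_unity[OF N_pos] by (simp add: bij_betw_def)
  from inj_onD[OF this, of i 0] i zeta_pow[of i] show False by simp
qed

definition R :: "complex set" where
  "R = {\<Sum>k<N. of_int (c k) * \<zeta> ^ k | c. True}"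

lemma R_I: "(\<Sum>k<N. of_int (c k) * \<zeta> ^ k) \<in> R"
  by (auto simp: R_def)

lemma R_add: "x \<in> R \<Longrightarrow> y \<in> R \<Longrightarrow> x + y \<in> R"
proof -
  assume "x \<in> R" "y \<in> R"
  then obtain c d where "x = (\<Sum>k<N. of_int (c k) * \<zeta> ^ k)" "y = (\<Sum>k<N. of_int (d k) * \<zeta> ^ k)"
    by (auto simp: R_def)
  then have "x + y = (\<Sum>k<N. of_int (c k + d k) * \<zeta> ^ k)" by (simp add: sum.distrib algebra_simps)
  then show ?thesis using R_I by metis
qed

lemma R_of_int_mult: "x \<in> R \<Longrightarrow> of_int a * x \<in> R"
proof -
  assume "x \<in> R"
  then obtain c where "x = (\<Sum>k<N. of_int (c k) * \<zeta> ^ k)" by (auto simp: R_def)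
  then have "of_int a * x = (\<Sum>k<N. of_int (a * c k) * \<zeta> ^ k)" by (simp add: sum_distrib_left mult_ac)
  then show ?thesis using R_I by metis
qed

lemma R_zeta_pow: "\<zeta> ^ m \<in> R"
proof -
  have "\<zeta> ^ m = (\<Sum>k<N. of_int (if k = m mod N then 1 else 0) * \<zeta> ^ k)"
    using N_pos by (simp add: if_distrib[of "\<lambda>x. x * _"] if_distrib[of of_int] sum.delta zeta_pow_mod cong: if_cong)
  then show ?thesis using R_I by metis
qed

lemma R_1: "1 \<in> R" using R_zeta_pow[of 0] by simp
lemma R_0: "0 \<in> R" using R_of_int_mult[OF R_1, of 0] by simp
lemma R_of_int: "of_int a \<in> R" using R_of_int_mult[OF R_1, of a] by simp
lemma R_minus: "x \<in> R \<Longrightarrow> - x \<in> R" using R_of_int_mult[of x "-1"] by simp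
lemma R_diff: "x \<in> R \<Longrightarrow> y \<in> R \<Longrightarrow> x - y \<in> R" using R_add[OF _ R_minus, of x y] by simp

lemma R_sum: "(\<And>i. i \<in> A \<Longrightarrow> f i \<in> R) \<Longrightarrow> (\<Sum>i\<in>A. f i) \<in> R"
  by (induction A rule: infinite_finite_induct) (auto simp: R_0 R_add)

lemma R_mult: "x \<in> R \<Longrightarrow> y \<in> R \<Longrightarrow> x * y \<in> R"
proof -
  assume "x \<in> R" "y \<in> R"
  then obtain c d where "x = (\<Sum>k<N. of_int (c k) * \<zeta> ^ k)" "y = (\<Sum>k<N. of_int (d k) * \<zeta> ^ k)"
    by (auto simp: R_def)
  then have "x * y = (\<Sum>i<N. \<Sum>j<N. of_int (c i * d j) * \<zeta> ^ (i + j))"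
    by (simp add: sum_product power_add mult_ac)
  also have "\<dots> \<in> R" by (intro R_sum R_of_int_mult R_zeta_pow)
  finally show ?thesis .
qed

lemma R_pow: "x \<in> R \<Longrightarrow> x ^ k \<in> R"
  by (induction k) (auto simp: R_1 R_mult)

text \<open>Multiplication by \<open>r\<close> acts on the powers of \<open>\<zeta>\<close> by an integral circulant matrix. If
  \<open>p * r = 1\<close>, then the matrix \<open>p\<close> times this circulant minus the identity annihilates the vector of powers of
  \<open>\<zeta>\<close>, so its determinant is zero; but modulo \<open>p\<close> this determinant is \<open>(-1)\<close> to the power \<open>N\<close>.\<close>

lemma p_not_unit:
  assumes r: "r \<in> R" shows "of_nat p * r \<noteq> 1"
proof
  assume pr: "of_nat p * r = 1"
  obtain c where c: "r = (\<Sum>k<N. of_int (c k) * \<zeta> ^ k)" using r by (auto simp: R_def)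
  define M :: "int mat" where
    "M = mat N N (\<lambda>(i, j). int p * c ((j + N - i) mod N) - (if i = j then 1 else 0))"
  have M: "M \<in> carrier_mat N N" by (simp add: M_def)
  define v where "v = vec N (\<lambda>j. \<zeta> ^ j)"
  have vc: "v \<in> carrier_vec N" by (simp add: v_def)
  have "v $ 0 \<noteq> 0\<^sub>v N $ 0" using N_pos by (simp add: v_def)
  then have v0: "v \<noteq> 0\<^sub>v N" by metis
  have row: "(\<Sum>j<N. of_int (c ((j + N - i) mod N)) * \<zeta> ^ j) = r * \<zeta> ^ i" if i: "i < N" for i
  proof -
    have bij: "bij_betw (\<lambda>k. (k + i) mod N) {..<N} {..<N}"
    proof (rule bij_betwI[where g = "\<lambda>j. (j + N - i) mod N"])
      fix k assume "k \<in> {..<N}"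
      then have k: "k < N" by simp
      show "((k + i) mod N + N - i) mod N = k"
      proof (cases "k + i < N")
        case False
        then have "(k + i) mod N = k + i - N" using k i by (simp add: mod_if)
        then show ?thesis using k i False by simp
      qed (use k i in simp)
      show "((k + N - i) mod N + i) mod N = k"
      proof (cases "k < i")
        case True
        then show ?thesis using k i by simp
      next
        case False
        then have "(k + N - i) mod N = k - i" using k i by (simp add: mod_if)
        then show ?thesis using k i False by simp
      qed
    qed (use N_pos in auto)
    have "(\<Sum>j<N. of_int (c ((j + N - i) mod N)) * \<zeta> ^ j)
        = (\<Sum>k<N. of_int (c (((k + i) mod N + N - i) mod N)) * \<zeta> ^ ((k + i) mod N))"
      by (rule sum.reindex_bij_betw[OF bij, symmetric])
    also have "\<dots> = (\<Sum>k<N. of_int (c k) * \<zeta> ^ (k + i))"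
    proof (intro sum.cong refl)
      fix k assume "k \<in> {..<N}"
      then have k: "k < N" by simp
      have "((k + i) mod N + N - i) mod N = k"
      proof (cases "k + i < N")
        case False
        then have "(k + i) mod N = k + i - N" using k i by (simp add: mod_if)
        then show ?thesis using k i False by simp
      qed (use k i in simp)
      then show "of_int (c (((k + i) mod N + N - i) mod N)) * \<zeta> ^ ((k + i) mod N)
          = of_int (c k) * \<zeta> ^ (k + i)" by (simp add: zeta_pow_mod)
    qed
    also have "\<dots> = r * \<zeta> ^ i" by (simp add: c power_add sum_distrib_left mult_ac)
    finally show ?thesis .
  qed
  have "map_mat of_int M *\<^sub>v v = 0\<^sub>v N"
  proof (rule eq_vecI)
    fix i assume "i < dim_vec (0\<^sub>v N :: complex vec)"
    then have i: "i < N" by simp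
    have "(map_mat of_int M *\<^sub>v v) $ i = (\<Sum>j<N. of_int (M $$ (i, j)) * \<zeta> ^ j)"
      using i M by (simp add: v_def scalar_prod_def atLeast0LessThan)
    also have "\<dots> = (\<Sum>j<N. of_nat p * (of_int (c ((j + N - i) mod N)) * \<zeta> ^ j) - (if i = j then \<zeta> ^ j else 0))"
      using i by (intro sum.cong) (auto simp: M_def algebra_simps)
    also have "\<dots> = of_nat p * (r * \<zeta> ^ i) - \<zeta> ^ i"
      unfolding sum_subtractf sum_distrib_left[symmetric] row[OF i] using i by simp
    also have "\<dots> = (of_nat p * r) * \<zeta> ^ i - \<zeta> ^ i" by (simp only: mult.assoc)
    also have "\<dots> = 0" using pr by simp
    finally show "(map_mat of_int M *\<^sub>v v) $ i = (0\<^sub>v N) $ i" using i by simp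
  qed (simp add: M_def)
  then have "det (map_mat of_int M :: complex mat) = 0"
    using det_0_iff_vec_prod_zero[of "map_mat of_int M :: complex mat" N] M vc v0 by auto
  then have "det M = 0" by (simp add: of_int_hom.hom_det)
  moreover have "[det M = det (- 1 \<cdot>\<^sub>m 1\<^sub>m N)] (mod int p)"
  proof (rule cong_mat_det[OF M])
    show "cong_mat N (int p) M (- 1 \<cdot>\<^sub>m 1\<^sub>m N)"
      by (auto simp: cong_mat_def M_def cong_iff_dvd_diff)
  qed simp
  ultimately have "int p dvd (- 1) ^ N" by (simp add: cong_0_iff cong_sym_eq[of 0])
  then have "int p dvd 1" by (cases "even N") auto
  then show False using p by simp
qed

definition proper_ideal :: "complex set \<Rightarrow> bool" where
  "proper_ideal I \<longleftrightarrow> I \<subseteq> R \<and> (\<forall>x\<in>I. \<forall>y\<in>I. x + y \<in> I) \<and> (\<forall>r\<in>R. \<forall>x\<in>I. r * x \<in> I) \<and>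
     of_nat p \<in> I \<and> 1 \<notin> I"

text \<open>Zorn's lemma, starting from the ideal \<open>p R\<close>, which is proper by \<open>p_not_unit\<close>.\<close>

lemma ex_maximal_ideal:
  "\<exists>P. proper_ideal P \<and> (\<forall>I. proper_ideal I \<longrightarrow> P \<subseteq> I \<longrightarrow> I = P)"
proof -
  have "proper_ideal ((\<lambda>r. of_nat p * r) ` R)"
    unfolding proper_ideal_def
  proof (intro conjI ballI)
    show "(\<lambda>r. of_nat p * r) ` R \<subseteq> R" using R_of_int_mult[of _ "int p"] by auto
    show "x + y \<in> (\<lambda>r. of_nat p * r) ` R" if xy: "x \<in> (\<lambda>r. of_nat p * r) ` R" "y \<in> (\<lambda>r. of_nat p * r) ` R" for x y
    proof -
      obtain a b where "a \<in> R" "b \<in> R" "x = of_nat p * a" "y = of_nat p * b" using xy by blast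
      then show ?thesis by (intro image_eqI[of _ _ "a + b"]) (auto simp: R_add algebra_simps)
    qed
    show "r * x \<in> (\<lambda>r. of_nat p * r) ` R" if r: "r \<in> R" and x: "x \<in> (\<lambda>r. of_nat p * r) ` R" for r x
    proof -
      obtain a where "a \<in> R" "x = of_nat p * a" using x by blast
      then show ?thesis using r by (intro image_eqI[of _ _ "r * a"]) (auto simp: R_mult)
    qed
    show "of_nat p \<in> (\<lambda>r. of_nat p * r) ` R" using R_1 by force
    show "1 \<notin> (\<lambda>r. of_nat p * r) ` R" using p_not_unit by force
  qed
  then have ne: "Collect proper_ideal \<noteq> {}" by blast
  have chain: "\<Union>C \<in> Collect proper_ideal" if C: "C \<noteq> {}" "subset.chain (Collect proper_ideal) C" for C
  proof -
    have pi: "proper_ideal I" if "I \<in> C" for I using C that by (auto simp: subset.chain_def)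
    have lin: "I \<subseteq> J \<or> J \<subseteq> I" if "I \<in> C" "J \<in> C" for I J using C that by (auto simp: subset.chain_def)
    have "x + y \<in> \<Union>C" if xy: "x \<in> \<Union>C" "y \<in> \<Union>C" for x y
    proof -
      obtain I J where IJ: "x \<in> I" "I \<in> C" "y \<in> J" "J \<in> C" using xy by blast
      then consider "x \<in> J" | "y \<in> I" using lin by blast
      then show ?thesis
      proof cases
        case 1
        then have "x + y \<in> J" using pi[OF IJ(4)] IJ(3) unfolding proper_ideal_def by blast
        then show ?thesis using IJ by blast
      next
        case 2
        then have "x + y \<in> I" using pi[OF IJ(2)] IJ(1) unfolding proper_ideal_def by blast
        then show ?thesis using IJ by blast
      qed
    qed
    moreover have "of_nat p \<in> \<Union>C" using C(1) pi by (auto simp: proper_ideal_def)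
    moreover have "r * x \<in> \<Union>C" if "r \<in> R" "x \<in> \<Union>C" for r x
    proof -
      from that(2) obtain I where I: "x \<in> I" "I \<in> C" by blast
      then have "r * x \<in> I" using pi[OF I(2)] that(1) unfolding proper_ideal_def by blast
      then show ?thesis using I by blast
    qed
    moreover have "\<Union>C \<subseteq> R" using pi unfolding proper_ideal_def by blast
    moreover have "1 \<notin> \<Union>C" using pi unfolding proper_ideal_def by blast
    ultimately have "proper_ideal (\<Union>C)" unfolding proper_ideal_def by blast
    then show ?thesis by simp
  qed
  have "\<exists>M\<in>Collect proper_ideal. \<forall>X\<in>Collect proper_ideal. M \<subseteq> X \<longrightarrow> X = M"
    by (rule subset_Zorn_nonempty[OF ne chain])
  then show ?thesis by auto
qed

definition P :: "complex set" where
  "P = (SOME P. proper_ideal P \<and> (\<forall>I. proper_ideal I \<longrightarrow> P \<subseteq> I \<longrightarrow> I = P))"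

lemma P_ideal: "proper_ideal P" and P_max: "proper_ideal I \<Longrightarrow> P \<subseteq> I \<Longrightarrow> I = P"
  using someI_ex[OF ex_maximal_ideal] unfolding P_def by auto

lemma P_R: "x \<in> P \<Longrightarrow> x \<in> R" and P_add: "x \<in> P \<Longrightarrow> y \<in> P \<Longrightarrow> x + y \<in> P"
  and P_mult: "r \<in> R \<Longrightarrow> x \<in> P \<Longrightarrow> r * x \<in> P" and P_p: "of_nat p \<in> P" and P_1: "1 \<notin> P"
  using P_ideal by (auto simp: proper_ideal_def)

lemma P_0: "0 \<in> P" using P_mult[OF R_0 P_p] by simp
lemma P_minus: "x \<in> P \<Longrightarrow> - x \<in> P" using P_mult[OF R_of_int[of "-1"]] by simp
lemma P_diff: "x \<in> P \<Longrightarrow> y \<in> P \<Longrightarrow> x - y \<in> P" using P_add[OF _ P_minus, of x y] by simp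
lemma P_mult_right: "x \<in> P \<Longrightarrow> r \<in> R \<Longrightarrow> x * r \<in> P" using P_mult[of r x] by (simp add: mult.commute)
lemma P_sum: "(\<And>i. i \<in> A \<Longrightarrow> f i \<in> P) \<Longrightarrow> (\<Sum>i\<in>A. f i) \<in> P"
  by (induction A rule: infinite_finite_induct) (auto simp: P_0 P_add)

lemma P_prime:
  assumes "x \<in> R" "y \<in> R" "x * y \<in> P" "x \<notin> P" shows "y \<in> P"
proof -
  define I where "I = {a + r * x | a r. a \<in> P \<and> r \<in> R}"
  have PI: "P \<subseteq> I" using R_0 by (force simp: I_def)
  have "x \<in> I" using P_0 R_1 by (force simp: I_def)
  then have "\<not> proper_ideal I" using P_max[OF _ PI] assms(4) by blast
  moreover have "I \<subseteq> R" using assms(1) P_R by (auto simp: I_def intro!: R_add R_mult)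
  moreover have "u + v \<in> I" if uv: "u \<in> I" "v \<in> I" for u v
  proof -
    obtain a r a' r' where h: "u = a + r * x" "v = a' + r' * x" "a \<in> P" "a' \<in> P" "r \<in> R" "r' \<in> R"
      using uv by (auto simp: I_def)
    have "u + v = (a + a') + (r + r') * x" using h by (simp add: algebra_simps)
    then show ?thesis using h P_add R_add unfolding I_def by blast
  qed
  moreover have "s * u \<in> I" if su: "s \<in> R" "u \<in> I" for s u
  proof -
    obtain a r where h: "u = a + r * x" "a \<in> P" "r \<in> R" using su by (auto simp: I_def)
    have "s * u = s * a + (s * r) * x" using h by (simp add: algebra_simps)
    then show ?thesis using h su(1) P_mult R_mult unfolding I_def by blast
  qed
  ultimately have "1 \<in> I" using PI P_p unfolding proper_ideal_def by blast
  then obtain a r where "1 = a + r * x" "a \<in> P" "r \<in> R" by (auto simp: I_def)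
  then have "y = a * y + r * (x * y)" by (metis (no_types, lifting) distrib_right mult.assoc mult_1)
  then show ?thesis using P_mult_right[OF \<open>a \<in> P\<close> assms(2)] P_mult[OF \<open>r \<in> R\<close> assms(3)] P_add by metis
qed

lemma of_int_in_P: "of_int a \<in> P \<longleftrightarrow> int p dvd a"
proof
  assume a: "of_int a \<in> P"
  show "int p dvd a"
  proof (rule ccontr)
    assume "\<not> int p dvd a"
    then have "coprime (int p) a" using p by (simp add: prime_imp_coprime)
    then obtain u v where "u * int p + v * a = 1" using bezout_int[of "int p" a] by (metis coprime_iff_gcd_eq_1)
    then have "of_int (u * int p + v * a) = (1 :: complex)" by simp
    then have "(1 :: complex) = of_int u * of_nat p + of_int v * of_int a" by simp
    also have "\<dots> \<in> P" using a P_p by (intro P_add P_mult R_of_int)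
    finally show False using P_1 by simp
  qed
next
  assume "int p dvd a"
  then obtain b where "a = int p * b" by (auto simp: dvd_def)
  then show "of_int a \<in> P" using P_mult_right[OF P_p R_of_int[of b]] by simp
qed

definition eqv :: "complex \<Rightarrow> complex \<Rightarrow> bool" (infix "\<equiv>\<^sub>P" 50) where
  "x \<equiv>\<^sub>P y \<longleftrightarrow> x - y \<in> P"

lemma eqv_refl [simp]: "x \<equiv>\<^sub>P x" by (simp add: eqv_def P_0)
lemma eqv_sym: "x \<equiv>\<^sub>P y \<Longrightarrow> y \<equiv>\<^sub>P x" using P_minus[of "x - y"] by (simp add: eqv_def)
lemma eqv_trans [trans]: "x \<equiv>\<^sub>P y \<Longrightarrow> y \<equiv>\<^sub>P z \<Longrightarrow> x \<equiv>\<^sub>P z" using P_add[of "x - y" "y - z"] by (simp add: eqv_def)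
lemma eqv_add: "x \<equiv>\<^sub>P x' \<Longrightarrow> y \<equiv>\<^sub>P y' \<Longrightarrow> x + y \<equiv>\<^sub>P x' + y'"
  using P_add[of "x - x'" "y - y'"] by (simp add: eqv_def algebra_simps)
lemma eqv_sum: "(\<And>i. i \<in> A \<Longrightarrow> f i \<equiv>\<^sub>P g i) \<Longrightarrow> (\<Sum>i\<in>A. f i) \<equiv>\<^sub>P (\<Sum>i\<in>A. g i)"
  using P_sum[of A "\<lambda>i. f i - g i"] by (simp add: eqv_def sum_subtractf)
lemma eqv_mult_left: "r \<in> R \<Longrightarrow> x \<equiv>\<^sub>P y \<Longrightarrow> r * x \<equiv>\<^sub>P r * y"
  using P_mult[of r "x - y"] by (simp add: eqv_def algebra_simps)
lemma eqv_mult: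
  assumes "x \<equiv>\<^sub>P x'" "y \<equiv>\<^sub>P y'" "x \<in> R" "y' \<in> R" shows "x * y \<equiv>\<^sub>P x' * y'"
  using eqv_trans[OF eqv_mult_left[OF assms(3,2)] ] eqv_mult_left[OF assms(4,1)] by (simp add: mult.commute)
lemma eqv_pow: "x \<equiv>\<^sub>P y \<Longrightarrow> x \<in> R \<Longrightarrow> y \<in> R \<Longrightarrow> x ^ k \<equiv>\<^sub>P y ^ k"
  by (induction k) (auto intro!: eqv_mult R_pow)
lemma eqv_0_iff: "x \<equiv>\<^sub>P 0 \<longleftrightarrow> x \<in> P" by (simp add: eqv_def)

text \<open>The powers of a root of unity \<open>\<eta> \<noteq> 1\<close> of order dividing \<open>N\<close> sum to zero, whereas \<open>\<eta>\<close> congruent to \<open>1\<close> would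
  make this sum congruent to \<open>N\<close>, that is, to \<open>-1\<close>.\<close>

lemma zeta_pow_not_eqv_1:
  assumes "0 < i" "i < N" shows "\<not> \<zeta> ^ i \<equiv>\<^sub>P 1"
proof
  assume e: "\<zeta> ^ i \<equiv>\<^sub>P 1"
  define \<eta> where "\<eta> = \<zeta> ^ i"
  have "\<eta> \<noteq> 1" using zeta_pow_neq_1 assms by (simp add: \<eta>_def)
  have "\<eta> ^ N = 1" unfolding \<eta>_def by (metis mult.commute power_mult power_one zeta_pow_N)
  then have "(\<Sum>k<N. \<eta> ^ k) = 0" using \<open>\<eta> \<noteq> 1\<close> by (simp add: geometric_sum)
  moreover have "(\<Sum>k<N. \<eta> ^ k) \<equiv>\<^sub>P (\<Sum>k<N. 1)"
    using eqv_pow[OF e R_zeta_pow R_1] by (intro eqv_sum) (simp add: \<eta>_def)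
  ultimately have "0 \<equiv>\<^sub>P of_nat N" by simp
  then have "of_nat N \<in> P" using eqv_0_iff eqv_sym by blast
  then have "of_int (int N) \<in> P" by simp
  then have "int p dvd int N" by (simp only: of_int_in_P)
  then have "p dvd N" by simp
  moreover have "p dvd Suc N" unfolding p_pow[symmetric] using n by (simp add: dvd_power)
  ultimately have "p dvd 1" by (metis Suc_eq_plus1 dvd_add_right_iff)
  then show False using p by simp
qed

lemma zeta_pow_unit: "\<zeta> ^ k \<notin> P"
proof
  assume "\<zeta> ^ k \<in> P"
  then have "\<zeta> ^ (k mod N) \<in> P" by (simp add: zeta_pow_mod)
  then have "\<zeta> ^ (N - k mod N) * \<zeta> ^ (k mod N) \<in> P" by (intro P_mult R_zeta_pow)
  then have "\<zeta> ^ N \<in> P" using N_pos by (simp add: power_add[symmetric])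
  then show False using P_1 zeta_pow_N by simp
qed

lemma zeta_pow_eqv_iff: "\<zeta> ^ i \<equiv>\<^sub>P \<zeta> ^ j \<longleftrightarrow> i mod N = j mod N"
proof -
  have *: "\<not> \<zeta> ^ i \<equiv>\<^sub>P \<zeta> ^ j" if "i < j" "j < N" for i j
  proof
    assume "\<zeta> ^ i \<equiv>\<^sub>P \<zeta> ^ j"
    then have "\<zeta> ^ j - \<zeta> ^ i \<in> P" using eqv_sym by (simp add: eqv_def)
    also have "\<zeta> ^ j - \<zeta> ^ i = \<zeta> ^ i * (\<zeta> ^ (j - i) - 1)"
      using that by (simp add: algebra_simps power_add[symmetric])
    finally have "\<zeta> ^ (j - i) - 1 \<in> P"
      using P_prime[OF R_zeta_pow R_diff[OF R_zeta_pow R_1]] zeta_pow_unit by blast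
    then show False using zeta_pow_not_eqv_1[of "j - i"] that by (simp add: eqv_def less_imp_diff_less)
  qed
  have "\<zeta> ^ (i mod N) \<equiv>\<^sub>P \<zeta> ^ (j mod N) \<Longrightarrow> i mod N = j mod N"
    using *[of "i mod N" "j mod N"] *[of "j mod N" "i mod N"] N_pos eqv_sym
    by (metis mod_less_divisor nat_neq_iff)
  then show ?thesis using zeta_pow_mod by (metis eqv_refl)
qed

lemma frobenius_add:
  assumes "x \<in> R" "y \<in> R" shows "(x + y) ^ p \<equiv>\<^sub>P x ^ p + y ^ p"
proof -
  let ?f = "\<lambda>k. of_nat (p choose k) * x ^ k * y ^ (p - k)"
  have p2: "p \<ge> 2" using p prime_ge_2_nat by blast
  have "(x + y) ^ p = (\<Sum>k\<le>p. ?f k)" by (rule binomial_ring)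
  also have "{..p} = insert 0 (insert p {1..<p})" using p2 by auto
  also have "(\<Sum>k\<in>\<dots>. ?f k) = y ^ p + (x ^ p + (\<Sum>k\<in>{1..<p}. ?f k))" using p2 by simp
  finally have "(x + y) ^ p - (x ^ p + y ^ p) = (\<Sum>k\<in>{1..<p}. ?f k)" by simp
  moreover have "(\<Sum>k\<in>{1..<p}. ?f k) \<in> P"
  proof (rule P_sum)
    fix k assume "k \<in> {1..<p}"
    then have "p dvd (p choose k)" using p by (intro dvd_choose_prime) auto
    then have "of_int (int (p choose k)) \<in> P" unfolding of_int_in_P by simp
    then show "?f k \<in> P" using assms by (simp add: P_mult_right R_pow)
  qed
  ultimately show ?thesis by (simp add: eqv_def)
qed

lemma frobenius_pow_add:
  assumes "x \<in> R" "y \<in> R" shows "(x + y) ^ (p ^ m) \<equiv>\<^sub>P x ^ (p ^ m) + y ^ (p ^ m)"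
proof (induction m)
  case (Suc m)
  have "(x + y) ^ (p ^ Suc m) = ((x + y) ^ (p ^ m)) ^ p" by (simp add: power_mult[symmetric] mult.commute)
  also have "\<dots> \<equiv>\<^sub>P (x ^ (p ^ m) + y ^ (p ^ m)) ^ p"
    using assms by (intro eqv_pow Suc R_pow R_add)
  also have "\<dots> \<equiv>\<^sub>P (x ^ (p ^ m)) ^ p + (y ^ (p ^ m)) ^ p" using assms by (intro frobenius_add R_pow)
  finally show ?case by (simp add: power_mult[symmetric] mult.commute)
qed simp

text \<open>The elements that are fixed by the \<open>p ^ n\<close>-th power are closed under addition (Frobenius) and contain
  the powers of \<open>\<zeta>\<close>, because \<open>p ^ n = N + 1\<close>. Up to congruence every element of \<open>R\<close> is a combination of
  powers of \<open>\<zeta>\<close> with natural coefficients.\<close>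

lemma pow_q: assumes "r \<in> R" shows "r ^ (p ^ n) \<equiv>\<^sub>P r"
proof -
  define Fix where "Fix = {r \<in> R. r ^ (p ^ n) \<equiv>\<^sub>P r}"
  have Fix_add: "x + y \<in> Fix" if "x \<in> Fix" "y \<in> Fix" for x y
    using that eqv_trans[OF frobenius_pow_add eqv_add] R_add by (auto simp: Fix_def)
  have Fix_0: "0 \<in> Fix" by (simp add: Fix_def R_0 p_pow)
  have Fix_zeta: "\<zeta> ^ k \<in> Fix" for k
  proof -
    have "(\<zeta> ^ k) ^ (p ^ n) = \<zeta> ^ k * (\<zeta> ^ N) ^ k" unfolding p_pow
      by (simp add: power_mult[symmetric] mult.commute)
    then show ?thesis by (simp add: Fix_def zeta_pow_N R_zeta_pow)
  qed
  have Fix_mult: "of_nat m * x \<in> Fix" if "x \<in> Fix" for m x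
    by (induction m) (use that Fix_0 Fix_add in \<open>auto simp: algebra_simps\<close>)
  have Fix_sum: "(\<Sum>i\<in>A. f i) \<in> Fix" if "\<And>i. i \<in> A \<Longrightarrow> f i \<in> Fix" for A :: "nat set" and f
    using that by (induction A rule: infinite_finite_induct) (auto simp: Fix_0 Fix_add)
  obtain c where c: "r = (\<Sum>k<N. of_int (c k) * \<zeta> ^ k)" using assms by (auto simp: R_def)
  define r' where "r' = (\<Sum>k<N. of_nat (nat (c k mod int p)) * \<zeta> ^ k)"
  have r': "r' \<in> Fix" unfolding r'_def by (intro Fix_sum Fix_mult Fix_zeta)
  have rr': "r \<equiv>\<^sub>P r'" unfolding c r'_def
  proof (rule eqv_sum)
    fix k
    have "of_int (c k) - of_nat (nat (c k mod int p)) = (of_int (c k - c k mod int p) :: complex)"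
      using p prime_gt_0_nat[OF p] by simp
    also have "\<dots> \<in> P" unfolding of_int_in_P by (simp add: minus_mod_eq_mult_div)
    finally have "of_int (c k) \<equiv>\<^sub>P of_nat (nat (c k mod int p))" by (simp add: eqv_def)
    from eqv_mult_left[OF R_zeta_pow this, of k]
    show "of_int (c k) * \<zeta> ^ k \<equiv>\<^sub>P of_nat (nat (c k mod int p)) * \<zeta> ^ k" by (simp add: mult.commute)
  qed
  have "r ^ (p ^ n) \<equiv>\<^sub>P r' ^ (p ^ n)" using r' assms rr' by (intro eqv_pow) (auto simp: Fix_def)
  also have "\<dots> \<equiv>\<^sub>P r'" using r' by (simp add: Fix_def)
  also have "\<dots> \<equiv>\<^sub>P r" using rr' by (rule eqv_sym)
  finally show ?thesis .
qed

lemma poly_R: "(\<And>i. poly.coeff h i \<in> R) \<Longrightarrow> z \<in> R \<Longrightarrow> poly h z \<in> R"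
  unfolding poly_altdef by (intro R_sum R_mult R_pow) auto

lemma synthetic_div_R:
  "(\<And>i. poly.coeff h i \<in> R) \<Longrightarrow> z \<in> R \<Longrightarrow> poly.coeff (synthetic_div h z) i \<in> R"
proof (induction h arbitrary: i)
  case 0 then show ?case by (simp add: R_0)
next
  case (pCons a h)
  have h: "poly.coeff h i \<in> R" for i using pCons.prems(1)[of "Suc i"] by simp
  show ?case using pCons.IH[OF h] poly_R[OF h] pCons.prems(2)
    by (cases i) (auto simp: synthetic_div_pCons)
qed

text \<open>A nonzero polynomial over the field \<open>R/P\<close> has at most as many roots as its degree; linear
  factors are split off by synthetic division.\<close>

lemma roots_mod_P:
  assumes "finite Z" "\<And>i. poly.coeff h i \<in> R" "Z \<subseteq> R"
    "\<And>z w. z \<in> Z \<Longrightarrow> w \<in> Z \<Longrightarrow> z \<noteq> w \<Longrightarrow> \<not> z \<equiv>\<^sub>P w"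
    "\<And>z. z \<in> Z \<Longrightarrow> poly h z \<in> P" "degree h < card Z"
  shows "poly.coeff h i \<in> P"
  using assms
proof (induction Z arbitrary: h i rule: finite_induct)
  case empty then show ?case by simp
next
  case (insert z Z)
  define q where "q = synthetic_div h z"
  have zR: "z \<in> R" using insert.prems by blast
  have h: "h = [:-z, 1:] * q + [:poly h z:]" unfolding q_def by (rule synthetic_div_correct'[symmetric])
  have hz: "poly h z \<in> P" using insert.prems by blast
  have qP: "poly.coeff q i \<in> P" for i
  proof (cases "degree h = 0")
    case True
    then have "q = 0" by (simp add: q_def synthetic_div_eq_0_iff)
    then show ?thesis by (simp add: P_0)
  next
    case False
    show ?thesis
    proof (rule insert.IH)
      show "poly.coeff q i \<in> R" for i unfolding q_def using insert.prems(1) zR by (rule synthetic_div_R)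
      show "degree q < card Z" using False insert.prems(5) insert.hyps by (simp add: q_def degree_synthetic_div)
      fix w assume w: "w \<in> Z"
      have "poly h w = (w - z) * poly q w + poly h z" by (subst h) (simp add: algebra_simps)
      then have "(w - z) * poly q w \<in> P" using insert.prems(4)[of w] hz w P_diff[of "poly h w" "poly h z"] by simp
      moreover have "w - z \<notin> P" using insert.prems(3)[of w z] w insert.hyps by (auto simp: eqv_def)
      moreover have "poly q w \<in> R" unfolding q_def using insert.prems(1,2) zR w synthetic_div_R
        by (intro poly_R) auto
      ultimately show "poly q w \<in> P" using P_prime[of "w - z" "poly q w"] zR w insert.prems(2) R_diff by blast
    qed (use insert.prems in auto)
  qed
  have "poly.coeff h i = - z * poly.coeff q i + (if i = 0 then 0 else poly.coeff q (i - 1)) + (if i = 0 then poly h z else 0)"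
    by (subst h) (cases i; simp)
  also have "\<dots> \<in> P" using qP hz zR by (intro P_add P_mult R_minus) (auto simp: P_0)
  finally show ?case .
qed

text \<open>By \<open>pow_q\<close> every nonzero class is a root of \<open>X ^ N - 1\<close>. The powers of \<open>\<zeta>\<close> are \<open>N\<close> different roots,
  so there are no others.\<close>

lemma eqv_zeta_pow:
  assumes r: "r \<in> R" "r \<notin> P" shows "\<exists>k<N. r \<equiv>\<^sub>P \<zeta> ^ k"
proof (rule ccontr)
  assume neg: "\<not> ?thesis"
  have "r * (r ^ N - 1) \<in> P" using pow_q[OF r(1)] unfolding p_pow by (simp add: eqv_def algebra_simps)
  then have rN: "r ^ N - 1 \<in> P" using P_prime[OF r(1) _ _ r(2)] R_diff[OF R_pow[OF r(1)] R_1] by blast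
  define h :: "complex poly" where "h = Polynomial.monom 1 N - 1"
  define Z where "Z = insert r ((\<lambda>k. \<zeta> ^ k) ` {..<N})"
  have inj: "inj_on (\<lambda>k. \<zeta> ^ k) {..<N}"
    using zeta_pow_eqv_iff by (intro inj_onI) (metis eqv_refl lessThan_iff mod_less)
  have "r \<notin> (\<lambda>k. \<zeta> ^ k) ` {..<N}" using neg by auto
  then have cZ: "card Z = Suc N" unfolding Z_def using inj by (simp add: card_image)
  have "degree h \<le> N" unfolding h_def by (rule degree_diff_le) (auto simp: degree_monom_le)
  have "poly.coeff h N \<in> P"
  proof (rule roots_mod_P[of Z])
    show "finite Z" by (simp add: Z_def)
    show "poly.coeff h i \<in> R" for i by (auto simp: h_def R_0 R_1 R_minus R_diff)
    show "Z \<subseteq> R" using r R_zeta_pow by (auto simp: Z_def)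
    show "\<not> z \<equiv>\<^sub>P w" if "z \<in> Z" "w \<in> Z" "z \<noteq> w" for z w
      using that neg eqv_sym zeta_pow_eqv_iff by (auto simp: Z_def)
    show "poly h z \<in> P" if "z \<in> Z" for z
    proof -
      have "(\<zeta> ^ k) ^ N = 1" for k by (metis mult.commute power_mult power_one zeta_pow_N)
      then show ?thesis using that rN by (auto simp: Z_def h_def poly_monom P_0)
    qed
    show "degree h < card Z" using \<open>degree h \<le> N\<close> cZ by simp
  qed
  then show False using N_pos P_1 by (simp add: h_def)
qed

text \<open>Coordinates on \<open>R/P\<close> in the basis \<open>1, \<zeta>, \<dots>\<close>; the next lemma shows that the first \<open>n\<close> powers form a
  basis.\<close>

definition \<theta> :: "int vec \<Rightarrow> complex" where
  "\<theta> v = (\<Sum>i<n. of_int (v $ i) * \<zeta> ^ i)"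

text \<open>Let \<open>D\<close> be least such that \<open>\<zeta> ^ D\<close> is congruent to a combination of lower powers. Then the powers below
  \<open>D\<close> form a basis of \<open>R/P\<close> over \<open>\<int>/p\<close>. There are \<open>p ^ n\<close> classes by \<open>eqv_zeta_pow\<close>, and \<open>p ^ D\<close> coordinate
  vectors, so \<open>D = n\<close>.\<close>

lemma basis_dimension:
  "(\<forall>c::nat \<Rightarrow> int. (\<Sum>i<n. of_int (c i) * \<zeta> ^ i) \<in> P \<longrightarrow> (\<forall>i<n. int p dvd c i)) \<and>
   (\<forall>r\<in>R. \<exists>c::nat \<Rightarrow> int. r \<equiv>\<^sub>P (\<Sum>i<n. of_int (c i) * \<zeta> ^ i))"
proof -
  define comb where "comb d c = (\<Sum>i<d. of_int (c i) * \<zeta> ^ i)" for d and c :: "nat \<Rightarrow> int"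
  have comb_R: "comb d c \<in> R" for d c unfolding comb_def by (intro R_sum R_of_int_mult R_zeta_pow)
  have comb_add: "comb d c + comb d c' = comb d (\<lambda>i. c i + c' i)" for d c c'
    by (simp add: comb_def sum.distrib algebra_simps)
  have comb_diff: "comb d c - comb d c' = comb d (\<lambda>i. c i - c' i)" for d c c'
    by (simp add: comb_def sum_subtractf algebra_simps)
  have comb_mult: "of_int a * comb d c = comb d (\<lambda>i. a * c i)" for a d c
    by (simp add: comb_def sum_distrib_left mult_ac)
  have comb_cong: "comb d c \<equiv>\<^sub>P comb d c'" if "\<And>i. i < d \<Longrightarrow> int p dvd c i - c' i" for d c c'
  proof -
    have "(\<Sum>i<d. of_int (c i - c' i) * \<zeta> ^ i) \<in> P"
      using that by (intro P_sum P_mult_right R_zeta_pow) (simp only: of_int_in_P lessThan_iff)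
    then show ?thesis by (simp add: eqv_def comb_diff) (simp add: comb_def)
  qed
  define D where "D = (LEAST d. \<exists>c. \<zeta> ^ d \<equiv>\<^sub>P comb d c)"
  have "\<exists>c. \<zeta> ^ N \<equiv>\<^sub>P comb N c"
  proof
    have "comb N (\<lambda>i. if i = 0 then 1 else 0) = 1"
      using N_pos by (simp add: comb_def if_distrib[of of_int] if_distrib[of "\<lambda>x. x * _"] sum.delta cong: if_cong)
    then show "\<zeta> ^ N \<equiv>\<^sub>P comb N (\<lambda>i. if i = 0 then 1 else 0)" by (simp add: zeta_pow_N)
  qed
  then have "\<exists>d c. \<zeta> ^ d \<equiv>\<^sub>P comb d c" by blast
  then obtain a where a: "\<zeta> ^ D \<equiv>\<^sub>P comb D a" unfolding D_def by (rule exE[OF LeastI_ex])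
  have D_min: "\<not> \<zeta> ^ d \<equiv>\<^sub>P comb d c" if "d < D" for d c
    using not_less_Least[of d "\<lambda>d. \<exists>c. \<zeta> ^ d \<equiv>\<^sub>P comb d c"] that unfolding D_def by blast
  have indep: "\<forall>i<D. int p dvd c i" if c: "comb D c \<in> P" for c
  proof (rule ccontr)
    assume "\<not> ?thesis"
    then have ex: "{i. i < D \<and> \<not> int p dvd c i} \<noteq> {}" by blast
    define m where "m = Max {i. i < D \<and> \<not> int p dvd c i}"
    have m: "m < D" "\<not> int p dvd c m"
      using Max_in[OF _ ex] unfolding m_def by auto
    have top: "int p dvd c i" if "m < i" "i < D" for i
      using that Max_ge[of "{i. i < D \<and> \<not> int p dvd c i}" i] unfolding m_def by fastforce
    have "coprime (c m) (int p)" using m p by (simp add: prime_imp_coprime coprime_commute)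
    then obtain y where y: "[c m * y = 1] (mod int p)" using cong_solve_coprime_int by blast
    have "comb D c \<equiv>\<^sub>P comb D (\<lambda>i. if i \<le> m then c i else 0)"
      using top by (intro comb_cong) auto
    also have "comb D (\<lambda>i. if i \<le> m then c i else 0) = comb (Suc m) c"
      unfolding comb_def using m(1) by (intro sum.mono_neutral_cong_right) auto
    finally have "comb (Suc m) c \<in> P" using c P_diff by (metis eqv_0_iff eqv_sym eqv_trans)
    then have "of_int y * comb (Suc m) c \<in> P" by (rule P_mult[OF R_of_int])
    then have "comb (Suc m) (\<lambda>i. y * c i) \<in> P" by (simp add: comb_mult)
    moreover have "comb (Suc m) (\<lambda>i. y * c i) \<equiv>\<^sub>P comb (Suc m) (\<lambda>i. if i = m then 1 else y * c i)"
      using y by (intro comb_cong) (auto simp: cong_iff_dvd_diff mult.commute)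
    moreover have "comb (Suc m) (\<lambda>i. if i = m then 1 else y * c i) = comb m (\<lambda>i. y * c i) + \<zeta> ^ m"
      by (simp add: comb_def)
    ultimately have "comb m (\<lambda>i. y * c i) + \<zeta> ^ m \<in> P" by (metis eqv_0_iff eqv_sym eqv_trans)
    then have "\<zeta> ^ m \<equiv>\<^sub>P comb m (\<lambda>i. - (y * c i))"
      by (simp add: eqv_def comb_def sum_negf add.commute)
    then show False using D_min[OF m(1)] by blast
  qed
  have span_pow: "\<exists>c. \<zeta> ^ k \<equiv>\<^sub>P comb D c" for k
  proof (induction k)
    case 0
    show ?case
    proof (cases "D = 0")
      case True then show ?thesis using a by auto
    next
      case False
      then have "comb D (\<lambda>i. if i = 0 then 1 else 0) = 1"
        by (simp add: comb_def if_distrib[of of_int] if_distrib[of "\<lambda>x. x * _"] sum.delta cong: if_cong)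
      then show ?thesis by (intro exI[of _ "\<lambda>i. if i = 0 then 1 else 0"]) simp
    qed
  next
    case (Suc k)
    then obtain c where c: "\<zeta> ^ k \<equiv>\<^sub>P comb D c" by blast
    have "\<zeta> ^ Suc k \<equiv>\<^sub>P \<zeta> * comb D c" using eqv_mult_left[OF R_zeta_pow[of 1] c] by simp
    also have "\<zeta> * comb D c = (\<Sum>i<D. of_int (c i) * \<zeta> ^ Suc i)" by (simp add: comb_def sum_distrib_left mult_ac)
    also have "\<dots> = (\<Sum>i<Suc D. of_int (if i = 0 then 0 else c (i - 1)) * \<zeta> ^ i)"
      by (subst sum.lessThan_Suc_shift) simp
    also have "\<dots> = comb D (\<lambda>i. if i = 0 then 0 else c (i - 1)) + of_int (if D = 0 then 0 else c (D - 1)) * \<zeta> ^ D"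
      by (simp add: comb_def)
    also have "\<dots> \<equiv>\<^sub>P comb D (\<lambda>i. if i = 0 then 0 else c (i - 1)) + of_int (if D = 0 then 0 else c (D - 1)) * comb D a"
      by (intro eqv_add eqv_refl eqv_mult_left R_of_int a)
    finally show ?case unfolding comb_mult comb_add by blast
  qed
  have span: "\<exists>c. r \<equiv>\<^sub>P comb D c" if r: "r \<in> R" for r
  proof -
    obtain e where e: "r = (\<Sum>k<N. of_int (e k) * \<zeta> ^ k)" using r by (auto simp: R_def)
    obtain f where f: "\<And>k. \<zeta> ^ k \<equiv>\<^sub>P comb D (f k)" using span_pow by metis
    have "r \<equiv>\<^sub>P (\<Sum>k<N. of_int (e k) * comb D (f k))"
      unfolding e using f by (intro eqv_sum eqv_mult_left R_of_int)
    also have "\<dots> = comb D (\<lambda>i. \<Sum>k<N. e k * f k i)"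
      unfolding comb_def by (simp add: sum_distrib_left sum_distrib_right mult_ac) (rule sum.swap)
    finally show ?thesis by blast
  qed
  \<comment> \<open>Count the residue classes in two ways.\<close>
  define Cl where "Cl = insert 0 ((\<lambda>k. \<zeta> ^ k) ` {..<N})"
  have inj: "inj_on (\<lambda>k. \<zeta> ^ k) {..<N}"
    using zeta_pow_eqv_iff by (intro inj_onI) (metis eqv_refl lessThan_iff mod_less)
  have "0 \<notin> (\<lambda>k. \<zeta> ^ k) ` {..<N}" using zeta_pow_unit P_0 by (metis imageE)
  then have card_Cl: "card Cl = p ^ n" unfolding Cl_def p_pow using inj by (simp add: card_image)
  have Cl_R: "z \<in> R" if "z \<in> Cl" for z using that R_0 R_zeta_pow by (auto simp: Cl_def)
  have Cl_eqv: "z = w" if "z \<in> Cl" "w \<in> Cl" "z \<equiv>\<^sub>P w" for z w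
    using that zeta_pow_unit zeta_pow_eqv_iff by (auto simp: Cl_def eqv_0_iff dest: eqv_sym)
  have Cl_ex: "\<exists>z\<in>Cl. r \<equiv>\<^sub>P z" if "r \<in> R" for r
    using eqv_zeta_pow[OF that] by (cases "r \<in> P") (auto simp: Cl_def eqv_0_iff)
  define T where "T = ({..<D} \<rightarrow>\<^sub>E {0..<int p})"
  define rep where "rep c = (SOME z. z \<in> Cl \<and> comb D c \<equiv>\<^sub>P z)" for c
  have rep: "rep c \<in> Cl" "comb D c \<equiv>\<^sub>P rep c" for c
    using someI_ex[of "\<lambda>z. z \<in> Cl \<and> comb D c \<equiv>\<^sub>P z"] Cl_ex[OF comb_R] unfolding rep_def by blast+
  have "inj_on rep T"
  proof (rule inj_onI)
    fix c c' assume cc: "c \<in> T" "c' \<in> T" "rep c = rep c'"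
    have "comb D c \<equiv>\<^sub>P comb D c'" using rep[of c] rep[of c'] cc(3) by (metis eqv_sym eqv_trans)
    then have dv: "\<forall>i<D. int p dvd c i - c' i" by (intro indep) (simp add: eqv_def comb_diff)
    have "c i = c' i" if "i < D" for i
    proof -
      have "c i \<in> {0..<int p}" "c' i \<in> {0..<int p}" using PiE_mem[OF cc(1)[unfolded T_def], of i] PiE_mem[OF cc(2)[unfolded T_def], of i] that by auto
      moreover have "[c i = c' i] (mod int p)" using dv that by (simp add: cong_iff_dvd_diff)
      ultimately show ?thesis using cong_less_imp_eq_int[of "c i" "int p" "c' i"] by simp
    qed
    then show "c = c'" using PiE_ext[OF cc(1,2)[unfolded T_def]] by simp
  qed
  moreover have "rep ` T = Cl"
  proof
    show "Cl \<subseteq> rep ` T"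
    proof
      fix z assume z: "z \<in> Cl"
      obtain c where c: "z \<equiv>\<^sub>P comb D c" using span Cl_R[OF z] by blast
      define c' where "c' = (\<lambda>i\<in>{..<D}. c i mod int p)"
      have "c' \<in> T" using prime_gt_0_nat[OF p] by (auto simp: c'_def T_def)
      have "comb D c \<equiv>\<^sub>P comb D c'" by (intro comb_cong) (simp add: c'_def minus_mod_eq_mult_div)
      then have "z \<equiv>\<^sub>P rep c'" using c rep(2)[of c'] eqv_trans by blast
      then have "z = rep c'" using Cl_eqv z rep(1) by blast
      then show "z \<in> rep ` T" using \<open>c' \<in> T\<close> by blast
    qed
  qed (use rep in blast)
  ultimately have "card Cl = card T" using card_image by metis
  also have "card T = p ^ D" by (simp add: T_def card_PiE)
  finally have "p ^ D = p ^ n" using card_Cl by simp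
  then have "D = n" using prime_gt_1_nat[OF p] power_inject_exp by blast
  then show ?thesis using indep span unfolding comb_def by blast
qed

lemma theta_in_P: "\<theta> v \<in> P \<longleftrightarrow> (\<forall>i<n. int p dvd v $ i)"
proof
  show "\<theta> v \<in> P \<Longrightarrow> \<forall>i<n. int p dvd v $ i" using basis_dimension by (simp add: \<theta>_def)
  show "\<forall>i<n. int p dvd v $ i \<Longrightarrow> \<theta> v \<in> P"
    unfolding \<theta>_def by (intro P_sum P_mult_right R_zeta_pow) (simp only: of_int_in_P lessThan_iff)
qed

lemma theta_surj: "r \<in> R \<Longrightarrow> \<exists>v\<in>carrier_vec n. r \<equiv>\<^sub>P \<theta> v"
proof -
  assume "r \<in> R"
  then obtain c :: "nat \<Rightarrow> int" where "r \<equiv>\<^sub>P (\<Sum>i<n. of_int (c i) * \<zeta> ^ i)" using basis_dimension by blast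
  then show ?thesis by (intro bexI[of _ "vec n c"]) (auto simp: \<theta>_def)
qed

lemma theta_R: "\<theta> v \<in> R"
  unfolding \<theta>_def by (intro R_sum R_of_int_mult R_zeta_pow)

lemma theta_eqv:
  assumes "v \<in> carrier_vec n" "w \<in> carrier_vec n"
  shows "\<theta> v \<equiv>\<^sub>P \<theta> w \<longleftrightarrow> (\<forall>i<n. [v $ i = w $ i] (mod int p))"
proof -
  have "\<theta> v - \<theta> w = \<theta> (v - w)" using assms by (simp add: \<theta>_def sum_subtractf algebra_simps)
  then show ?thesis using assms by (simp add: eqv_def theta_in_P cong_iff_dvd_diff)
qed

text \<open>\<open>C\<close> is the matrix of multiplication by \<open>\<zeta>\<close> in the basis \<open>1, \<zeta>, \<dots>, \<zeta>\<^sup>n\<^sup>-\<^sup>1\<close>. The first basis vector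
  corresponds to \<open>1\<close>, so \<open>C\<^sup>k\<close> maps it to the coordinates of \<open>\<zeta>\<^sup>k\<close>.\<close>

theorem ex_singer_matrix: "\<exists>C. singer_matrix p n N C"
proof -
  have "\<exists>u. u \<in> carrier_vec n \<and> \<zeta> ^ Suc j \<equiv>\<^sub>P \<theta> u" for j using theta_surj[OF R_zeta_pow, of "Suc j"] by blast
  then obtain u where u: "\<And>j. u j \<in> carrier_vec n" "\<And>j. \<zeta> ^ Suc j \<equiv>\<^sub>P \<theta> (u j)" by metis
  define C where "C = mat n n (\<lambda>(i, j). u j $ i)"
  have C: "C \<in> carrier_mat n n" by (simp add: C_def)
  have mult: "\<theta> (C *\<^sub>v v) \<equiv>\<^sub>P \<zeta> * \<theta> v" if v: "v \<in> carrier_vec n" for v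
  proof -
    have "\<theta> (C *\<^sub>v v) = (\<Sum>i<n. \<Sum>j<n. of_int (u j $ i) * of_int (v $ j) * \<zeta> ^ i)"
      using v by (simp add: \<theta>_def C_def scalar_prod_def atLeast0LessThan sum_distrib_right)
    also have "\<dots> = (\<Sum>j<n. \<Sum>i<n. of_int (u j $ i) * of_int (v $ j) * \<zeta> ^ i)" by (rule sum.swap)
    also have "\<dots> = (\<Sum>j<n. of_int (v $ j) * \<theta> (u j))" by (simp add: \<theta>_def sum_distrib_left mult_ac)
    also have "\<dots> \<equiv>\<^sub>P (\<Sum>j<n. of_int (v $ j) * \<zeta> ^ Suc j)"
      by (intro eqv_sum eqv_mult_left R_of_int eqv_sym[OF u(2)])
    also have "\<dots> = \<zeta> * \<theta> v" by (simp add: \<theta>_def sum_distrib_left mult_ac)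
    finally show ?thesis .
  qed
  have pow: "\<theta> (C ^\<^sub>m k *\<^sub>v v) \<equiv>\<^sub>P \<zeta> ^ k * \<theta> v" if v: "v \<in> carrier_vec n" for v k
    using v
  proof (induction k arbitrary: v)
    case 0 then show ?case using C by simp
  next
    case (Suc k)
    have "\<theta> (C ^\<^sub>m Suc k *\<^sub>v v) = \<theta> (C ^\<^sub>m k *\<^sub>v (C *\<^sub>v v))"
      using C Suc.prems by (simp add: assoc_mult_mat_vec[of _ n n _ n])
    also have "\<dots> \<equiv>\<^sub>P \<zeta> ^ k * \<theta> (C *\<^sub>v v)" using C Suc.prems by (intro Suc.IH) auto
    also have "\<dots> \<equiv>\<^sub>P \<zeta> ^ k * (\<zeta> * \<theta> v)" using mult[OF Suc.prems] by (intro eqv_mult_left R_zeta_pow)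
    finally show ?case by (simp add: mult_ac)
  qed
  have e0: "\<theta> (unit_vec n 0) = 1"
  proof -
    have "\<theta> (unit_vec n 0) = (\<Sum>i<n. if i = 0 then 1 else 0)"
      unfolding \<theta>_def by (intro sum.cong) (auto simp: unit_vec_def)
    then show ?thesis using n by simp
  qed
  have pow0: "\<theta> (C ^\<^sub>m k *\<^sub>v unit_vec n 0) \<equiv>\<^sub>P \<zeta> ^ k" for k using pow[of "unit_vec n 0" k] e0 by simp
  have car: "C ^\<^sub>m k *\<^sub>v unit_vec n 0 \<in> carrier_vec n" for k
    using mult_mat_vec_carrier[OF pow_carrier_mat[OF C]] by simp
  have S0: "cong_mat n (int p) (C ^\<^sub>m N) (1\<^sub>m n)"
    unfolding cong_mat_def
  proof (intro allI impI)
    fix i j assume ij: "i < n" "j < n"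
    have "\<theta> (C ^\<^sub>m N *\<^sub>v unit_vec n j) \<equiv>\<^sub>P \<theta> (unit_vec n j)"
      using pow[of "unit_vec n j" N] by (simp add: zeta_pow_N)
    then have "[(C ^\<^sub>m N *\<^sub>v unit_vec n j) $ i = unit_vec n j $ i] (mod int p)"
      using theta_eqv[OF mult_mat_vec_carrier[OF pow_carrier_mat[OF C] unit_vec_carrier] unit_vec_carrier] ij(1)
      by blast
    moreover have "(C ^\<^sub>m N *\<^sub>v unit_vec n j) $ i = (C ^\<^sub>m N) $$ (i, j)"
      using C ij by (simp add: carrier_matD[OF pow_carrier_mat[OF C]])
    ultimately show "[(C ^\<^sub>m N) $$ (i, j) = 1\<^sub>m n $$ (i, j)] (mod int p)" using ij by simp
  qed
  have S1: "\<exists>k<N. \<forall>i<n. [v $ i = (C ^\<^sub>m k *\<^sub>v unit_vec n 0) $ i] (mod int p)"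
    if v: "v \<in> carrier_vec n" "\<exists>i<n. \<not> int p dvd v $ i" for v
  proof -
    have "\<theta> v \<notin> P" using v theta_in_P by blast
    then obtain k where k: "k < N" "\<theta> v \<equiv>\<^sub>P \<zeta> ^ k" using eqv_zeta_pow[OF theta_R] by blast
    then have "\<theta> v \<equiv>\<^sub>P \<theta> (C ^\<^sub>m k *\<^sub>v unit_vec n 0)" using pow0 eqv_sym eqv_trans by blast
    then show ?thesis using theta_eqv[OF v(1) car] k by blast
  qed
  have S2: "\<exists>i<n. \<not> int p dvd (C ^\<^sub>m k *\<^sub>v unit_vec n 0) $ i" for k
  proof -
    have "\<theta> (C ^\<^sub>m k *\<^sub>v unit_vec n 0) \<notin> P"
      using pow0[of k] zeta_pow_unit by (metis eqv_0_iff eqv_sym eqv_trans)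
    then show ?thesis using theta_in_P by blast
  qed
  have S3: "j mod N = k mod N"
    if "\<forall>i<n. [(C ^\<^sub>m j *\<^sub>v unit_vec n 0) $ i = (C ^\<^sub>m k *\<^sub>v unit_vec n 0) $ i] (mod int p)" for j k
  proof -
    have "\<theta> (C ^\<^sub>m j *\<^sub>v unit_vec n 0) \<equiv>\<^sub>P \<theta> (C ^\<^sub>m k *\<^sub>v unit_vec n 0)" using that theta_eqv[OF car car] by blast
    then have "\<zeta> ^ j \<equiv>\<^sub>P \<zeta> ^ k" using pow0 eqv_sym eqv_trans by blast
    then show ?thesis by (simp only: zeta_pow_eqv_iff)
  qed
  have S4: "card {k. k < N \<and> (\<forall>i<n. int p dvd (\<Sum>l\<le>n. g l * (C ^\<^sub>m (k * l) *\<^sub>v unit_vec n 0) $ i))} \<le> n"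
    (is "card ?K \<le> n") if g: "\<exists>l\<le>n. \<not> int p dvd g l" for g :: "nat \<Rightarrow> int"
  proof (rule ccontr)
    assume big: "\<not> card ?K \<le> n"
    define h :: "complex poly" where "h = (\<Sum>l\<le>n. Polynomial.monom (of_int (g l)) l)"
    have coeff: "poly.coeff h l = (if l \<le> n then of_int (g l) else 0)" for l
      by (simp add: h_def coeff_sum if_distrib sum.delta cong: if_cong)
    have "degree h \<le> n" by (rule degree_le) (simp add: coeff)
    have inj: "inj_on (\<lambda>k. \<zeta> ^ k) {..<N}"
      using zeta_pow_eqv_iff by (intro inj_onI) (metis eqv_refl lessThan_iff mod_less)
    have "?K \<subseteq> {..<N}" by auto
    then have card: "card ((\<lambda>k. \<zeta> ^ k) ` ?K) = card ?K" using inj by (intro card_image) (rule inj_on_subset)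
    have "poly.coeff h l \<in> P" for l
    proof (rule roots_mod_P[of "(\<lambda>k. \<zeta> ^ k) ` ?K"])
      show "poly.coeff h i \<in> R" for i by (simp add: coeff R_of_int R_0)
      show "(\<lambda>k. \<zeta> ^ k) ` ?K \<subseteq> R" using R_zeta_pow by blast
      show "\<not> z \<equiv>\<^sub>P w" if "z \<in> (\<lambda>k. \<zeta> ^ k) ` ?K" "w \<in> (\<lambda>k. \<zeta> ^ k) ` ?K" "z \<noteq> w" for z w
        using that by (auto simp: zeta_pow_eqv_iff)
      show "degree h < card ((\<lambda>k. \<zeta> ^ k) ` ?K)" using \<open>degree h \<le> n\<close> big card by linarith
      fix z assume "z \<in> (\<lambda>k. \<zeta> ^ k) ` ?K"
      then obtain k where k: "k \<in> ?K" "z = \<zeta> ^ k" by blast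
      define w where "w = vec n (\<lambda>i. \<Sum>l\<le>n. g l * (C ^\<^sub>m (k * l) *\<^sub>v unit_vec n 0) $ i)"
      have "\<theta> w \<in> P" using k by (simp add: theta_in_P w_def)
      moreover have "\<theta> w = (\<Sum>l\<le>n. of_int (g l) * \<theta> (C ^\<^sub>m (k * l) *\<^sub>v unit_vec n 0))"
      proof -
        have "\<theta> w = (\<Sum>i<n. \<Sum>l\<le>n. of_int (g l) * (of_int ((C ^\<^sub>m (k * l) *\<^sub>v unit_vec n 0) $ i) * \<zeta> ^ i))"
          unfolding \<theta>_def w_def by (intro sum.cong refl) (simp add: sum_distrib_right mult.assoc)
        also have "\<dots> = (\<Sum>l\<le>n. \<Sum>i<n. of_int (g l) * (of_int ((C ^\<^sub>m (k * l) *\<^sub>v unit_vec n 0) $ i) * \<zeta> ^ i))"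
          by (rule sum.swap)
        finally show ?thesis by (simp add: \<theta>_def sum_distrib_left)
      qed
      moreover have "(\<Sum>l\<le>n. of_int (g l) * \<theta> (C ^\<^sub>m (k * l) *\<^sub>v unit_vec n 0)) \<equiv>\<^sub>P (\<Sum>l\<le>n. of_int (g l) * \<zeta> ^ (k * l))"
        by (intro eqv_sum eqv_mult_left R_of_int pow0)
      moreover have "poly h z = (\<Sum>l\<le>n. of_int (g l) * \<zeta> ^ (k * l))"
        by (simp add: h_def poly_sum poly_monom k power_mult)
      ultimately show "poly h z \<in> P" by (metis eqv_0_iff eqv_sym eqv_trans)
    qed simp
    then have "int p dvd g l" if "l \<le> n" for l using coeff[of l] that of_int_in_P by metis
    then show False using g by blast
  qed
  show ?thesis
  proof (intro exI[of _ C] singer_matrix.intro)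
    show "\<exists>k<N. cong_vec n (int p) v (C ^\<^sub>m k *\<^sub>v unit_vec n 0)"
      if "v \<in> carrier_vec n" "\<exists>i<n. \<not> int p dvd v $ i" for v
      using S1[OF that] by (simp add: cong_vec_def)
    show "\<exists>i<n. \<not> int p dvd (C ^\<^sub>m k *\<^sub>v unit_vec n 0) $ i" for k by (rule S2)
    show "j mod N = k mod N"
      if "cong_vec n (int p) (C ^\<^sub>m j *\<^sub>v unit_vec n 0) (C ^\<^sub>m k *\<^sub>v unit_vec n 0)" for j k
      using S3 that unfolding cong_vec_def by blast
    show "card {k. k < N \<and> (\<forall>i<n. int p dvd (\<Sum>l\<le>n. g l * (C ^\<^sub>m (k * l) *\<^sub>v unit_vec n 0) $ i))} \<le> n"
      if "\<exists>l\<le>n. \<not> int p dvd g l" for g :: "nat \<Rightarrow> int"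
      using that by (rule S4)
  qed (rule p n p_pow C S0)+
qed

end

section \<open>General linear groups modulo an integer\<close>

definition reduce_mat :: "nat \<Rightarrow> int \<Rightarrow> int mat \<Rightarrow> int mat" where
  "reduce_mat n m A = mat n n (\<lambda>(i, j). A $$ (i, j) mod m)"

lemma reduce_mat_carrier [simp]: "reduce_mat n m A \<in> carrier_mat n n"
  by (simp add: reduce_mat_def)

lemma reduce_mat_cong: "cong_mat n m (reduce_mat n m A) A"
  by (simp add: reduce_mat_def cong_mat_def cong_def)

lemma reduce_mat_eq_iff: "reduce_mat n m A = reduce_mat n m B \<longleftrightarrow> cong_mat n m A B"
proof
  show "reduce_mat n m A = reduce_mat n m B \<Longrightarrow> cong_mat n m A B"
    by (metis reduce_mat_cong cong_mat_sym cong_mat_trans)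
  show "cong_mat n m A B \<Longrightarrow> reduce_mat n m A = reduce_mat n m B"
    by (rule eq_matI) (auto simp: reduce_mat_def cong_mat_def cong_def)
qed

definition inverse_mod :: "nat \<Rightarrow> int \<Rightarrow> int mat \<Rightarrow> int mat \<Rightarrow> bool" where
  "inverse_mod n m A B \<longleftrightarrow> B \<in> carrier_mat n n \<and> cong_mat n m (A * B) (1\<^sub>m n) \<and> cong_mat n m (B * A) (1\<^sub>m n)"

text \<open>Matrices are represented by their entries in \<open>{0..<m}\<close>, which makes the group finite.\<close>

definition GL_mod :: "nat \<Rightarrow> int \<Rightarrow> int mat monoid" where
  "GL_mod n m = \<lparr>carrier = {A \<in> carrier_mat n n. reduce_mat n m A = A \<and> (\<exists>B. inverse_mod n m A B)},
     monoid.mult = (\<lambda>A B. reduce_mat n m (A * B)), one = reduce_mat n m (1\<^sub>m n)\<rparr>"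

lemma GL_mod_carrier: "A \<in> carrier (GL_mod n m) \<longleftrightarrow>
    A \<in> carrier_mat n n \<and> reduce_mat n m A = A \<and> (\<exists>B. inverse_mod n m A B)"
  by (simp add: GL_mod_def)

lemma GL_mod_mult [simp]: "A \<otimes>\<^bsub>GL_mod n m\<^esub> B = reduce_mat n m (A * B)"
  by (simp add: GL_mod_def)

lemma GL_mod_one [simp]: "\<one>\<^bsub>GL_mod n m\<^esub> = reduce_mat n m (1\<^sub>m n)"
  by (simp add: GL_mod_def)

lemma reduce_mat_reduce [simp]: "reduce_mat n m (reduce_mat n m A) = reduce_mat n m A"
  using reduce_mat_cong by (simp add: reduce_mat_eq_iff)

lemma cong_mat_mult_one:
  assumes "A \<in> carrier_mat n n" "B \<in> carrier_mat n n" "cong_mat n m B (1\<^sub>m n)"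
  shows "cong_mat n m (A * B) A" "cong_mat n m (B * A) A"
  using cong_mat_mult[OF assms(1,1,2) one_carrier_mat cong_mat_refl assms(3)]
    cong_mat_mult[OF assms(2) one_carrier_mat assms(1,1) assms(3) cong_mat_refl] assms(1) by auto

lemma reduce_mat_in_GL:
  assumes A: "A \<in> carrier_mat n n" and B: "inverse_mod n m A B"
  shows "reduce_mat n m A \<in> carrier (GL_mod n m)"
proof -
  have Bc: "B \<in> carrier_mat n n" using B by (simp add: inverse_mod_def)
  have "inverse_mod n m (reduce_mat n m A) B"
    unfolding inverse_mod_def
  proof (intro conjI)
    show "cong_mat n m (reduce_mat n m A * B) (1\<^sub>m n)"
      using cong_mat_trans[OF cong_mat_mult[OF reduce_mat_carrier A Bc Bc reduce_mat_cong cong_mat_refl]] B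
      by (simp add: inverse_mod_def)
    show "cong_mat n m (B * reduce_mat n m A) (1\<^sub>m n)"
      using cong_mat_trans[OF cong_mat_mult[OF Bc Bc reduce_mat_carrier A cong_mat_refl reduce_mat_cong]] B
      by (simp add: inverse_mod_def)
  qed (rule Bc)
  then show ?thesis by (auto simp: GL_mod_carrier)
qed

lemma inverse_mod_sym: "A \<in> carrier_mat n n \<Longrightarrow> inverse_mod n m A B \<Longrightarrow> inverse_mod n m B A"
  by (simp add: inverse_mod_def)

lemma inverse_mod_mult:
  assumes A: "A \<in> carrier_mat n n" and A': "A' \<in> carrier_mat n n"
    and B: "inverse_mod n m A B" and B': "inverse_mod n m A' B'"
  shows "inverse_mod n m (A * A') (B' * B)"
proof -
  have c: "B \<in> carrier_mat n n" "B' \<in> carrier_mat n n" using B B' by (auto simp: inverse_mod_def)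
  have *: "cong_mat n m (A * A' * (B' * B)) (1\<^sub>m n)"
    if "A \<in> carrier_mat n n" "A' \<in> carrier_mat n n" "B \<in> carrier_mat n n" "B' \<in> carrier_mat n n"
      "cong_mat n m (A * B) (1\<^sub>m n)" "cong_mat n m (A' * B') (1\<^sub>m n)" for A A' B B'
  proof -
    have "A * A' * (B' * B) = A * (A' * B') * B"
      using that by (simp add: assoc_mult_mat[of _ n n _ n _ n])
    also have "cong_mat n m (A * (A' * B') * B) (A * B)"
      using cong_mat_mult_one(1)[OF that(1) mult_carrier_mat[OF that(2,4)] that(6)] that
      by (intro cong_mat_mult) auto
    finally show ?thesis using that(5) cong_mat_trans by blast
  qed
  show ?thesis unfolding inverse_mod_def
    using *[OF A A' c] *[OF c(2,1) A' A] B B' c by (auto simp: inverse_mod_def)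
qed

lemma GL_mod_mult_eq:
  assumes "A \<in> carrier_mat n n" "B \<in> carrier_mat n n"
  shows "reduce_mat n m (reduce_mat n m A * reduce_mat n m B) = reduce_mat n m (A * B)"
  using assms by (simp add: reduce_mat_eq_iff cong_mat_mult reduce_mat_cong)

theorem group_GL_mod: "group (GL_mod n m)"
proof (rule groupI)
  fix A B assume A: "A \<in> carrier (GL_mod n m)" and B: "B \<in> carrier (GL_mod n m)"
  obtain A' B' where inv: "inverse_mod n m A A'" "inverse_mod n m B B'"
    using A B unfolding GL_mod_carrier by blast
  have c: "A \<in> carrier_mat n n" "B \<in> carrier_mat n n" using A B by (auto simp: GL_mod_carrier)
  show "A \<otimes>\<^bsub>GL_mod n m\<^esub> B \<in> carrier (GL_mod n m)"
    unfolding GL_mod_mult using inverse_mod_mult[OF c inv] c by (intro reduce_mat_in_GL) auto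
  fix C assume C: "C \<in> carrier (GL_mod n m)"
  then have "C \<in> carrier_mat n n" by (simp add: GL_mod_carrier)
  then show "A \<otimes>\<^bsub>GL_mod n m\<^esub> B \<otimes>\<^bsub>GL_mod n m\<^esub> C = A \<otimes>\<^bsub>GL_mod n m\<^esub> (B \<otimes>\<^bsub>GL_mod n m\<^esub> C)"
    using GL_mod_mult_eq[of "A * B" n C m] GL_mod_mult_eq[of A n "B * C" m] A B C c
    by (simp add: GL_mod_carrier)
next
  show "\<one>\<^bsub>GL_mod n m\<^esub> \<in> carrier (GL_mod n m)"
    unfolding GL_mod_one by (rule reduce_mat_in_GL[of _ _ _ "1\<^sub>m n"]) (auto simp: inverse_mod_def)
next
  fix A assume A: "A \<in> carrier (GL_mod n m)"
  then have c: "A \<in> carrier_mat n n" "reduce_mat n m A = A" by (auto simp: GL_mod_carrier)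
  then show "\<one>\<^bsub>GL_mod n m\<^esub> \<otimes>\<^bsub>GL_mod n m\<^esub> A = A"
    using GL_mod_mult_eq[of "1\<^sub>m n" n A m] by simp
  obtain B where B: "inverse_mod n m A B" using A unfolding GL_mod_carrier by blast
  then have Bc: "B \<in> carrier_mat n n" by (simp add: inverse_mod_def)
  have "reduce_mat n m B \<in> carrier (GL_mod n m)"
    using inverse_mod_sym[OF c(1) B] by (rule reduce_mat_in_GL[OF Bc])
  moreover have "reduce_mat n m B \<otimes>\<^bsub>GL_mod n m\<^esub> A = \<one>\<^bsub>GL_mod n m\<^esub>"
  proof -
    have "reduce_mat n m (reduce_mat n m B * A) = reduce_mat n m (B * A)"
      using GL_mod_mult_eq[OF Bc c(1), of m] c(2) by simp
    also have "\<dots> = reduce_mat n m (1\<^sub>m n)" using B by (simp add: reduce_mat_eq_iff inverse_mod_def)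
    finally show ?thesis by simp
  qed
  ultimately show "\<exists>B\<in>carrier (GL_mod n m). B \<otimes>\<^bsub>GL_mod n m\<^esub> A = \<one>\<^bsub>GL_mod n m\<^esub>" by blast
qed

lemma finite_GL_mod:
  assumes "m > 0" shows "finite (carrier (GL_mod n m))"
proof (rule finite_subset)
  let ?S = "({0..<n} \<times> {0..<n}) \<rightarrow>\<^sub>E {0..<m}"
  show "carrier (GL_mod n m) \<subseteq> (\<lambda>f. mat n n f) ` ?S"
  proof
    fix A assume "A \<in> carrier (GL_mod n m)"
    then have A: "A \<in> carrier_mat n n" "reduce_mat n m A = A" by (auto simp: GL_mod_carrier)
    define f where "f = restrict (\<lambda>ij. A $$ ij mod m) ({0..<n} \<times> {0..<n})"
    have "mat n n f = reduce_mat n m A" by (rule eq_matI) (auto simp: reduce_mat_def f_def)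
    then have "A = mat n n f" using A(2) by simp
    moreover have "f \<in> ?S" using assms by (auto simp: f_def)
    ultimately show "A \<in> (\<lambda>f. mat n n f) ` ?S" by blast
  qed
  show "finite ((\<lambda>f. mat n n f) ` ?S)" by (intro finite_imageI finite_PiE) auto
qed

lemma GL_mod_pow:
  assumes "A \<in> carrier_mat n n"
  shows "reduce_mat n m A [^]\<^bsub>GL_mod n m\<^esub> (k::nat) = reduce_mat n m (A ^\<^sub>m k)"
proof (induction k)
  case 0 show ?case using carrier_matD[OF assms] by (simp add: nat_pow_def)
next
  case (Suc k)
  then show ?case using GL_mod_mult_eq[OF pow_carrier_mat[OF assms] assms, of m k] by (simp add: nat_pow_def)
qed

text \<open>Take the order of the group.\<close>

lemma ex_exponent_GL_mod:
  assumes "m > 0"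
  shows "\<exists>e>0. \<forall>A\<in>carrier_mat n n. (\<exists>B. inverse_mod n m A B) \<longrightarrow> cong_mat n m (A ^\<^sub>m e) (1\<^sub>m n)"
proof (intro exI[of _ "order (GL_mod n m)"] conjI ballI impI)
  interpret group "GL_mod n m" by (rule group_GL_mod)
  show "order (GL_mod n m) > 0"
    using finite_GL_mod[OF assms] one_closed unfolding Coset.order_def by (simp add: card_gt_0_iff) blast
  fix A assume A: "A \<in> carrier_mat n n" "\<exists>B. inverse_mod n m A B"
  have "reduce_mat n m A \<in> carrier (GL_mod n m)" using A reduce_mat_in_GL by blast
  from pow_order_eq_1[OF this] show "cong_mat n m (A ^\<^sub>m order (GL_mod n m)) (1\<^sub>m n)"
    using GL_mod_pow[OF A(1)] by (simp add: reduce_mat_eq_iff)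
qed

section \<open>Singer cycles\<close>

lemma cong_vec_refl [simp]: "cong_vec n m v v" by (simp add: cong_vec_def)
lemma cong_vec_sym: "cong_vec n m v w \<Longrightarrow> cong_vec n m w v" by (simp add: cong_vec_def cong_sym)
lemma cong_vec_trans [trans]: "cong_vec n m u v \<Longrightarrow> cong_vec n m v w \<Longrightarrow> cong_vec n m u w"
  by (simp add: cong_vec_def) (meson cong_trans)

lemma cong_mat_mult_vec:
  assumes "A \<in> carrier_mat n n" "B \<in> carrier_mat n n" "v \<in> carrier_vec n" "w \<in> carrier_vec n"
    "cong_mat n m A B" "cong_vec n m v w"
  shows "cong_vec n m (A *\<^sub>v v) (B *\<^sub>v w)"
  using assms unfolding cong_vec_def cong_mat_def
  by (auto simp: scalar_prod_def intro!: cong_sum cong_mult)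

lemma cong_vec_add:
  "u \<in> carrier_vec n \<Longrightarrow> u' \<in> carrier_vec n \<Longrightarrow> v \<in> carrier_vec n \<Longrightarrow> v' \<in> carrier_vec n \<Longrightarrow>
   cong_vec n m u u' \<Longrightarrow> cong_vec n m v v' \<Longrightarrow> cong_vec n m (u + v) (u' + v')"
  by (auto simp: cong_vec_def intro: cong_add)

lemma cong_mat_if_cong_vec:
  assumes "A \<in> carrier_mat n n" "B \<in> carrier_mat n n"
    and "\<And>v. v \<in> carrier_vec n \<Longrightarrow> cong_vec n m (A *\<^sub>v v) (B *\<^sub>v v)"
  shows "cong_mat n m A B"
  unfolding cong_mat_def
proof (intro allI impI)
  fix i j assume ij: "i < n" "j < n"
  have "[(A *\<^sub>v unit_vec n j) $ i = (B *\<^sub>v unit_vec n j) $ i] (mod m)"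
    using assms(3)[of "unit_vec n j"] ij by (simp add: cong_vec_def)
  then show "[A $$ (i, j) = B $$ (i, j)] (mod m)" using assms ij by simp
qed

lemma smult_mat_vec:
  fixes A :: "int mat"
  assumes "A \<in> carrier_mat n n" "v \<in> carrier_vec n"
  shows "A *\<^sub>v (a \<cdot>\<^sub>v v) = a \<cdot>\<^sub>v (A *\<^sub>v v)"
  using assms by (intro eq_vecI) (auto simp: scalar_prod_smult_distrib[of _ n])

text \<open>The preimages in \<open>\<int>\<^sup>n\<close> of the subgroups of \<open>(\<int>/p)\<^sup>n\<close>.\<close>

definition mod_subgroup :: "nat \<Rightarrow> int \<Rightarrow> int vec set \<Rightarrow> bool" where
  "mod_subgroup n p W \<longleftrightarrow> W \<subseteq> carrier_vec n \<and> (\<forall>v\<in>W. \<forall>w\<in>W. v + w \<in> W) \<and>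
     (\<forall>v\<in>carrier_vec n. p \<cdot>\<^sub>v v \<in> W)"

lemma mod_subgroup_cong:
  assumes W: "mod_subgroup n p W" and v: "v \<in> W" and w: "w \<in> carrier_vec n" and c: "cong_vec n p v w"
  shows "w \<in> W"
proof -
  have vc: "v \<in> carrier_vec n" using W v by (auto simp: mod_subgroup_def)
  define u where "u = vec n (\<lambda>i. (w $ i - v $ i) div p)"
  have "w = v + p \<cdot>\<^sub>v u"
  proof (rule eq_vecI)
    fix i assume "i < dim_vec (v + p \<cdot>\<^sub>v u)"
    then have i: "i < n" by (simp add: u_def)
    have "p dvd w $ i - v $ i" using c i by (simp add: cong_vec_def cong_iff_dvd_diff dvd_diff_commute)
    then show "w $ i = (v + p \<cdot>\<^sub>v u) $ i" using i vc by (simp add: u_def)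
  qed (use vc w in \<open>simp add: u_def\<close>)
  moreover have "p \<cdot>\<^sub>v u \<in> W" using W by (simp add: mod_subgroup_def u_def)
  ultimately show ?thesis using W v by (simp add: mod_subgroup_def)
qed

lemma mod_subgroup_kernel:
  assumes A: "A \<in> carrier_mat n n" and B: "B \<in> carrier_mat n n"
  shows "mod_subgroup n p {v \<in> carrier_vec n. cong_vec n p (A *\<^sub>v v) (B *\<^sub>v v)}"
  unfolding mod_subgroup_def
proof (intro conjI ballI)
  fix v w assume "v \<in> {v \<in> carrier_vec n. cong_vec n p (A *\<^sub>v v) (B *\<^sub>v v)}"
    "w \<in> {v \<in> carrier_vec n. cong_vec n p (A *\<^sub>v v) (B *\<^sub>v v)}"
  then show "v + w \<in> {v \<in> carrier_vec n. cong_vec n p (A *\<^sub>v v) (B *\<^sub>v v)}"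
    using A B by (auto simp: mult_add_distrib_mat_vec[of _ n n] intro!: cong_vec_add)
next
  fix v :: "int vec" assume v: "v \<in> carrier_vec n"
  then have "cong_vec n p (A *\<^sub>v (p \<cdot>\<^sub>v v)) (B *\<^sub>v (p \<cdot>\<^sub>v v))"
    using A B unfolding smult_mat_vec[OF A v] smult_mat_vec[OF B v]
    by (auto simp: cong_vec_def cong_iff_dvd_diff)
  then show "p \<cdot>\<^sub>v v \<in> {v \<in> carrier_vec n. cong_vec n p (A *\<^sub>v v) (B *\<^sub>v v)}" using v by simp
qed auto

lemma mod_subgroup_preimage:
  assumes W: "mod_subgroup n p W" and x: "x \<in> carrier_mat n n"
  shows "mod_subgroup n p {v \<in> carrier_vec n. x *\<^sub>v v \<in> W}"
  unfolding mod_subgroup_def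
proof (intro conjI ballI)
  fix v w assume "v \<in> {v \<in> carrier_vec n. x *\<^sub>v v \<in> W}" "w \<in> {v \<in> carrier_vec n. x *\<^sub>v v \<in> W}"
  then show "v + w \<in> {v \<in> carrier_vec n. x *\<^sub>v v \<in> W}"
    using x W by (auto simp: mult_add_distrib_mat_vec[of _ n n] mod_subgroup_def)
next
  fix v :: "int vec" assume "v \<in> carrier_vec n"
  then show "p \<cdot>\<^sub>v v \<in> {v \<in> carrier_vec n. x *\<^sub>v v \<in> W}"
    using x W by (auto simp: smult_mat_vec mod_subgroup_def)
qed auto

context singer_matrix begin

definition pt :: "nat \<Rightarrow> int vec" where "pt k = C ^\<^sub>m k *\<^sub>v unit_vec n 0"

lemma pt_carrier [simp]: "pt k \<in> carrier_vec n"
  unfolding pt_def using mult_mat_vec_carrier[OF pow_carrier_mat[OF C]] by simp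

lemma N_pos: "N > 0"
proof -
  have "p ^ n > 1" using p n prime_gt_1_nat one_less_power by blast
  then show ?thesis using N by simp
qed

lemma C_pow_carrier [simp]: "C ^\<^sub>m k \<in> carrier_mat n n"
  using C by (rule pow_carrier_mat)

lemma C_pt: "C ^\<^sub>m j *\<^sub>v pt k = pt (j + k)"
  unfolding pt_def pow_mat_add[OF C] by (rule assoc_mult_mat_vec[symmetric, of _ n n _ n]) auto

lemma C_pow_mod: "cong_mat n (int p) (C ^\<^sub>m (k mod N)) (C ^\<^sub>m k)"
proof -
  have "cong_mat n (int p) ((C ^\<^sub>m N) ^\<^sub>m (k div N)) (1\<^sub>m n)"
    using cong_mat_pow[OF C_pow_carrier one_carrier_mat C_N, of "k div N"] by (simp add: pow_mat_one)
  then have "cong_mat n (int p) (C ^\<^sub>m (N * (k div N))) (1\<^sub>m n)" by (simp only: pow_mat_mult[OF C])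
  then have "cong_mat n (int p) (C ^\<^sub>m (N * (k div N)) * C ^\<^sub>m (k mod N)) (C ^\<^sub>m (k mod N))"
    by (intro cong_mat_mult_one(2)) auto
  moreover have "C ^\<^sub>m (N * (k div N)) * C ^\<^sub>m (k mod N) = C ^\<^sub>m k"
    unfolding pow_mat_add[OF C, symmetric] by simp
  ultimately show ?thesis by (simp add: cong_mat_sym)
qed

lemma pt_mod: "cong_vec n (int p) (pt (k mod N)) (pt k)"
  unfolding pt_def by (intro cong_mat_mult_vec C_pow_mod) auto

text \<open>A subspace of dimension \<open>w\<close> has \<open>p ^ w - 1\<close> nonzero vectors, and each of them is \<open>pt k\<close> for
  exactly one \<open>k < N\<close>.\<close>

lemma card_exponents:
  assumes W: "mod_subgroup n (int p) W"
  shows "\<exists>w\<le>n. card {k. k < N \<and> pt k \<in> W} = p ^ w - 1"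
proof -
  have p0: "p > 0" using p prime_gt_0_nat by blast
  define V where "V = product_group {..<n} (\<lambda>_. integer_mod_group p)"
  interpret V: group V unfolding V_def by (rule product_group) simp
  have V_carrier: "carrier V = ({..<n} \<rightarrow>\<^sub>E {0..<int p})"
    using p0 by (simp add: V_def carrier_integer_mod_group)
  define H where "H = {f \<in> carrier V. vec n f \<in> W}"
  have zero: "0\<^sub>v n \<in> W"
  proof -
    have "int p \<cdot>\<^sub>v (0\<^sub>v n) \<in> W" using W by (simp add: mod_subgroup_def)
    moreover have "int p \<cdot>\<^sub>v (0\<^sub>v n) = 0\<^sub>v n" by (rule eq_vecI) auto
    ultimately show ?thesis by simp
  qed
  have one_V: "\<one>\<^bsub>V\<^esub> = (\<lambda>i\<in>{..<n}. 0)" by (simp add: V_def)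
  have H_mult: "f \<otimes>\<^bsub>V\<^esub> g \<in> H" if fg: "f \<in> H" "g \<in> H" for f g
  proof -
    have "cong_vec n (int p) (vec n f + vec n g) (vec n (f \<otimes>\<^bsub>V\<^esub> g))"
      by (auto simp: cong_vec_def V_def cong_def)
    moreover have "vec n f + vec n g \<in> W" using fg W by (simp add: H_def mod_subgroup_def)
    ultimately have "vec n (f \<otimes>\<^bsub>V\<^esub> g) \<in> W" using mod_subgroup_cong[OF W] by simp
    then show ?thesis using fg by (simp add: H_def)
  qed
  have H_one: "\<one>\<^bsub>V\<^esub> \<in> H"
  proof -
    have "vec n \<one>\<^bsub>V\<^esub> = 0\<^sub>v n" by (auto simp: one_V)
    then show ?thesis using zero by (simp add: H_def)
  qed
  have finV: "finite (carrier V)" unfolding V_carrier by (intro finite_PiE) auto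
  have "subgroup H V"
  proof (rule subgroup.intro)
    fix f assume f: "f \<in> H"
    then have fV: "f \<in> carrier V" by (simp add: H_def)
    \<comment> \<open>In a finite group the inverse is a power.\<close>
    have "f [^]\<^bsub>V\<^esub> (order V - 1) \<otimes>\<^bsub>V\<^esub> f = f [^]\<^bsub>V\<^esub> (Suc (order V - 1))" by simp
    also have "Suc (order V - 1) = order V"
      using V.order_gt_0_iff_finite finV by simp
    finally have "inv\<^bsub>V\<^esub> f = f [^]\<^bsub>V\<^esub> (order V - 1)"
      using fV V.pow_order_eq_1[OF fV] by (intro V.inv_equality) auto
    moreover have "f [^]\<^bsub>V\<^esub> (k::nat) \<in> H" for k
      by (induction k) (use f H_one H_mult in auto)
    ultimately show "inv\<^bsub>V\<^esub> f \<in> H" by simp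
  qed (use H_mult H_one in \<open>auto simp: H_def\<close>)
  then have "card (rcosets\<^bsub>V\<^esub> H) * card H = order V" by (rule V.lagrange)
  moreover have "order V = p ^ n" unfolding Coset.order_def V_carrier by (simp add: card_PiE)
  ultimately have "card H dvd p ^ n" by (metis dvd_triv_right)
  then obtain w where w: "w \<le> n" "card H = p ^ w" using divides_primepow_nat[OF p] by blast
  define Q where "Q = {k. k < N \<and> pt k \<in> W}"
  define g where "g k = (\<lambda>i\<in>{..<n}. pt k $ i mod int p)" for k
  have g_V: "g k \<in> carrier V" for k using p0 by (auto simp: V_carrier g_def)
  have g_cong: "cong_vec n (int p) (pt k) (vec n (g k))" for k by (auto simp: cong_vec_def g_def cong_def)
  have "inj_on g Q"
  proof (rule inj_onI)
    fix j k assume jk: "j \<in> Q" "k \<in> Q" "g j = g k"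
    have "cong_vec n (int p) (pt j) (pt k)"
      using g_cong[of j] g_cong[of k] jk(3) by (metis cong_vec_sym cong_vec_trans)
    then have "j mod N = k mod N" using inj by (simp add: pt_def)
    then show "j = k" using jk by (simp add: Q_def)
  qed
  moreover have "g ` Q = H - {\<one>\<^bsub>V\<^esub>}"
  proof
    show "g ` Q \<subseteq> H - {\<one>\<^bsub>V\<^esub>}"
    proof
      fix f assume "f \<in> g ` Q"
      then obtain k where k: "k \<in> Q" "f = g k" by blast
      have "vec n (g k) \<in> W" using mod_subgroup_cong[OF W _ _ g_cong, of k] k by (simp add: Q_def)
      moreover have "g k \<noteq> \<one>\<^bsub>V\<^esub>"
      proof
        assume g1: "g k = \<one>\<^bsub>V\<^esub>"
        have "int p dvd pt k $ i" if "i < n" for i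
          using that fun_cong[OF g1, of i] by (simp add: one_V g_def dvd_eq_mod_eq_0)
        then show False using nonzero[of k] by (auto simp: pt_def)
      qed
      ultimately show "f \<in> H - {\<one>\<^bsub>V\<^esub>}" using g_V k by (simp add: H_def)
    qed
    show "H - {\<one>\<^bsub>V\<^esub>} \<subseteq> g ` Q"
    proof
      fix f assume f: "f \<in> H - {\<one>\<^bsub>V\<^esub>}"
      then have fV: "f \<in> ({..<n} \<rightarrow>\<^sub>E {0..<int p})" by (simp add: H_def V_carrier)
      have "\<exists>i<n. \<not> int p dvd vec n f $ i"
      proof (rule ccontr)
        assume neg: "\<not> ?thesis"
        have "f i = 0" if "i < n" for i
        proof -
          have "f i \<in> {0..<int p}" using PiE_mem[OF fV] that by simp
          moreover have "int p dvd f i" using neg that by simp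
          ultimately show ?thesis using zdvd_not_zless[of "f i" "int p"] by (cases "f i = 0") auto
        qed
        then have "f = \<one>\<^bsub>V\<^esub>" using fV unfolding one_V by (intro PiE_ext[of f "{..<n}" "\<lambda>_. {0..<int p}"]) (use p0 in auto)
        then show False using f by simp
      qed
      then obtain k where k: "k < N" "cong_vec n (int p) (vec n f) (pt k)"
        using orbit[of "vec n f"] by (auto simp: pt_def)
      have "pt k \<in> W" using mod_subgroup_cong[OF W _ _ k(2)] f by (simp add: H_def)
      moreover have "f = g k"
      proof (rule PiE_ext[OF fV])
        show "g k \<in> ({..<n} \<rightarrow>\<^sub>E {0..<int p})" using g_V by (simp add: V_carrier)
        fix i assume i: "i \<in> {..<n}"
        have "f i \<in> {0..<int p}" using PiE_mem[OF fV i] .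
        then show "f i = g k i" using k(2) i by (auto simp: cong_vec_def cong_def g_def)
      qed
      ultimately show "f \<in> g ` Q" using k by (simp add: Q_def)
    qed
  qed
  ultimately have "card Q = card (H - {\<one>\<^bsub>V\<^esub>})" using card_image by metis
  also have "\<dots> = p ^ w - 1" using H_one w by (simp add: card_Diff_singleton)
  finally show ?thesis using w(1) unfolding Q_def by blast
qed

text \<open>In the field with \<open>p ^ n\<close> elements this says that the \<open>u\<close>-th power of the generator lies in no
  subset of the form \<open>{x. x ^ (p ^ d) = x}\<close> with \<open>1 \<le> d < n\<close>, hence in no proper subfield.\<close>

definition generic :: "nat \<Rightarrow> bool" where
  "generic u \<longleftrightarrow> (\<forall>d\<in>{1..<n}. \<not> N dvd u * (p ^ d - 1))"

text \<open>The exponents of the vectors in \<open>W\<close> form a set of \<open>p ^ w - 1\<close> residues modulo \<open>N\<close> that is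
  invariant under translation by \<open>u\<close>. Comparing the sum of this set with the sum of its translate gives that
  \<open>N\<close> divides \<open>u * (p ^ w - 1)\<close>, so \<open>w\<close> is \<open>0\<close> or \<open>n\<close>.\<close>

theorem generic_irreducible:
  assumes u: "generic u" and W: "mod_subgroup n (int p) W"
    and inv: "\<And>v. v \<in> W \<Longrightarrow> C ^\<^sub>m u *\<^sub>v v \<in> W"
    and ne: "\<exists>w\<in>W. \<exists>i<n. \<not> int p dvd w $ i"
  shows "W = carrier_vec n"
proof -
  have p0: "p > 0" using p prime_gt_0_nat by blast
  define Q where "Q = {k. k < N \<and> pt k \<in> W}"
  obtain w where w: "w \<le> n" "card Q = p ^ w - 1" using card_exponents[OF W] unfolding Q_def by blast
  have Wc: "W \<subseteq> carrier_vec n" using W by (simp add: mod_subgroup_def)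
  have finQ: "finite Q" by (simp add: Q_def)
  have cl: "(k + u) mod N \<in> Q" if k: "k \<in> Q" for k
  proof -
    have "pt (u + k) \<in> W" using inv[of "pt k"] k C_pt by (simp add: Q_def)
    then have "pt ((u + k) mod N) \<in> W"
      using mod_subgroup_cong[OF W _ pt_carrier cong_vec_sym[OF pt_mod]] by blast
    then show ?thesis using N_pos by (simp add: Q_def add.commute)
  qed
  have "inj_on (\<lambda>k. (k + u) mod N) Q"
  proof (rule inj_onI)
    fix j k assume jk: "j \<in> Q" "k \<in> Q" "(j + u) mod N = (k + u) mod N"
    then have "[j = k] (mod N)" by (metis cong_add_rcancel_nat cong_def)
    then show "j = k" using jk by (simp add: Q_def cong_def)
  qed
  moreover have "(\<lambda>k. (k + u) mod N) ` Q \<subseteq> Q" using cl by blast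
  ultimately have "bij_betw (\<lambda>k. (k + u) mod N) Q Q"
    using finQ by (simp add: bij_betw_def endo_inj_surj)
  then have "(\<Sum>k\<in>Q. (k + u) mod N) = (\<Sum>k\<in>Q. k)" by (rule sum.reindex_bij_betw)
  moreover have "[(\<Sum>k\<in>Q. (k + u) mod N) = (\<Sum>k\<in>Q. k + u)] (mod N)"
    by (intro cong_sum) (simp add: cong_def)
  ultimately have "[(\<Sum>k\<in>Q. k) = (\<Sum>k\<in>Q. k) + card Q * u] (mod N)" by (simp add: sum.distrib)
  then have "[(\<Sum>k\<in>Q. k) + card Q * u = (\<Sum>k\<in>Q. k)] (mod N)" by (rule cong_sym)
  then have "[card Q * u = 0] (mod N)" by (simp only: cong_add_lcancel_0_nat)
  then have dvd: "N dvd u * (p ^ w - 1)" using w by (simp add: cong_0_iff mult.commute)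
  have "w \<noteq> 0"
  proof
    assume "w = 0"
    then have "Q = {}" using w finQ by simp
    obtain v where v: "v \<in> W" "\<exists>i<n. \<not> int p dvd v $ i" using ne by blast
    then obtain k where k: "k < N" "cong_vec n (int p) v (pt k)" using orbit[of v] Wc by (auto simp: pt_def)
    then have "k \<in> Q" using mod_subgroup_cong[OF W v(1) pt_carrier k(2)] by (simp add: Q_def)
    then show False using \<open>Q = {}\<close> by simp
  qed
  then have "w = n" using u w(1) dvd unfolding generic_def by (metis One_nat_def Suc_leI atLeastLessThan_iff le_neq_implies_less neq0_conv)
  then have "card Q = card {..<N}" using w N by simp
  moreover have "Q \<subseteq> {..<N}" by (auto simp: Q_def)
  ultimately have "Q = {..<N}" by (intro card_subset_eq) auto
  show ?thesis
  proof
    show "carrier_vec n \<subseteq> W"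
    proof
      fix v :: "int vec" assume v: "v \<in> carrier_vec n"
      show "v \<in> W"
      proof (cases "\<exists>i<n. \<not> int p dvd v $ i")
        case True
        then obtain k where k: "k < N" "cong_vec n (int p) v (pt k)" using orbit[OF v] by (auto simp: pt_def)
        then have "pt k \<in> W" using \<open>Q = {..<N}\<close> by (auto simp: Q_def)
        then show ?thesis using mod_subgroup_cong[OF W _ v cong_vec_sym[OF k(2)]] by blast
      next
        case False
        have "int p \<cdot>\<^sub>v (0\<^sub>v n) \<in> W" using W by (simp add: mod_subgroup_def)
        moreover have "cong_vec n (int p) (int p \<cdot>\<^sub>v (0\<^sub>v n)) v"
          using False by (auto simp: cong_vec_def cong_iff_dvd_diff)
        ultimately show ?thesis using mod_subgroup_cong[OF W _ v] by blast
      qed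
    qed
  qed (rule Wc)
qed

lemma generic_mult: "generic (k * e) \<Longrightarrow> generic k"
  unfolding generic_def by (metis dvd_mult2 mult.assoc mult.commute)

lemma e0_nonzero: "\<exists>i<n. \<not> int p dvd unit_vec n 0 $ i"
  using nonzero[of 0] C by simp

lemma pt_0: "pt 0 = unit_vec n 0"
  using C by (simp add: pt_def)

lemma conj_pow:
  assumes x: "x \<in> carrier_mat n n" and A: "A \<in> carrier_mat n n" and D: "D \<in> carrier_mat n n"
    and xA: "cong_mat n m (x * D) (A * x)"
  shows "cong_mat n m (x * D ^\<^sub>m j) (A ^\<^sub>m j * x)"
proof (induction j)
  case 0 then show ?case using x A D by simp
next
  case (Suc j)
  have "x * D ^\<^sub>m Suc j = (x * D ^\<^sub>m j) * D" using x D by (simp add: assoc_mult_mat[of _ n n _ n _ n])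
  also have "cong_mat n m \<dots> ((A ^\<^sub>m j * x) * D)"
    by (rule cong_mat_mult[OF _ _ D D Suc cong_mat_refl]) (use x D A in auto)
  also have "(A ^\<^sub>m j * x) * D = A ^\<^sub>m j * (x * D)" using x D A by (simp add: assoc_mult_mat[of _ n n _ n _ n])
  also have "cong_mat n m \<dots> (A ^\<^sub>m j * (A * x))"
    by (rule cong_mat_mult[OF _ _ _ _ cong_mat_refl xA]) (use x D A in auto)
  also have "A ^\<^sub>m j * (A * x) = A ^\<^sub>m Suc j * x" using x A by (simp add: assoc_mult_mat[of _ n n _ n _ n])
  finally show ?case .
qed

theorem conjugate_not_reducible:
  assumes x: "x \<in> carrier_mat n n" "inverse_mod n (int p) x y" and A: "A \<in> carrier_mat n n"
    and xA: "cong_mat n (int p) (x * C ^\<^sub>m k) (A * x)" and k: "generic (k * e)"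
  shows "\<not> reducible_mod n (int p) (A ^\<^sub>m e)"
proof
  assume "reducible_mod n (int p) (A ^\<^sub>m e)"
  then obtain W where W: "mod_subgroup n (int p) W" and inv: "\<And>v. v \<in> W \<Longrightarrow> A ^\<^sub>m e *\<^sub>v v \<in> W"
    and proper: "W \<noteq> carrier_vec n" and ne: "\<exists>w\<in>W. \<exists>i<n. \<not> int p dvd w $ i"
    unfolding reducible_mod_def mod_subgroup_def by blast
  have y: "y \<in> carrier_mat n n" "cong_mat n (int p) (x * y) (1\<^sub>m n)"
    using x by (auto simp: inverse_mod_def)
  have Wc: "W \<subseteq> carrier_vec n" using W by (simp add: mod_subgroup_def)
  define W' where "W' = {v \<in> carrier_vec n. x *\<^sub>v v \<in> W}"
  have W': "mod_subgroup n (int p) W'" unfolding W'_def by (rule mod_subgroup_preimage[OF W x(1)])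
  have xy: "cong_vec n (int p) (x *\<^sub>v (y *\<^sub>v w)) w" if "w \<in> carrier_vec n" for w
    using cong_mat_mult_vec[OF mult_carrier_mat[OF x(1) y(1)] one_carrier_mat that that y(2) cong_vec_refl] that x(1) y(1)
    by (simp add: assoc_mult_mat_vec[of _ n n _ n])
  have "W' = carrier_vec n"
  proof (rule generic_irreducible[OF k W'])
    fix v assume v: "v \<in> W'"
    then have vc: "v \<in> carrier_vec n" by (simp add: W'_def)
    have "cong_mat n (int p) (x * C ^\<^sub>m (k * e)) (A ^\<^sub>m e * x)"
      unfolding pow_mat_mult[OF C] by (rule conj_pow[OF x(1) A C_pow_carrier xA])
    then have "cong_vec n (int p) ((x * C ^\<^sub>m (k * e)) *\<^sub>v v) ((A ^\<^sub>m e * x) *\<^sub>v v)"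
      using x A vc by (intro cong_mat_mult_vec) auto
    then have "cong_vec n (int p) (A ^\<^sub>m e *\<^sub>v (x *\<^sub>v v)) (x *\<^sub>v (C ^\<^sub>m (k * e) *\<^sub>v v))"
      using x A vc pow_carrier_mat[OF A] by (simp add: assoc_mult_mat_vec[of _ n n _ n] cong_vec_sym)
    moreover have "A ^\<^sub>m e *\<^sub>v (x *\<^sub>v v) \<in> W" using inv v by (simp add: W'_def)
    ultimately have "x *\<^sub>v (C ^\<^sub>m (k * e) *\<^sub>v v) \<in> W"
      using mod_subgroup_cong[OF W] x(1) vc mult_mat_vec_carrier[OF C_pow_carrier vc] by simp
    then show "C ^\<^sub>m (k * e) *\<^sub>v v \<in> W'"
      using mult_mat_vec_carrier[OF C_pow_carrier vc] by (simp add: W'_def)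
  next
    obtain w where w: "w \<in> W" "\<exists>i<n. \<not> int p dvd w $ i" using ne by blast
    then have wc: "w \<in> carrier_vec n" using Wc by blast
    have "y *\<^sub>v w \<in> W'"
      using mod_subgroup_cong[OF W w(1) _ cong_vec_sym[OF xy[OF wc]]] x(1) y(1) wc by (simp add: W'_def)
    moreover have "\<exists>i<n. \<not> int p dvd (y *\<^sub>v w) $ i"
    proof (rule ccontr)
      assume "\<not> ?thesis"
      then have "cong_vec n (int p) (y *\<^sub>v w) (0\<^sub>v n)" by (auto simp: cong_vec_def cong_0_iff)
      then have "cong_vec n (int p) (x *\<^sub>v (y *\<^sub>v w)) (x *\<^sub>v 0\<^sub>v n)"
        using x(1) y(1) wc by (intro cong_mat_mult_vec) auto
      moreover have "x *\<^sub>v 0\<^sub>v n = 0\<^sub>v n" using x(1) by (intro eq_vecI) auto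
      ultimately have "cong_vec n (int p) w (0\<^sub>v n)" using xy[OF wc] by (metis cong_vec_sym cong_vec_trans)
      then show False using w(2) by (auto simp: cong_vec_def cong_0_iff)
    qed
    ultimately show "\<exists>w\<in>W'. \<exists>i<n. \<not> int p dvd w $ i" by blast
  qed
  have "carrier_vec n \<subseteq> W"
  proof
    fix w :: "int vec" assume wc: "w \<in> carrier_vec n"
    have "y *\<^sub>v w \<in> W'" unfolding \<open>W' = carrier_vec n\<close> using y(1) wc by simp
    then show "w \<in> W" using mod_subgroup_cong[OF W _ wc xy[OF wc]] by (simp add: W'_def)
  qed
  then show False using proper Wc by blast
qed

end

section \<open>Counting conjugates of powers of a Singer cycle\<close>

lemma inverse_mod_cancel_left:
  assumes x: "x \<in> carrier_mat n n" "inverse_mod n m x y" and B: "B \<in> carrier_mat n n" "B' \<in> carrier_mat n n"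
    and c: "cong_mat n m (x * B) (x * B')"
  shows "cong_mat n m B B'"
proof -
  have y: "y \<in> carrier_mat n n" "cong_mat n m (y * x) (1\<^sub>m n)" using x by (auto simp: inverse_mod_def)
  have *: "cong_mat n m (y * (x * B)) B" if "B \<in> carrier_mat n n" for B
    using cong_mat_mult_one(2)[OF that mult_carrier_mat[OF y(1) x(1)] y(2)]
    by (simp only: assoc_mult_mat[OF y(1) x(1) that])
  have "cong_mat n m (y * (x * B)) (y * (x * B'))"
    by (rule cong_mat_mult[OF y(1) y(1) _ _ cong_mat_refl c]) (use x B in auto)
  then show ?thesis using *[OF B(1)] *[OF B(2)] cong_mat_sym cong_mat_trans by blast
qed

lemma inverse_mod_cancel_right:
  assumes x: "x \<in> carrier_mat n n" "inverse_mod n m x y" and B: "B \<in> carrier_mat n n" "B' \<in> carrier_mat n n"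
    and c: "cong_mat n m (B * x) (B' * x)"
  shows "cong_mat n m B B'"
proof -
  have y: "y \<in> carrier_mat n n" "cong_mat n m (x * y) (1\<^sub>m n)" using x by (auto simp: inverse_mod_def)
  have *: "cong_mat n m ((B * x) * y) B" if "B \<in> carrier_mat n n" for B
    using cong_mat_mult_one(1)[OF that mult_carrier_mat[OF x(1) y(1)] y(2)]
    by (simp only: assoc_mult_mat[OF that x(1) y(1)])
  have "cong_mat n m ((B * x) * y) ((B' * x) * y)"
    by (rule cong_mat_mult[OF _ _ y(1) y(1) c cong_mat_refl]) (use x B in auto)
  then show ?thesis using *[OF B(1)] *[OF B(2)] cong_mat_sym cong_mat_trans by blast
qed

lemma det_inverse_mod:
  assumes x: "x \<in> carrier_mat n n" "inverse_mod n m x y"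
  shows "coprime (det x) m"
proof -
  have y: "y \<in> carrier_mat n n" "cong_mat n m (x * y) (1\<^sub>m n)" using x by (auto simp: inverse_mod_def)
  have "[det (x * y) = det (1\<^sub>m n)] (mod m)"
    by (rule cong_mat_det[OF mult_carrier_mat[OF x(1) y(1)] one_carrier_mat y(2)])
  then have "[det x * det y = 1] (mod m)" using det_mult[OF x(1) y(1)] by simp
  then show ?thesis by (metis coprime_iff_invertible_int)
qed

lemma det_pow_mat: "A \<in> carrier_mat n n \<Longrightarrow> det (A ^\<^sub>m k) = det (A :: int mat) ^ k"
  by (induction k) (auto simp: det_mult[of _ n])

context singer_matrix begin

abbreviation "GLp \<equiv> GL_mod n (int p)"

definition pol :: "(nat \<Rightarrow> int) \<Rightarrow> int mat \<Rightarrow> int mat" where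
  "pol g B = mat n n (\<lambda>(i, j). \<Sum>l\<le>n. g l * (B ^\<^sub>m l) $$ (i, j))"

lemma pol_carrier [simp]: "pol g B \<in> carrier_mat n n" by (simp add: pol_def)

lemma pol_vec:
  assumes B: "B \<in> carrier_mat n n" and "v \<in> carrier_vec n" "i < n"
  shows "(pol g B *\<^sub>v v) $ i = (\<Sum>l\<le>n. g l * (B ^\<^sub>m l *\<^sub>v v) $ i)"
proof -
  have "(pol g B *\<^sub>v v) $ i = (\<Sum>j<n. \<Sum>l\<le>n. g l * ((B ^\<^sub>m l) $$ (i, j) * v $ j))"
    using assms by (simp add: pol_def scalar_prod_def atLeast0LessThan sum_distrib_right mult.assoc)
  also have "\<dots> = (\<Sum>l\<le>n. \<Sum>j<n. g l * ((B ^\<^sub>m l) $$ (i, j) * v $ j))" by (rule sum.swap)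
  also have "\<dots> = (\<Sum>l\<le>n. g l * (B ^\<^sub>m l *\<^sub>v v) $ i)"
    using assms carrier_matD[OF pow_carrier_mat[OF B]]
    by (simp add: scalar_prod_def atLeast0LessThan sum_distrib_left)
  finally show ?thesis .
qed

lemma pol_intertwine:
  assumes x: "x \<in> carrier_mat n n" and A: "A \<in> carrier_mat n n" and B: "B \<in> carrier_mat n n"
    and c: "cong_mat n m (x * B) (A * x)"
  shows "cong_mat n m (x * pol g B) (pol g A * x)"
  unfolding cong_mat_def
proof (intro allI impI)
  fix i j assume ij: "i < n" "j < n"
  have 1: "(x * pol g B) $$ (i, j) = (\<Sum>l\<le>n. g l * (x * B ^\<^sub>m l) $$ (i, j))"
  proof -
    have "(x * pol g B) $$ (i, j) = (\<Sum>a<n. \<Sum>l\<le>n. g l * (x $$ (i, a) * (B ^\<^sub>m l) $$ (a, j)))"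
      using ij x by (simp add: pol_def scalar_prod_def atLeast0LessThan sum_distrib_left mult_ac)
    also have "\<dots> = (\<Sum>l\<le>n. \<Sum>a<n. g l * (x $$ (i, a) * (B ^\<^sub>m l) $$ (a, j)))" by (rule sum.swap)
    finally show ?thesis using ij x carrier_matD[OF pow_carrier_mat[OF B]]
      by (simp add: scalar_prod_def atLeast0LessThan sum_distrib_left)
  qed
  have 2: "(pol g A * x) $$ (i, j) = (\<Sum>l\<le>n. g l * (A ^\<^sub>m l * x) $$ (i, j))"
  proof -
    have "(pol g A * x) $$ (i, j) = (\<Sum>a<n. \<Sum>l\<le>n. g l * ((A ^\<^sub>m l) $$ (i, a) * x $$ (a, j)))"
      using ij x by (simp add: pol_def scalar_prod_def atLeast0LessThan sum_distrib_right mult.assoc)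
    also have "\<dots> = (\<Sum>l\<le>n. \<Sum>a<n. g l * ((A ^\<^sub>m l) $$ (i, a) * x $$ (a, j)))" by (rule sum.swap)
    finally show ?thesis using ij x carrier_matD[OF pow_carrier_mat[OF A]]
      by (simp add: scalar_prod_def atLeast0LessThan sum_distrib_left)
  qed
  have "[(x * B ^\<^sub>m l) $$ (i, j) = (A ^\<^sub>m l * x) $$ (i, j)] (mod m)" for l
    using conj_pow[OF x A B c, of l] ij by (simp only: cong_mat_def)
  then show "[(x * pol g B) $$ (i, j) = (pol g A * x) $$ (i, j)] (mod m)"
    unfolding 1 2 by (intro cong_sum cong_mult cong_refl)
qed

text \<open>The kernel of a polynomial in \<open>C ^\<^sub>m k\<close> is invariant under \<open>C ^\<^sub>m k\<close>, so by irreducibility it is everything as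
  soon as it contains the first basis vector.\<close>

lemma pol_zero_mat:
  assumes k: "generic k" and e: "cong_vec n (int p) (pol g (C ^\<^sub>m k) *\<^sub>v unit_vec n 0) (0\<^sub>v n)"
  shows "cong_mat n (int p) (pol g (C ^\<^sub>m k)) (0\<^sub>m n n)"
proof -
  let ?P = "pol g (C ^\<^sub>m k)"
  define W where "W = {v \<in> carrier_vec n. cong_vec n (int p) (?P *\<^sub>v v) (0\<^sub>m n n *\<^sub>v v)}"
  have z: "0\<^sub>m n n *\<^sub>v v = 0\<^sub>v n" if "v \<in> carrier_vec n" for v :: "int vec"
    using that by (intro eq_vecI) auto
  have "W = carrier_vec n"
  proof (rule generic_irreducible[OF k])
    show "mod_subgroup n (int p) W" unfolding W_def by (rule mod_subgroup_kernel) auto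
    fix v assume "v \<in> W"
    then have v: "v \<in> carrier_vec n" "cong_vec n (int p) (?P *\<^sub>v v) (0\<^sub>v n)" using z by (auto simp: W_def)
    have Cv: "C ^\<^sub>m k *\<^sub>v v \<in> carrier_vec n" using mult_mat_vec_carrier[OF C_pow_carrier v(1)] .
    have "cong_mat n (int p) (C ^\<^sub>m k * ?P) (?P * C ^\<^sub>m k)" by (rule pol_intertwine) auto
    then have "cong_vec n (int p) ((C ^\<^sub>m k * ?P) *\<^sub>v v) ((?P * C ^\<^sub>m k) *\<^sub>v v)"
      using cong_mat_mult_vec[OF mult_carrier_mat[OF C_pow_carrier pol_carrier]
          mult_carrier_mat[OF pol_carrier C_pow_carrier] v(1) v(1) _ cong_vec_refl] by blast
    then have "cong_vec n (int p) (?P *\<^sub>v (C ^\<^sub>m k *\<^sub>v v)) (C ^\<^sub>m k *\<^sub>v (?P *\<^sub>v v))"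
      using assoc_mult_mat_vec[OF C_pow_carrier pol_carrier v(1)]
        assoc_mult_mat_vec[OF pol_carrier C_pow_carrier v(1)] cong_vec_sym by simp
    also have "cong_vec n (int p) (C ^\<^sub>m k *\<^sub>v (?P *\<^sub>v v)) (C ^\<^sub>m k *\<^sub>v 0\<^sub>v n)"
      by (rule cong_mat_mult_vec[OF C_pow_carrier C_pow_carrier _ _ cong_mat_refl v(2)])
        (use mult_mat_vec_carrier[OF pol_carrier v(1)] in auto)
    also have "C ^\<^sub>m k *\<^sub>v 0\<^sub>v n = 0\<^sub>v n"
      using carrier_matD[OF C_pow_carrier[of k]] by (intro eq_vecI) auto
    finally show "C ^\<^sub>m k *\<^sub>v v \<in> W" using Cv z by (simp add: W_def)
  next
    have "unit_vec n 0 \<in> W" using e z[OF unit_vec_carrier] by (simp add: W_def)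
    then show "\<exists>w\<in>W. \<exists>i<n. \<not> int p dvd w $ i" using e0_nonzero by blast
  qed
  then have "cong_vec n (int p) (?P *\<^sub>v v) (0\<^sub>m n n *\<^sub>v v)" if "v \<in> carrier_vec n" for v
    using that unfolding W_def by blast
  then show ?thesis by (intro cong_mat_if_cong_vec) auto
qed

text \<open>There are more coefficient vectors of length \<open>n + 1\<close> than vectors of length \<open>n\<close>, so two polynomials
  have the same value at the first basis vector; take their difference.\<close>

lemma annihilating_polynomial:
  "\<exists>g. (\<exists>l\<le>n. \<not> int p dvd g l) \<and> cong_vec n (int p) (pol g (C ^\<^sub>m k) *\<^sub>v unit_vec n 0) (0\<^sub>v n)"
proof -
  have p1: "p > 1" using p prime_gt_1_nat by blast
  define T where "T = ({..n} \<rightarrow>\<^sub>E {0..<int p})"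
  define V where "V = ({..<n} \<rightarrow>\<^sub>E {0..<int p})"
  define q where "q g = (\<lambda>i\<in>{..<n}. (pol g (C ^\<^sub>m k) *\<^sub>v unit_vec n 0) $ i mod int p)" for g
  have "q ` T \<subseteq> V" using p1 by (intro image_subsetI) (simp add: q_def V_def restrict_PiE_iff)
  moreover have "finite V" unfolding V_def by (intro finite_PiE) auto
  ultimately have "card (q ` T) \<le> card V" by (intro card_mono)
  also have "\<dots> = p ^ n" by (simp add: V_def card_PiE)
  also have "\<dots> < p ^ Suc n" using p1 by simp
  also have "\<dots> = card T" by (simp add: T_def card_PiE)
  finally have "\<not> inj_on q T" by (rule pigeonhole)
  then obtain g1 g2 where g: "g1 \<in> T" "g2 \<in> T" "q g1 = q g2" "g1 \<noteq> g2" unfolding inj_on_def by blast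
  define g where "g l = g1 l - g2 l" for l
  have "\<exists>l\<in>{..n}. g1 l \<noteq> g2 l" using PiE_ext[OF g(1,2)[unfolded T_def]] g(4) by blast
  then obtain l where l: "l \<le> n" "g1 l \<noteq> g2 l" by auto
  have "\<not> int p dvd g l"
  proof
    assume "int p dvd g l"
    then have "[g1 l = g2 l] (mod int p)" by (simp add: g_def cong_iff_dvd_diff)
    then show False using l PiE_mem[OF g(1)[unfolded T_def], of l] PiE_mem[OF g(2)[unfolded T_def], of l]
      cong_less_imp_eq_int[of "g1 l" "int p" "g2 l"] by simp
  qed
  moreover have "cong_vec n (int p) (pol g (C ^\<^sub>m k) *\<^sub>v unit_vec n 0) (0\<^sub>v n)"
    unfolding cong_vec_def
  proof (intro allI impI)
    fix i assume i: "i < n"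
    have "(pol g (C ^\<^sub>m k) *\<^sub>v unit_vec n 0) $ i
        = (pol g1 (C ^\<^sub>m k) *\<^sub>v unit_vec n 0) $ i - (pol g2 (C ^\<^sub>m k) *\<^sub>v unit_vec n 0) $ i"
      unfolding pol_vec[OF C_pow_carrier unit_vec_carrier i] by (simp add: g_def algebra_simps sum_subtractf)
    moreover have "[(pol g1 (C ^\<^sub>m k) *\<^sub>v unit_vec n 0) $ i = (pol g2 (C ^\<^sub>m k) *\<^sub>v unit_vec n 0) $ i] (mod int p)"
      using fun_cong[OF g(3), of i] i by (simp add: q_def cong_def)
    ultimately show "[(pol g (C ^\<^sub>m k) *\<^sub>v unit_vec n 0) $ i = 0\<^sub>v n $ i] (mod int p)"
      using i by (simp add: cong_iff_dvd_diff)
  qed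
  ultimately show ?thesis using l by blast
qed

definition conjugates_to :: "int mat \<Rightarrow> int mat \<Rightarrow> nat \<Rightarrow> bool" where
  "conjugates_to A x k \<longleftrightarrow> x \<in> carrier GLp \<and> cong_mat n (int p) (x * C ^\<^sub>m k) (A * x)"

text \<open>Two conjugators that agree on the first basis vector agree on a \<open>C ^\<^sub>m k\<close>-invariant subspace, hence
  everywhere. So a conjugator is determined by its first column, a nonzero vector.\<close>

lemma card_conjugators:
  assumes k: "generic k" and A: "A \<in> carrier_mat n n"
  shows "finite {x. conjugates_to A x k} \<and> card {x. conjugates_to A x k} \<le> N"
proof -
  let ?X = "{x. conjugates_to A x k}"
  have idx: "\<exists>i<N. cong_vec n (int p) (x *\<^sub>v unit_vec n 0) (pt i)" if "x \<in> ?X" for x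
  proof -
    have x: "x \<in> carrier_mat n n" and "\<exists>y. inverse_mod n (int p) x y"
      using that by (auto simp: conjugates_to_def GL_mod_carrier)
    then obtain y where y: "y \<in> carrier_mat n n" "cong_mat n (int p) (y * x) (1\<^sub>m n)"
      by (auto simp: inverse_mod_def)
    have xe: "x *\<^sub>v unit_vec n 0 \<in> carrier_vec n" using mult_mat_vec_carrier[OF x] by simp
    have "\<exists>i<n. \<not> int p dvd (x *\<^sub>v unit_vec n 0) $ i"
    proof (rule ccontr)
      assume "\<not> ?thesis"
      then have "cong_vec n (int p) (x *\<^sub>v unit_vec n 0) (0\<^sub>v n)" by (auto simp: cong_vec_def cong_0_iff)
      then have "cong_vec n (int p) (y *\<^sub>v (x *\<^sub>v unit_vec n 0)) (y *\<^sub>v 0\<^sub>v n)"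
        using xe y(1) by (intro cong_mat_mult_vec) auto
      moreover have "y *\<^sub>v 0\<^sub>v n = 0\<^sub>v n" using y(1) by (intro eq_vecI) auto
      moreover have "y *\<^sub>v (x *\<^sub>v unit_vec n 0) = (y * x) *\<^sub>v unit_vec n 0"
        by (rule assoc_mult_mat_vec[OF y(1) x unit_vec_carrier, symmetric])
      moreover have "cong_vec n (int p) ((y * x) *\<^sub>v unit_vec n 0) (1\<^sub>m n *\<^sub>v unit_vec n 0)"
        by (rule cong_mat_mult_vec[OF mult_carrier_mat[OF y(1) x] one_carrier_mat _ _ y(2)]) auto
      ultimately have "cong_vec n (int p) (unit_vec n 0) (0\<^sub>v n)"
        by (metis cong_vec_sym cong_vec_trans one_mult_mat_vec unit_vec_carrier)
      then show False using e0_nonzero by (auto simp: cong_vec_def cong_0_iff)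
    qed
    then show ?thesis using orbit[OF xe] by (simp add: pt_def)
  qed
  then obtain f where f: "\<forall>x\<in>?X. f x < N \<and> cong_vec n (int p) (x *\<^sub>v unit_vec n 0) (pt (f x))"
    using bchoice[of ?X "\<lambda>x i. i < N \<and> cong_vec n (int p) (x *\<^sub>v unit_vec n 0) (pt i)"] by blast
  have "inj_on f ?X"
  proof (rule inj_onI)
    fix x x' assume xx: "x \<in> ?X" "x' \<in> ?X" "f x = f x'"
    have c: "x \<in> carrier_mat n n" "x' \<in> carrier_mat n n" "reduce_mat n (int p) x = x" "reduce_mat n (int p) x' = x'"
      using xx by (auto simp: conjugates_to_def GL_mod_carrier)
    define W where "W = {v \<in> carrier_vec n. cong_vec n (int p) (x *\<^sub>v v) (x' *\<^sub>v v)}"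
    have *: "cong_vec n (int p) (x *\<^sub>v (C ^\<^sub>m k *\<^sub>v v)) (A *\<^sub>v (x *\<^sub>v v))"
      if "x \<in> ?X" "x \<in> carrier_mat n n" "v \<in> carrier_vec n" for x v
    proof -
      have "cong_vec n (int p) ((x * C ^\<^sub>m k) *\<^sub>v v) ((A * x) *\<^sub>v v)"
        by (rule cong_mat_mult_vec[OF mult_carrier_mat[OF that(2) C_pow_carrier] mult_carrier_mat[OF A that(2)]
            that(3,3) _ cong_vec_refl]) (use that(1) in \<open>simp add: conjugates_to_def\<close>)
      then show ?thesis
        by (simp only: assoc_mult_mat_vec[OF that(2) C_pow_carrier that(3)] assoc_mult_mat_vec[OF A that(2,3)])
    qed
    have "W = carrier_vec n"
    proof (rule generic_irreducible[OF k])
      show "mod_subgroup n (int p) W" unfolding W_def by (rule mod_subgroup_kernel[OF c(1,2)])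
      fix v assume "v \<in> W"
      then have v: "v \<in> carrier_vec n" "cong_vec n (int p) (x *\<^sub>v v) (x' *\<^sub>v v)" by (auto simp: W_def)
      have "cong_vec n (int p) (A *\<^sub>v (x *\<^sub>v v)) (A *\<^sub>v (x' *\<^sub>v v))"
        by (rule cong_mat_mult_vec[OF A A _ _ cong_mat_refl v(2)]) (use c v mult_mat_vec_carrier in auto)
      then have "cong_vec n (int p) (x *\<^sub>v (C ^\<^sub>m k *\<^sub>v v)) (x' *\<^sub>v (C ^\<^sub>m k *\<^sub>v v))"
        using *[OF xx(1) c(1) v(1)] *[OF xx(2) c(2) v(1)] cong_vec_sym cong_vec_trans by blast
      then show "C ^\<^sub>m k *\<^sub>v v \<in> W" using mult_mat_vec_carrier[OF C_pow_carrier v(1)] by (simp add: W_def)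
    next
      have "cong_vec n (int p) (x *\<^sub>v unit_vec n 0) (x' *\<^sub>v unit_vec n 0)"
        using f xx cong_vec_sym cong_vec_trans by metis
      then have "unit_vec n 0 \<in> W" by (simp add: W_def)
      then show "\<exists>w\<in>W. \<exists>i<n. \<not> int p dvd w $ i" using e0_nonzero by blast
    qed
    then have "cong_mat n (int p) x x'" using c by (intro cong_mat_if_cong_vec) (auto simp: W_def)
    then show "x = x'" using c reduce_mat_eq_iff[of n "int p" x x'] by simp
  qed
  moreover have "f ` ?X \<subseteq> {..<N}" using f by blast
  ultimately show ?thesis
    using card_inj_on_le[of f ?X "{..<N}"] inj_on_finite[of f ?X "{..<N}"] by simp
qed

text \<open>If \<open>A\<close> is conjugate to a generic power of \<open>C\<close>, a polynomial of degree at most \<open>n\<close> that annihilates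
  this power annihilates \<open>A\<close> and all other powers of \<open>C\<close> conjugate to \<open>A\<close>. In field terms, these powers are roots
  of the polynomial.\<close>

lemma card_conjugate_exponents:
  assumes A: "A \<in> carrier_mat n n"
  shows "card {k. k < N \<and> generic k \<and> (\<exists>x. conjugates_to A x k)} \<le> n"
proof (cases "{k. k < N \<and> generic k \<and> (\<exists>x. conjugates_to A x k)} = {}")
  case True show ?thesis by (simp only: True card.empty le0)
next
  case False
  then obtain k0 x0 where k0: "generic k0" "conjugates_to A x0 k0" by blast
  obtain g where g: "\<exists>l\<le>n. \<not> int p dvd g l"
    "cong_vec n (int p) (pol g (C ^\<^sub>m k0) *\<^sub>v unit_vec n 0) (0\<^sub>v n)"
    using annihilating_polynomial[of k0] by blast
  have P0: "cong_mat n (int p) (pol g (C ^\<^sub>m k0)) (0\<^sub>m n n)" by (rule pol_zero_mat[OF k0(1) g(2)])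
  have x0: "x0 \<in> carrier_mat n n" "\<exists>y. inverse_mod n (int p) x0 y" "cong_mat n (int p) (x0 * C ^\<^sub>m k0) (A * x0)"
    using k0(2) by (auto simp: conjugates_to_def GL_mod_carrier)
  obtain y0 where y0: "inverse_mod n (int p) x0 y0" using x0 by blast
  have "cong_mat n (int p) (pol g A * x0) (x0 * pol g (C ^\<^sub>m k0))"
    by (rule cong_mat_sym[OF pol_intertwine[OF x0(1) A C_pow_carrier x0(3)]])
  also have "cong_mat n (int p) (x0 * pol g (C ^\<^sub>m k0)) (x0 * 0\<^sub>m n n)"
    by (rule cong_mat_mult[OF x0(1,1) _ _ cong_mat_refl P0]) auto
  also have "x0 * 0\<^sub>m n n = 0\<^sub>m n n * x0" using x0(1) by simp
  finally have PA: "cong_mat n (int p) (pol g A) (0\<^sub>m n n)"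
    by (rule inverse_mod_cancel_right[OF x0(1) y0 pol_carrier zero_carrier_mat])
  have "{k. k < N \<and> generic k \<and> (\<exists>x. conjugates_to A x k)} \<subseteq>
      {k. k < N \<and> (\<forall>i<n. int p dvd (\<Sum>l\<le>n. g l * (C ^\<^sub>m (k * l) *\<^sub>v unit_vec n 0) $ i))}"
  proof
    fix k assume "k \<in> {k. k < N \<and> generic k \<and> (\<exists>x. conjugates_to A x k)}"
    then obtain x where k: "k < N" and xk: "conjugates_to A x k" by blast
    have x: "x \<in> carrier_mat n n" "\<exists>y. inverse_mod n (int p) x y" "cong_mat n (int p) (x * C ^\<^sub>m k) (A * x)"
      using xk by (auto simp: conjugates_to_def GL_mod_carrier)
    obtain y where y: "inverse_mod n (int p) x y" using x by blast
    have "cong_mat n (int p) (x * pol g (C ^\<^sub>m k)) (pol g A * x)"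
      by (rule pol_intertwine[OF x(1) A C_pow_carrier x(3)])
    also have "cong_mat n (int p) (pol g A * x) (0\<^sub>m n n * x)"
      by (rule cong_mat_mult[OF _ _ x(1,1) PA cong_mat_refl]) auto
    also have "0\<^sub>m n n * x = x * 0\<^sub>m n n" using x(1) by simp
    finally have "cong_mat n (int p) (pol g (C ^\<^sub>m k)) (0\<^sub>m n n)"
      by (rule inverse_mod_cancel_left[OF x(1) y pol_carrier zero_carrier_mat])
    then have z: "cong_vec n (int p) (pol g (C ^\<^sub>m k) *\<^sub>v unit_vec n 0) (0\<^sub>m n n *\<^sub>v unit_vec n 0)"
      by (intro cong_mat_mult_vec) auto
    have "int p dvd (\<Sum>l\<le>n. g l * (C ^\<^sub>m (k * l) *\<^sub>v unit_vec n 0) $ i)" if i: "i < n" for i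
    proof -
      have "[(pol g (C ^\<^sub>m k) *\<^sub>v unit_vec n 0) $ i = (0\<^sub>m n n *\<^sub>v unit_vec n 0) $ i] (mod int p)"
        using z i by (simp only: cong_vec_def)
      moreover have "(0\<^sub>m n n *\<^sub>v unit_vec n 0 :: int vec) $ i = 0" using i by simp
      ultimately have "int p dvd (pol g (C ^\<^sub>m k) *\<^sub>v unit_vec n 0) $ i" by (simp only: cong_0_iff)
      then show ?thesis unfolding pol_vec[OF C_pow_carrier unit_vec_carrier i] pow_mat_mult[OF C] .
    qed
    then show "k \<in> {k. k < N \<and> (\<forall>i<n. int p dvd (\<Sum>l\<le>n. g l * (C ^\<^sub>m (k * l) *\<^sub>v unit_vec n 0) $ i))}"
      using k by blast
  qed
  then have "card {k. k < N \<and> generic k \<and> (\<exists>x. conjugates_to A x k)} \<le>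
      card {k. k < N \<and> (\<forall>i<n. int p dvd (\<Sum>l\<le>n. g l * (C ^\<^sub>m (k * l) *\<^sub>v unit_vec n 0) $ i))}"
    by (intro card_mono) auto
  then show ?thesis using roots[OF g(1)] by linarith
qed

lemma C_in_GL: "reduce_mat n (int p) (C ^\<^sub>m k) \<in> carrier GLp"
proof -
  interpret group GLp by (rule group_GL_mod)
  have "C * C ^\<^sub>m (N - 1) = C ^\<^sub>m N" "C ^\<^sub>m (N - 1) * C = C ^\<^sub>m N"
    using pow_mat_add[OF C, of 1 "N - 1"] pow_mat_add[OF C, of "N - 1" 1] N_pos C by auto
  then have "inverse_mod n (int p) C (C ^\<^sub>m (N - 1))" using C_N by (simp add: inverse_mod_def)
  then have "reduce_mat n (int p) C \<in> carrier GLp" by (rule reduce_mat_in_GL[OF C])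
  then show ?thesis using GL_mod_pow[OF C, of "int p" k] nat_pow_closed by metis
qed

definition det_coset :: "int \<Rightarrow> int mat set" where
  "det_coset \<tau> = {A \<in> carrier GLp. [det A = \<tau>] (mod int p)}"

definition good_exponents :: "nat \<Rightarrow> int \<Rightarrow> nat set" where
  "good_exponents e \<tau> = {k. k < N \<and> generic (k * e) \<and> [det (C ^\<^sub>m k) = \<tau>] (mod int p)}"

text \<open>Count the pairs \<open>(k, x)\<close> of a good exponent \<open>k\<close> and an invertible matrix \<open>x\<close> by the conjugate of \<open>C ^\<^sub>m k\<close> by
  \<open>x\<close>. Each matrix arises from at most \<open>n\<close> exponents, and from at most \<open>N\<close> conjugators for each exponent.\<close>

lemma count_conjugates:
  "card (carrier GLp) * card (good_exponents e \<tau>) \<le>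
     n * N * card {A \<in> det_coset \<tau>. \<not> reducible_mod n (int p) (A ^\<^sub>m e)}"
proof -
  interpret G: group GLp by (rule group_GL_mod)
  have p0: "int p > 0" using p prime_gt_0_nat by simp
  have finG: "finite (carrier GLp)" by (rule finite_GL_mod[OF p0])
  define J where "J = good_exponents e \<tau>"
  define Y where "Y = {A \<in> det_coset \<tau>. \<not> reducible_mod n (int p) (A ^\<^sub>m e)}"
  have finY: "finite Y" using finG by (simp add: Y_def det_coset_def)
  have Yc: "A \<in> carrier_mat n n" if "A \<in> Y" for A using that by (simp add: Y_def det_coset_def GL_mod_carrier)
  define K where "K A = {k. k < N \<and> generic k \<and> (\<exists>x. conjugates_to A x k)}" for A
  define fib where "fib A = (SIGMA k:K A. {x. conjugates_to A x k})" for A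
  have fib: "finite (fib A) \<and> card (fib A) \<le> n * N" if A: "A \<in> Y" for A
  proof -
    have finK: "finite (K A)" by (simp add: K_def)
    have fx: "finite {x. conjugates_to A x k}" "card {x. conjugates_to A x k} \<le> N" if "k \<in> K A" for k
      using card_conjugators[OF _ Yc[OF A], of k] that by (auto simp: K_def)
    have "card (fib A) = (\<Sum>k\<in>K A. card {x. conjugates_to A x k})"
      unfolding fib_def using finK fx by (intro card_SigmaI) auto
    also have "\<dots> \<le> card (K A) * N" using fx sum_bounded_above[of "K A" "\<lambda>k. card {x. conjugates_to A x k}" N] by simp
    also have "\<dots> \<le> n * N" using card_conjugate_exponents[OF Yc[OF A]] by (simp add: K_def)
    finally show ?thesis unfolding fib_def using finK fx by (auto intro!: finite_SigmaI)
  qed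
  have sub: "J \<times> carrier GLp \<subseteq> (\<Union>A\<in>Y. fib A)"
  proof
    fix kx assume "kx \<in> J \<times> carrier GLp"
    then obtain k x where kx: "kx = (k, x)" "k \<in> J" "x \<in> carrier GLp" by blast
    define A where "A = x \<otimes>\<^bsub>GLp\<^esub> reduce_mat n (int p) (C ^\<^sub>m k) \<otimes>\<^bsub>GLp\<^esub> inv\<^bsub>GLp\<^esub> x"
    have A: "A \<in> carrier GLp" using kx C_in_GL by (simp add: A_def del: GL_mod_mult GL_mod_one)
    have "A \<otimes>\<^bsub>GLp\<^esub> x = x \<otimes>\<^bsub>GLp\<^esub> reduce_mat n (int p) (C ^\<^sub>m k)"
      unfolding A_def using kx C_in_GL[of k] by (simp add: G.m_assoc del: GL_mod_mult GL_mod_one)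
    moreover have xc: "x \<in> carrier_mat n n" "reduce_mat n (int p) x = x" "\<exists>y. inverse_mod n (int p) x y"
      using kx(3) by (auto simp: GL_mod_carrier)
    moreover have Ac: "A \<in> carrier_mat n n" using A by (simp add: GL_mod_carrier)
    ultimately have "reduce_mat n (int p) (A * x) = reduce_mat n (int p) (x * C ^\<^sub>m k)"
      using GL_mod_mult_eq[OF xc(1) C_pow_carrier, of "int p" k] by simp
    then have cong: "cong_mat n (int p) (x * C ^\<^sub>m k) (A * x)" by (simp add: reduce_mat_eq_iff cong_mat_sym)
    obtain y where y: "inverse_mod n (int p) x y" using xc by blast
    have kJ: "k < N" "generic (k * e)" "[det (C ^\<^sub>m k) = \<tau>] (mod int p)"
      using kx(2) by (auto simp: J_def good_exponents_def)
    have "[det (x * C ^\<^sub>m k) = det (A * x)] (mod int p)"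
      by (rule cong_mat_det[OF _ _ cong]) (use xc Ac in auto)
    then have "[det (C ^\<^sub>m k) * det x = det A * det x] (mod int p)"
      using det_mult[OF xc(1) C_pow_carrier, of k] det_mult[OF Ac xc(1)] by (simp add: mult.commute)
    then have "[det (C ^\<^sub>m k) = det A] (mod int p)"
      using cong_mult_rcancel[OF det_inverse_mod[OF xc(1) y]] by blast
    then have "[det A = \<tau>] (mod int p)" using kJ(3) cong_sym cong_trans by blast
    then have "A \<in> Y" using A conjugate_not_reducible[OF xc(1) y Ac cong kJ(2)] by (simp add: Y_def det_coset_def)
    moreover have "(k, x) \<in> fib A"
      using kJ kx(3) cong generic_mult[OF kJ(2)] by (auto simp: fib_def K_def conjugates_to_def)
    ultimately show "kx \<in> (\<Union>A\<in>Y. fib A)" using kx by blast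
  qed
  have "card (carrier GLp) * card J = card (J \<times> carrier GLp)" by (simp add: card_cartesian_product)
  also have "\<dots> \<le> card (\<Union>A\<in>Y. fib A)" using sub finY fib by (intro card_mono) auto
  also have "\<dots> \<le> (\<Sum>A\<in>Y. card (fib A))" by (rule card_UN_le[OF finY])
  also have "\<dots> \<le> card Y * (n * N)" using fib sum_bounded_above[of Y "\<lambda>A. card (fib A)" "n * N"] by simp
  finally show ?thesis by (simp add: J_def Y_def mult_ac)
qed

text \<open>Multiplication by the diagonal matrices with entries \<open>t, 1, \<dots>, 1\<close> for \<open>1 \<le> t < p\<close> gives \<open>p - 1\<close> disjoint
  copies of the coset.\<close>

lemma card_GL_ge:
  assumes \<tau>: "coprime \<tau> (int p)"
  shows "(p - 1) * card (det_coset \<tau>) \<le> card (carrier GLp)"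
proof -
  interpret G: group GLp by (rule group_GL_mod)
  have p0: "int p > 0" using p prime_gt_0_nat by simp
  define D where "D t = multrow_mat n 0 (int t)" for t
  have D: "D t \<in> carrier_mat n n" for t by (simp add: D_def)
  have detD: "det (D t) = int t" for t unfolding D_def by (rule det_multrow_mat[OF n])
  have D_inv: "\<exists>E. inverse_mod n (int p) (D t) E" if t: "t \<in> {1..<p}" for t
  proof -
    have "coprime (int t) (int p)"
      using t p by (metis atLeastLessThan_iff coprime_commute coprime_int_iff nat_dvd_not_less not_one_le_zero prime_imp_coprime_nat zero_less_iff_neq_zero)
    then obtain s where s: "[int t * s = 1] (mod int p)" using cong_solve_coprime_int by blast
    have "inverse_mod n (int p) (D t) (multrow_mat n 0 s)"
      unfolding inverse_mod_def
    proof (intro conjI)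
      have 1: "D t * multrow_mat n 0 s = multrow_mat n 0 (int t * s)"
        unfolding D_def by (subst multrow_mat[symmetric, of _ n n]) (auto intro!: eq_matI)
      have 2: "multrow_mat n 0 s * D t = multrow_mat n 0 (s * int t)"
        unfolding D_def by (subst multrow_mat[symmetric, of _ n n]) (auto intro!: eq_matI)
      show "cong_mat n (int p) (D t * multrow_mat n 0 s) (1\<^sub>m n)"
        "cong_mat n (int p) (multrow_mat n 0 s * D t) (1\<^sub>m n)"
        unfolding 1 2 using s by (auto simp: cong_mat_def mult.commute)
    qed simp
    then show ?thesis by blast
  qed
  define f where "f = (\<lambda>(A, t). reduce_mat n (int p) (A * D t))"
  have "inj_on f (det_coset \<tau> \<times> {1..<p})"
  proof (rule inj_onI)
    fix u v assume uv: "u \<in> det_coset \<tau> \<times> {1..<p}" "v \<in> det_coset \<tau> \<times> {1..<p}" "f u = f v"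
    obtain A t B s where AB: "u = (A, t)" "v = (B, s)" by (metis surj_pair)
    have c: "A \<in> carrier_mat n n" "B \<in> carrier_mat n n" "reduce_mat n (int p) A = A" "reduce_mat n (int p) B = B"
      and d: "[det A = \<tau>] (mod int p)" "[det B = \<tau>] (mod int p)" and ts: "t \<in> {1..<p}" "s \<in> {1..<p}"
      using uv AB by (auto simp: det_coset_def GL_mod_carrier)
    have cong: "cong_mat n (int p) (A * D t) (B * D s)"
      using uv(3) AB by (simp add: f_def reduce_mat_eq_iff)
    have "[det (A * D t) = det (B * D s)] (mod int p)"
      by (rule cong_mat_det[OF _ _ cong]) (use c D in auto)
    then have "[det A * int t = det B * int s] (mod int p)" using det_mult[OF c(1) D] det_mult[OF c(2) D] detD by simp
    moreover have "[\<tau> * int t = det A * int t] (mod int p)" "[det B * int s = \<tau> * int s] (mod int p)"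
      using d by (auto intro: cong_mult cong_sym)
    ultimately have "[\<tau> * int t = \<tau> * int s] (mod int p)" by (meson cong_trans)
    then have "[int t = int s] (mod int p)" using cong_mult_lcancel[OF \<tau>] by blast
    then have "t = s" using ts cong_less_imp_eq_int[of "int t" "int p" "int s"] by simp
    moreover obtain E where "inverse_mod n (int p) (D t) E" using D_inv[OF ts(1)] by blast
    then have "cong_mat n (int p) A B" using inverse_mod_cancel_right[OF D _ c(1,2)] cong \<open>t = s\<close> by blast
    then have "A = B" using c reduce_mat_eq_iff[of n "int p" A B] by simp
    ultimately show "u = v" using AB by simp
  qed
  moreover have "f ` (det_coset \<tau> \<times> {1..<p}) \<subseteq> carrier GLp"
  proof
    fix B assume "B \<in> f ` (det_coset \<tau> \<times> {1..<p})"
    then obtain A t where At: "A \<in> carrier GLp" "t \<in> {1..<p}" "B = reduce_mat n (int p) (A * D t)"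
      by (auto simp: f_def det_coset_def)
    then obtain A' E where "inverse_mod n (int p) A A'" "inverse_mod n (int p) (D t) E" "A \<in> carrier_mat n n"
      using D_inv unfolding GL_mod_carrier by blast
    then show "B \<in> carrier GLp" unfolding At(3) using inverse_mod_mult[OF _ D] D by (intro reduce_mat_in_GL) auto
  qed
  ultimately have "card (det_coset \<tau> \<times> {1..<p}) \<le> card (carrier GLp)"
    using finite_GL_mod[OF p0] by (rule card_inj_on_le)
  then show ?thesis by (simp add: card_cartesian_product mult.commute)
qed

end

section \<open>The density of irreducible matrices\<close>

lemma geometric_sum_nat: "(p - 1) * (\<Sum>i<m. p ^ i) = p ^ m - (1::nat)"
proof (cases p)
  case 0 then show ?thesis by (cases m) auto
next
  case (Suc r)
  have "r * (\<Sum>i<m. p ^ i) + 1 = p ^ m" by (induction m) (auto simp: Suc algebra_simps)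
  then show ?thesis using Suc by simp
qed

text \<open>Two solutions differ by a multiple of \<open>h / gcd h y\<close>.\<close>

lemma card_arithmetic_progression_dvd:
  fixes a h y k0 :: nat
  assumes a: "a > 0" and y: "y > 0" and h: "h > 0"
  shows "card {i. i < h \<and> a * h dvd (k0 + a * i) * y} \<le> gcd h y"
proof -
  let ?B = "{i. i < h \<and> a * h dvd (k0 + a * i) * y}"
  define c where "c = gcd h y"
  have c: "c > 0" using h by (simp add: c_def)
  define h' where "h' = h div c"
  define y' where "y' = y div c"
  have hy: "h = h' * c" "y = y' * c" by (simp_all add: h'_def y'_def c_def)
  have co: "coprime h' y'" unfolding h'_def y'_def c_def using h by (intro div_gcd_coprime) simp
  have h'0: "h' > 0" using h hy by (cases h') auto
  have same: "h' dvd j - i" if "i \<in> ?B" "j \<in> ?B" "i \<le> j" for i j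
  proof -
    have "a * h dvd (k0 + a * j) * y - (k0 + a * i) * y" using that by (intro dvd_diff_nat) auto
    also have "(k0 + a * j) * y - (k0 + a * i) * y = a * ((j - i) * y)"
      using that(3) by (simp add: diff_mult_distrib[symmetric] diff_mult_distrib2[symmetric] mult.assoc)
    finally have "h dvd (j - i) * y" using a by simp
    then have "h' * c dvd ((j - i) * y') * c" by (simp add: hy mult.assoc)
    then have "h' dvd (j - i) * y'" using c by simp
    then show ?thesis using co by (simp add: coprime_dvd_mult_left_iff)
  qed
  have same_mod: "i mod h' = j mod h'" if "i \<in> ?B" "j \<in> ?B" for i j
  proof (cases "i \<le> j")
    case True then show ?thesis using same[OF that True] by (metis mod_eq_dvd_iff_nat)
  next
    case False then show ?thesis using same[OF that(2,1)] by (metis mod_eq_dvd_iff_nat nat_le_linear)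
  qed
  have "inj_on (\<lambda>i. i div h') ?B"
  proof (rule inj_onI)
    fix i j assume ij: "i \<in> ?B" "j \<in> ?B" "i div h' = j div h'"
    then show "i = j" using same_mod[OF ij(1,2)] by (metis div_mult_mod_eq)
  qed
  moreover have "(\<lambda>i. i div h') ` ?B \<subseteq> {..<c}"
    using h'0 by (auto simp: hy(1) less_mult_imp_div_less mult.commute)
  ultimately have "card ?B \<le> card {..<c}" by (intro card_inj_on_le[where f = "\<lambda>i. i div h'"]) auto
  then show ?thesis by (simp add: c_def)
qed

context singer_matrix begin

text \<open>The centralizer of \<open>C\<close> acts freely, because the powers of \<open>C\<close> carry the first basis vector to
  every nonzero vector.\<close>

lemma cong_if_agree_on_e0:
  assumes A: "A \<in> carrier_mat n n" and B: "B \<in> carrier_mat n n"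
    and AC: "cong_mat n (int p) (A * C) (C * A)" and BC: "cong_mat n (int p) (B * C) (C * B)"
    and e: "cong_vec n (int p) (A *\<^sub>v unit_vec n 0) (B *\<^sub>v unit_vec n 0)"
  shows "cong_mat n (int p) A B"
proof -
  define W where "W = {v \<in> carrier_vec n. cong_vec n (int p) (A *\<^sub>v v) (B *\<^sub>v v)}"
  have W: "mod_subgroup n (int p) W" unfolding W_def by (rule mod_subgroup_kernel[OF A B])
  have swap: "cong_vec n (int p) (A *\<^sub>v (C *\<^sub>v v)) (C *\<^sub>v (A *\<^sub>v v))"
    if "A \<in> carrier_mat n n" "cong_mat n (int p) (A * C) (C * A)" "v \<in> carrier_vec n" for A v
    using cong_mat_mult_vec[OF mult_carrier_mat[OF that(1) C] mult_carrier_mat[OF C that(1)] that(3,3,2) cong_vec_refl]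
    by (simp only: assoc_mult_mat_vec[OF that(1) C that(3)] assoc_mult_mat_vec[OF C that(1,3)])
  have pt_W: "pt k \<in> W" for k
  proof (induction k)
    case 0 then show ?case using e by (simp add: W_def pt_0)
  next
    case (Suc k)
    have pt_Suc: "pt (Suc k) = C *\<^sub>v pt k" using C_pt[of 1 k] C by simp
    have "cong_vec n (int p) (C *\<^sub>v (A *\<^sub>v pt k)) (C *\<^sub>v (B *\<^sub>v pt k))"
      by (rule cong_mat_mult_vec[OF C C _ _ cong_mat_refl]) (use Suc A B in \<open>auto simp: W_def\<close>)
    then have "cong_vec n (int p) (A *\<^sub>v pt (Suc k)) (B *\<^sub>v pt (Suc k))"
      unfolding pt_Suc using swap[OF A AC pt_carrier] swap[OF B BC pt_carrier] cong_vec_sym cong_vec_trans by blast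
    then show ?case by (simp add: W_def)
  qed
  have "v \<in> W" if v: "v \<in> carrier_vec n" for v
  proof (cases "\<exists>i<n. \<not> int p dvd v $ i")
    case True
    then obtain k where "cong_vec n (int p) v (pt k)" using orbit[OF v] by (auto simp: pt_def)
    then show ?thesis using mod_subgroup_cong[OF W pt_W v] cong_vec_sym by blast
  next
    case False
    have "int p \<cdot>\<^sub>v (0\<^sub>v n) \<in> W" using W by (simp add: mod_subgroup_def)
    moreover have "cong_vec n (int p) (int p \<cdot>\<^sub>v (0\<^sub>v n)) v"
      using False by (auto simp: cong_vec_def cong_iff_dvd_diff)
    ultimately show ?thesis using mod_subgroup_cong[OF W _ v] by blast
  qed
  then show ?thesis by (intro cong_mat_if_cong_vec[OF A B]) (simp add: W_def)
qed

text \<open>If \<open>z ^ n = -1\<close> modulo \<open>p\<close>, the scalar matrix \<open>z\<close> has determinant \<open>-1\<close>; it commutes with \<open>C\<close> and is therefore a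
  power of \<open>C\<close> modulo \<open>p\<close>.\<close>

lemma ex_exponent_of_det:
  assumes \<tau>: "\<tau> = 1 \<or> \<tau> = -1 \<and> [z ^ n = -1] (mod int p)"
  shows "\<exists>k. [det (C ^\<^sub>m k) = \<tau>] (mod int p)"
proof (cases "\<tau> = 1")
  case True
  then show ?thesis using C by (intro exI[of _ 0]) simp
next
  case False
  then have z: "\<tau> = -1" "[z ^ n = -1] (mod int p)" using \<tau> by auto
  have "\<not> int p dvd z"
  proof
    assume "int p dvd z"
    then have "int p dvd z ^ n" using n by (simp add: dvd_power_le dvd_trans[OF _ dvd_power])
    then have "int p dvd -1" using z(2) cong_dvd_iff by blast
    then show False using p by simp
  qed
  then have "\<exists>i<n. \<not> int p dvd (z \<cdot>\<^sub>v unit_vec n 0) $ i" using n by (intro exI[of _ 0]) simp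
  then obtain k where k: "cong_vec n (int p) (z \<cdot>\<^sub>v unit_vec n 0) (C ^\<^sub>m k *\<^sub>v unit_vec n 0)"
    using orbit[of "z \<cdot>\<^sub>v unit_vec n 0"] by auto
  define Z where "Z = z \<cdot>\<^sub>m 1\<^sub>m n"
  have Zc: "Z \<in> carrier_mat n n" by (simp add: Z_def)
  have ZA: "Z * A = z \<cdot>\<^sub>m A" "A * Z = z \<cdot>\<^sub>m A" if "A \<in> carrier_mat n n" for A
    using that mult_smult_assoc_mat[OF one_carrier_mat that, of z] mult_smult_distrib[OF that one_carrier_mat, of z]
    by (auto simp: Z_def)
  have "Z *\<^sub>v unit_vec n 0 = z \<cdot>\<^sub>v unit_vec n 0"
    by (rule eq_vecI) (auto simp: Z_def n)
  then have "cong_mat n (int p) Z (C ^\<^sub>m k)"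
  proof (intro cong_if_agree_on_e0[OF Zc C_pow_carrier])
    show "cong_mat n (int p) (Z * C) (C * Z)" using ZA[OF C] by simp
    have "C ^\<^sub>m k * C = C * C ^\<^sub>m k" using pow_mat_add[OF C, of 1 k] pow_mat_add[OF C, of k 1] C by simp
    then show "cong_mat n (int p) (C ^\<^sub>m k * C) (C * C ^\<^sub>m k)" by simp
  qed (use k in simp)
  then have "[det Z = det (C ^\<^sub>m k)] (mod int p)" by (rule cong_mat_det[OF Zc C_pow_carrier])
  moreover have "det Z = z ^ n" by (simp add: Z_def)
  ultimately have "[det (C ^\<^sub>m k) = -1] (mod int p)" using z(2) by (metis cong_sym cong_trans)
  then show ?thesis using z(1) by blast
qed

lemma det_C_fermat: "[det C ^ (p - 1) = 1] (mod int p)"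
proof -
  have "[det (C ^\<^sub>m N) = det (1\<^sub>m n)] (mod int p)" by (rule cong_mat_det[OF C_pow_carrier one_carrier_mat C_N])
  then have DN: "[det C ^ N = 1] (mod int p)" by (simp add: det_pow_mat[OF C])
  have nd: "\<not> int p dvd det C"
  proof
    assume "int p dvd det C"
    then have "int p dvd det C ^ N" using N_pos by (simp add: dvd_trans[OF _ dvd_power])
    then have "int p dvd 1" using DN cong_dvd_iff by blast
    then show False using p by simp
  qed
  define a where "a = nat (det C mod int p)"
  have p0: "int p > 0" using p prime_gt_0_nat by simp
  have a: "int a = det C mod int p" using p0 by (simp add: a_def)
  have "\<not> p dvd a"
  proof
    assume "p dvd a"
    then have "int p dvd det C mod int p" unfolding a[symmetric] by simp
    then show False using nd by (simp add: dvd_mod_iff)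
  qed
  then have "[a ^ (p - 1) = 1] (mod p)" using fermat_theorem p by blast
  then have "[int (a ^ (p - 1)) = int 1] (mod int p)" by (simp only: cong_int_iff)
  then have "[int a ^ (p - 1) = 1] (mod int p)" by simp
  moreover have "[det C ^ (p - 1) = int a ^ (p - 1)] (mod int p)"
    by (rule cong_pow) (simp add: a cong_def)
  ultimately show ?thesis using cong_trans by blast
qed

text \<open>Raising the exponent by \<open>p - 1\<close> does not change the determinant of a power of \<open>C\<close>. So the exponents with
  determinant \<open>\<tau>\<close> contain an arithmetic progression modulo \<open>N\<close> with \<open>h = N / (p - 1)\<close> terms. For each \<open>d\<close> with
  \<open>1 \<le> d < n\<close>, the number of terms that violate genericity is at most \<open>e * gcd h (p ^ d - 1)\<close>. This is at most
  \<open>h / (2 * n)\<close>: for \<open>d < n - 1\<close> because \<open>h \<ge> p ^ (n - 1)\<close>; for \<open>d = n - 1\<close> because modulo a common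
  divisor \<open>g\<close> of \<open>h\<close> and \<open>p ^ (n - 1) - 1\<close> one has \<open>p ^ n = 1\<close>, hence \<open>p = 1\<close> and \<open>h = n\<close>, so that \<open>g\<close> divides \<open>n\<close>.\<close>

lemma good_exponents_bound:
  assumes \<tau>: "\<tau> = 1 \<or> \<tau> = -1 \<and> [z ^ n = -1] (mod int p)"
    and e: "e > 0" and big: "2 * n ^ 2 * e \<le> p"
  shows "N \<le> 2 * (p - 1) * card (good_exponents e \<tau>)"
proof -
  have p1: "p > 1" using p prime_gt_1_nat by blast
  define h where "h = (\<Sum>i<n. p ^ i)"
  have hN: "(p - 1) * h = N" using geometric_sum_nat[of p n] N by (simp add: h_def)
  have h_ge: "h \<ge> p ^ (n - 1)" unfolding h_def using n by (intro member_le_sum) auto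
  have h0: "h > 0" using hN N_pos by (cases h) auto
  obtain k0 where k0: "[det (C ^\<^sub>m k0) = \<tau>] (mod int p)" using ex_exponent_of_det[OF \<tau>] by blast
  define ex where "ex i = (k0 + (p - 1) * i) mod N" for i
  define Bad where "Bad d = {i. i < h \<and> (p - 1) * h dvd (k0 + (p - 1) * i) * (e * (p ^ d - 1))}" for d
  \<comment> \<open>The bound \<open>e * gcd h (p ^ d - 1) \<le> h / (2 * n)\<close>, written without division.\<close>
  have gcd_bound: "gcd h (p ^ d - 1) * (2 * n * e) \<le> h" if d: "d \<in> {1..<n}" for d
  proof (cases "d = n - 1")
    case True
    define g where "g = gcd h (p ^ d - 1)"
    have "g dvd p ^ d - 1" by (simp add: g_def)
    then have pd: "[p ^ d = 1] (mod g)" using p1 by (simp add: cong_altdef_nat)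
    have "g dvd p ^ n - 1"
      using hN N by (metis dvd_mult dvd_triv_left g_def gcd_dvd1 diff_Suc_1)
    then have pn: "[p ^ n = 1] (mod g)" using p1 by (simp add: cong_altdef_nat)
    have "p ^ n = p * p ^ d" using True n by (cases n) auto
    then have "[p * 1 = 1] (mod g)" using pn cong_mult[OF cong_refl[of p] pd] by (metis cong_sym cong_trans)
    then have "[p = 1] (mod g)" by simp
    then have "[h = (\<Sum>i<n. 1)] (mod g)"
      unfolding h_def by (intro cong_sum) (metis cong_pow power_one)
    then have "[h = n] (mod g)" by simp
    moreover have "g dvd h" by (simp add: g_def)
    ultimately have "g dvd n" using cong_dvd_iff cong_sym by (metis cong_dvd_iff)
    have "[n = 0] (mod g)" using \<open>g dvd n\<close> by (simp add: cong_0_iff)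
    have "g \<le> n" using \<open>g dvd n\<close> n by (simp add: dvd_imp_le)
    then have "g * (2 * n * e) \<le> n * (2 * n * e)" by (rule mult_le_mono1)
    also have "\<dots> = 2 * n ^ 2 * e" by (simp add: power2_eq_square)
    also have "\<dots> \<le> p ^ 1" using big by simp
    also have "\<dots> \<le> p ^ (n - 1)" using d True p1 by (intro power_increasing) auto
    finally show ?thesis using h_ge by (simp add: g_def)
  next
    case False
    then have d2: "Suc d \<le> n - 1" using d by auto
    have "gcd h (p ^ d - 1) \<le> p ^ d - 1"
    proof (rule gcd_le2_nat)
      have "p ^ 1 \<le> p ^ d" using d p1 by (intro power_increasing) auto
      then show "p ^ d - 1 \<noteq> 0" using p1 by simp
    qed
    then have "gcd h (p ^ d - 1) \<le> p ^ d" by simp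
    moreover have "2 * n * e \<le> p"
    proof -
      have "n \<le> n ^ 2" using n by (simp add: power2_eq_square)
      then have "2 * n * e \<le> 2 * n ^ 2 * e" by (intro mult_le_mono le_refl)
      then show ?thesis using big by (rule le_trans)
    qed
    ultimately have "gcd h (p ^ d - 1) * (2 * n * e) \<le> p ^ d * p" by (rule mult_le_mono)
    also have "\<dots> = p ^ Suc d" by simp
    also have "\<dots> \<le> p ^ (n - 1)" using d2 p1 by (intro power_increasing) auto
    finally show ?thesis using h_ge by simp
  qed
  have bad: "card (Bad d) * (2 * n) \<le> h" if d: "d \<in> {1..<n}" for d
  proof -
    have "p ^ 1 \<le> p ^ d" using d p1 by (intro power_increasing) auto
    then have y: "e * (p ^ d - 1) > 0" using e p1 by simp
    have "card (Bad d) \<le> gcd h (e * (p ^ d - 1))"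
      unfolding Bad_def using p1 by (intro card_arithmetic_progression_dvd y h0) simp
    also have "gcd h (e * (p ^ d - 1)) dvd e * gcd h (p ^ d - 1)"
      by (simp add: gcd_mult_distrib_nat)
    then have "gcd h (e * (p ^ d - 1)) \<le> e * gcd h (p ^ d - 1)"
      using e h0 by (intro dvd_imp_le) auto
    finally have "card (Bad d) * (2 * n) \<le> gcd h (p ^ d - 1) * (2 * n * e)"
      by (simp add: mult_ac)
    then show ?thesis using gcd_bound[OF d] by linarith
  qed
  define Good where "Good = {..<h} - (\<Union>d\<in>{1..<n}. Bad d)"
  have "card (\<Union>d\<in>{1..<n}. Bad d) \<le> (\<Sum>d\<in>{1..<n}. card (Bad d))" by (rule card_UN_le) simp
  then have "card (\<Union>d\<in>{1..<n}. Bad d) * (2 * n) \<le> (\<Sum>d\<in>{1..<n}. card (Bad d) * (2 * n))"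
    unfolding sum_distrib_right[symmetric] by (rule mult_le_mono1)
  also have "\<dots> \<le> (\<Sum>d\<in>{1..<n}. h)" using bad by (rule sum_mono)
  also have "\<dots> \<le> n * h" by simp
  finally have badU: "2 * card (\<Union>d\<in>{1..<n}. Bad d) \<le> h" using n by (simp add: mult_ac)
  have "card Good \<ge> card {..<h} - card (\<Union>d\<in>{1..<n}. Bad d)"
    unfolding Good_def by (intro diff_card_le_card_Diff) (auto simp: Bad_def)
  then have good: "h \<le> 2 * card Good" using badU by simp
  have "inj_on ex Good"
  proof (rule inj_onI)
    fix i j assume ij: "i \<in> Good" "j \<in> Good" "ex i = ex j"
    then have "[k0 + (p - 1) * i = k0 + (p - 1) * j] (mod N)" by (simp add: ex_def cong_def)
    then have "[(p - 1) * i = (p - 1) * j] (mod N)" by (simp only: cong_add_lcancel_nat)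
    then have "(p - 1) * (i mod h) = (p - 1) * (j mod h)" unfolding mult_mod_right hN by (simp only: cong_def)
    then show "i = j" using ij p1 by (simp add: Good_def)
  qed
  moreover have "ex ` Good \<subseteq> good_exponents e \<tau>"
  proof
    fix k assume "k \<in> ex ` Good"
    then obtain i where i: "i \<in> Good" "k = ex i" by blast
    have "generic (k * e)"
      unfolding generic_def
    proof
      fix d assume d: "d \<in> {1..<n}"
      have "i \<notin> Bad d" "i < h" using i d by (auto simp: Good_def)
      then have "\<not> N dvd (k0 + (p - 1) * i) * (e * (p ^ d - 1))" unfolding Bad_def hN by blast
      then show "\<not> N dvd k * e * (p ^ d - 1)"
        unfolding i(2) ex_def by (simp add: dvd_eq_mod_eq_0 mod_mult_left_eq mult.assoc)
    qed
    moreover have "[det (C ^\<^sub>m k) = \<tau>] (mod int p)"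
    proof -
      have "[det (C ^\<^sub>m k) = det (C ^\<^sub>m (k0 + (p - 1) * i))] (mod int p)"
        unfolding i(2) ex_def by (rule cong_mat_det[OF C_pow_carrier C_pow_carrier C_pow_mod])
      also have "det (C ^\<^sub>m (k0 + (p - 1) * i)) = det (C ^\<^sub>m k0) * (det C ^ (p - 1)) ^ i"
        by (simp add: det_pow_mat[OF C] power_add power_mult)
      also have "[\<dots> = det (C ^\<^sub>m k0) * 1 ^ i] (mod int p)"
        by (intro cong_mult cong_refl cong_pow det_C_fermat)
      finally show ?thesis using k0 cong_trans by simp
    qed
    ultimately show "k \<in> good_exponents e \<tau>" using N_pos i by (simp add: good_exponents_def ex_def)
  qed
  ultimately have "card Good \<le> card (good_exponents e \<tau>)"
    by (intro card_inj_on_le[of ex]) (auto simp: good_exponents_def)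
  then have "h \<le> 2 * card (good_exponents e \<tau>)" using good by linarith
  then have "(p - 1) * h \<le> (p - 1) * (2 * card (good_exponents e \<tau>))" by (rule mult_le_mono2)
  then show ?thesis unfolding hN by (simp add: mult_ac)
qed

end

text \<open>Combine three counts: the good exponents are a proportion of at least \<open>1 / (2 * (p - 1))\<close>, each
  matrix is a conjugate at most \<open>n * N\<close> times, and the coset is at most the \<open>1 / (p - 1)\<close>-th part of the group.\<close>

theorem irreducible_density:
  assumes p: "prime p" and n: "n > 0" and e: "e > 0" and big: "2 * n ^ 2 * e \<le> p"
    and \<tau>: "\<tau> = 1 \<or> \<tau> = -1 \<and> [z ^ n = -1] (mod int p)"
  shows "card {A \<in> carrier (GL_mod n (int p)). [det A = \<tau>] (mod int p)} \<le>
    2 * n * card {A \<in> carrier (GL_mod n (int p)). [det A = \<tau>] (mod int p) \<and> \<not> reducible_mod n (int p) (A ^\<^sub>m e)}"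
proof -
  interpret S: singer p n by (unfold_locales) (use p n in auto)
  obtain C where C: "singer_matrix p n S.N C" using S.ex_singer_matrix ..
  interpret M: singer_matrix p n S.N C by (rule C)
  let ?D = "M.det_coset \<tau>"
  let ?Y = "{A \<in> ?D. \<not> reducible_mod n (int p) (A ^\<^sub>m e)}"
  let ?J = "M.good_exponents e \<tau>"
  have cop: "coprime \<tau> (int p)" using \<tau> by auto
  have "card ?D * S.N \<le> card ?D * (2 * (p - 1) * card ?J)"
    using M.good_exponents_bound[OF \<tau> e big] by (rule mult_le_mono2)
  also have "\<dots> = 2 * (((p - 1) * card ?D) * card ?J)" by (simp add: mult_ac)
  also have "\<dots> \<le> 2 * (card (carrier (GL_mod n (int p))) * card ?J)"
    by (intro mult_le_mono le_refl M.card_GL_ge[OF cop])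
  also have "\<dots> \<le> 2 * (n * S.N * card ?Y)" by (intro mult_le_mono le_refl M.count_conjugates)
  also have "\<dots> = (2 * n * card ?Y) * S.N" by (simp add: mult_ac)
  finally have "card ?D \<le> 2 * n * card ?Y" using S.N_pos by simp
  moreover have "?Y = {A \<in> carrier (GL_mod n (int p)). [det A = \<tau>] (mod int p) \<and> \<not> reducible_mod n (int p) (A ^\<^sub>m e)}"
    by (auto simp: M.det_coset_def)
  ultimately show ?thesis by (simp add: M.det_coset_def)
qed

section \<open>Irreducibility and determinants of automorphisms\<close>

text \<open>Euclid's argument, applied to the prime factors of \<open>(B!)\<^sup>n + 1\<close>.\<close>

lemma infinite_primes_with_root_of_minus_one:
  assumes n: "n > 0"
  shows "infinite {p::nat. prime p \<and> (\<exists>z. [z ^ n = -1] (mod int p))}"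
proof (rule ccontr)
  let ?A = "{p::nat. prime p \<and> (\<exists>z. [z ^ n = -1] (mod int p))}"
  assume "\<not> infinite ?A"
  then have "finite ?A" by simp
  then obtain B where B: "\<forall>p\<in>?A. p \<le> B" using finite_nat_set_iff_bounded_le[of ?A] by blast
  have "fact B ^ n + 1 \<noteq> (1::nat)" by simp
  then obtain p where p: "prime p" "p dvd fact B ^ n + (1::nat)" using prime_factor_nat by blast
  have "int p dvd int (fact B) ^ n + 1" using p(2) by (metis int_dvd_int_iff of_nat_1 of_nat_add of_nat_power)
  then have "[int (fact B) ^ n = -1] (mod int p)" by (simp add: cong_iff_dvd_diff)
  then have "p \<in> ?A" using p(1) by blast
  then have "p dvd fact B" using B p(1) prime_dvd_fact_iff by blast
  then have "p dvd fact B ^ n" using n by (simp add: dvd_trans[OF _ dvd_power])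
  then have "p dvd 1" using p(2) by (metis dvd_add_right_iff)
  then show False using p(1) by simp
qed

context based_free_group begin

lemma pow_AutF_apply:
  assumes "\<phi> \<in> carrier AutF" "x \<in> carrier F"
  shows "(\<phi> [^]\<^bsub>AutF\<^esub> (j::nat)) x = (\<phi> ^^ j) x"
  using assms(2)
proof (induction j arbitrary: x)
  case 0 then show ?case by (simp add: AutF_one)
next
  case (Suc j)
  interpret A: group AutF by (rule group_AutF)
  have "(\<phi> [^]\<^bsub>AutF\<^esub> Suc j) x = (\<phi> [^]\<^bsub>AutF\<^esub> j) (\<phi> x)"
    using Suc.prems assms(1) by (simp add: AutF_mult compose_def)
  also have "\<dots> = (\<phi> ^^ Suc j) x" using Suc AutF_closed[OF assms(1)] by (simp add: funpow_swap1)
  finally show ?case .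
qed

text \<open>If the classes of the factors are permuted transitively, then a positive power of \<open>\<phi>\<close> fixes the
  class of the first factor.\<close>

lemma strongly_irreducible_imp_irreducible:
  assumes \<phi>: "\<phi> \<in> carrier AutF" and strong: "strongly_irreducible_aut F \<phi>"
  shows "irreducible_aut F \<phi>"
  unfolding irreducible_aut_def
proof
  assume "\<exists>(r::nat) H. r \<ge> 1 \<and> (\<forall>i\<in>{1..r}. proper_free_factor F (H i)) \<and>
      permutes_transitively \<phi> (conjugacy_class F ` H ` {1..r}) \<and>
      (\<exists>P. is_free_product F {1..r} H P \<and> free_factor F P)"
  then obtain r :: nat and H where r: "r \<ge> 1" and H: "\<forall>i\<in>{1..r}. proper_free_factor F (H i)"
    and perm: "permutes_transitively \<phi> (conjugacy_class F ` H ` {1..r})" by blast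
  define C where "C = conjugacy_class F (H 1)"
  define S where "S = conjugacy_class F ` H ` {1..r}"
  have CS: "C \<in> S" using r by (auto simp: C_def S_def)
  have bij: "bij_betw (class_action \<phi>) S S" and trans: "\<forall>C\<in>S. \<forall>D\<in>S. \<exists>m::nat. (class_action \<phi> ^^ m) C = D"
    using perm by (auto simp: permutes_transitively_def S_def)
  have "class_action \<phi> C \<in> S" using bij CS by (auto simp: bij_betw_def)
  then obtain m where m: "(class_action \<phi> ^^ m) (class_action \<phi> C) = C" using trans CS by blast
  have pow: "(class_action \<phi> ^^ j) D = (\<lambda>H. (\<phi> ^^ j) ` H) ` D" for j D
    by (induction j) (auto simp: class_action_def image_image image_comp)
  have pff: "proper_free_factor F (H 1)" using H r by simp
  then obtain K where "is_free_product F UNIV (\<lambda>b::bool. if b then H 1 else K) (carrier F)"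
    unfolding proper_free_factor_def free_factor_def by blast
  then have "subgroup (H 1) F" unfolding is_free_product_def by (metis UNIV_I)
  then have H1: "H 1 \<subseteq> carrier F" by (rule subgroup.subset)
  have H1_eq: "(\<lambda>h. \<one> \<otimes> h \<otimes> inv \<one>) ` H 1 = H 1"
  proof -
    have "\<one> \<otimes> h \<otimes> inv \<one> = h" if "h \<in> H 1" for h using that H1 by auto
    then show ?thesis by simp
  qed
  have "H 1 \<in> C"
    unfolding C_def conjugacy_class_def
    by (rule CollectI, rule exI[of _ \<one>], rule conjI[OF H1_eq[symmetric] one_closed])
  then have "(\<phi> ^^ Suc m) ` H 1 \<in> (class_action \<phi> ^^ Suc m) C" unfolding pow by blast
  also have "(class_action \<phi> ^^ Suc m) C = C" using m by (simp add: funpow_swap1)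
  finally have "(\<phi> ^^ Suc m) ` H 1 \<in> C" .
  moreover have "(\<phi> [^]\<^bsub>AutF\<^esub> Suc m) ` H 1 = (\<phi> ^^ Suc m) ` H 1"
    using H1 pow_AutF_apply[OF \<phi>, of _ "Suc m"] by (intro image_cong) auto
  ultimately have "(\<phi> [^]\<^bsub>AutF\<^esub> Suc m) ` H 1 \<in> conjugacy_class F (H 1)" by (simp only: C_def)
  then have "\<exists>m::nat. m > 0 \<and> (\<exists>H. proper_free_factor F H \<and> (\<phi> [^]\<^bsub>AutF\<^esub> m) ` H \<in> conjugacy_class F H)"
    using pff by (intro exI[of _ "Suc m"] exI[of _ "H 1"] conjI zero_less_Suc)
  then show False using strong unfolding strongly_irreducible_aut_def by (rule notE[rotated])
qed

lemma aut_mat_inverse: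
  assumes "\<phi> \<in> carrier AutF"
  shows "aut_mat \<phi> * aut_mat (inv\<^bsub>AutF\<^esub> \<phi>) = 1\<^sub>m n" "aut_mat (inv\<^bsub>AutF\<^esub> \<phi>) * aut_mat \<phi> = 1\<^sub>m n"
proof -
  interpret A: group AutF by (rule group_AutF)
  show "aut_mat \<phi> * aut_mat (inv\<^bsub>AutF\<^esub> \<phi>) = 1\<^sub>m n" "aut_mat (inv\<^bsub>AutF\<^esub> \<phi>) * aut_mat \<phi> = 1\<^sub>m n"
    using aut_mat_mult[of \<phi> "inv\<^bsub>AutF\<^esub> \<phi>"] aut_mat_mult[of "inv\<^bsub>AutF\<^esub> \<phi>" \<phi>] assms
    by (auto simp: aut_mat_one)
qed

lemma aut_mat_inverse_mod:
  "\<phi> \<in> carrier AutF \<Longrightarrow> inverse_mod n m (aut_mat \<phi>) (aut_mat (inv\<^bsub>AutF\<^esub> \<phi>))"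
  using aut_mat_inverse by (simp add: inverse_mod_def)

lemma det_aut_mat:
  assumes "\<phi> \<in> carrier AutF" shows "det (aut_mat \<phi>) = 1 \<or> det (aut_mat \<phi>) = -1"
proof -
  have "det (aut_mat \<phi>) * det (aut_mat (inv\<^bsub>AutF\<^esub> \<phi>)) = 1"
    using det_mult[OF aut_mat_carrier aut_mat_carrier, of \<phi> "inv\<^bsub>AutF\<^esub> \<phi>"] aut_mat_inverse(1)[OF assms] by simp
  then show ?thesis using zmult_eq_1_iff by blast
qed

text \<open>Conjugation by a sign change inverts the transvection, so the commutator acts as its square. The even
  parameter is harmless modulo odd primes. Commutators are used because they are words of
  a length divisible by the order of the finite group, and so lie in \<open>return_subgroup\<close>.\<close>

lemma ex_commutator_transvection:
  assumes kl: "k < n" "l < n" "k \<noteq> l"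
  shows "\<exists>\<sigma>\<in>carrier AutF. \<exists>\<iota>\<in>carrier AutF.
    aut_mat (\<sigma> \<otimes>\<^bsub>AutF\<^esub> \<iota> \<otimes>\<^bsub>AutF\<^esub> inv\<^bsub>AutF\<^esub> \<sigma> \<otimes>\<^bsub>AutF\<^esub> inv\<^bsub>AutF\<^esub> \<iota>) = addrow_mat n (2 * c) k l"
proof -
  interpret A: group AutF by (rule group_AutF)
  define E where "E a = addrow_mat n a k l" for a :: int
  define D where "D = multrow_mat n k (-1 :: int)"
  have E: "E a \<in> carrier_mat n n" for a by (simp add: E_def)
  have D: "D \<in> carrier_mat n n" by (simp add: D_def)
  obtain \<sigma> where \<sigma>: "\<sigma> \<in> carrier AutF" "aut_mat \<sigma> = E c"
    using ex_transvection[of l k c] kl by (auto simp: E_def)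
  obtain \<iota> where \<iota>: "\<iota> \<in> carrier AutF" "aut_mat \<iota> = mat n n (\<lambda>(i, j). if i = j then if i = k then -1 else 1 else 0)"
    using ex_sign_change[OF kl(1)] by blast
  have \<iota>D: "aut_mat \<iota> = D" unfolding \<iota>(2) D_def by (rule eq_matI) auto
  have E_mult: "E a * M = addrow a k l M" if "M \<in> carrier_mat n n" for a M
    unfolding E_def by (rule addrow_mat[OF that kl(2), symmetric])
  have D_mult: "D * M = multrow k (-1) M" if "M \<in> carrier_mat n n" for M
    unfolding D_def by (rule multrow_mat[OF that, symmetric])
  have EE: "E a * E a' = E (a + a')" for a a'
    unfolding E_mult[OF E] using kl by (intro eq_matI) (auto simp: E_def)
  have E0: "E 0 = 1\<^sub>m n" unfolding E_def by (rule eq_matI) auto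
  have DD: "D * D = 1\<^sub>m n"
    unfolding D_mult[OF D] by (rule eq_matI) (auto simp: D_def)
  have DE: "D * E (- a) = E a * D" for a
    unfolding D_mult[OF E] E_mult[OF D] using kl by (intro eq_matI) (auto simp: D_def E_def)
  \<comment> \<open>Uniqueness of inverses, to identify the matrices of \<open>inv \<sigma>\<close> and \<open>inv \<iota>\<close>.\<close>
  have inv_unique: "Y = Z" if "Y * M = 1\<^sub>m n" "M * Z = 1\<^sub>m n" "M \<in> carrier_mat n n" "Y \<in> carrier_mat n n" "Z \<in> carrier_mat n n"
    for M Y Z :: "int mat"
    using assoc_mult_mat[OF that(4,3,5)] that by simp
  have \<sigma>': "aut_mat (inv\<^bsub>AutF\<^esub> \<sigma>) = E (- c)"
    using inv_unique[OF aut_mat_inverse(2)[OF \<sigma>(1)], of "E (- c)"] \<sigma>(2) EE[of c "- c"] E0 E by simp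
  have \<iota>': "aut_mat (inv\<^bsub>AutF\<^esub> \<iota>) = D"
    using inv_unique[OF aut_mat_inverse(2)[OF \<iota>(1)], of D] \<iota>D DD D by simp
  have "aut_mat (\<sigma> \<otimes>\<^bsub>AutF\<^esub> \<iota> \<otimes>\<^bsub>AutF\<^esub> inv\<^bsub>AutF\<^esub> \<sigma> \<otimes>\<^bsub>AutF\<^esub> inv\<^bsub>AutF\<^esub> \<iota>) = E c * D * E (- c) * D"
    using \<sigma> \<iota> \<iota>D \<sigma>' \<iota>' by (simp add: aut_mat_mult)
  also have "E c * D * E (- c) = E c * (E c * D)" using DE[of c] assoc_mult_mat[OF E D E] by simp
  also have "E c * (E c * D) * D = (E c * E c) * (D * D)"
    using E D assoc_mult_mat[OF E E D] assoc_mult_mat[OF mult_carrier_mat[OF E E] D D] by simp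
  also have "\<dots> = E (2 * c)" unfolding EE DD right_mult_one_mat[OF E] by simp
  finally show ?thesis using \<sigma> \<iota> unfolding E_def by blast
qed

end

section \<open>Random products of automorphisms\<close>

text \<open>The walk induced on the product of the groups \<open>GL\<^sub>n(\<int>/p)\<close> for a finite set \<open>S\<close> of odd primes.\<close>

locale random_automorphism = based_free_group +
  fixes k :: nat and f :: "nat \<Rightarrow> 'a \<Rightarrow> 'a" and S :: "nat set"
  assumes k1: "k \<ge> 1" and f: "f ` {1..k} \<subseteq> carrier AutF" and gen: "generate AutF (f ` {1..k}) = carrier AutF"
    and finS: "finite S" and primeS: "\<And>p. p \<in> S \<Longrightarrow> prime p" and oddS: "\<And>p. p \<in> S \<Longrightarrow> p > 2"
begin

definition \<G> :: "(nat \<Rightarrow> int mat) monoid" where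
  "\<G> = product_group S (\<lambda>p. GL_mod n (int p))"

definition \<rho> :: "('a \<Rightarrow> 'a) \<Rightarrow> nat \<Rightarrow> int mat" where
  "\<rho> \<phi> = (\<lambda>p\<in>S. reduce_mat n (int p) (aut_mat \<phi>))"

lemma group_\<G>: "group \<G>"
  unfolding \<G>_def by (rule product_group) (rule group_GL_mod)

lemma carrier_\<G>: "carrier \<G> = (\<Pi>\<^sub>E p\<in>S. carrier (GL_mod n (int p)))"
  by (simp add: \<G>_def)

lemma mult_\<G>: "p \<in> S \<Longrightarrow> (x \<otimes>\<^bsub>\<G>\<^esub> y) p = reduce_mat n (int p) (x p * y p)"
  by (simp add: \<G>_def)

lemma one_\<G>: "p \<in> S \<Longrightarrow> \<one>\<^bsub>\<G>\<^esub> p = reduce_mat n (int p) (1\<^sub>m n)"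
  by (simp add: \<G>_def)

lemma finite_\<G>: "finite (carrier \<G>)"
  unfolding carrier_\<G> using finS primeS prime_gt_0_nat by (intro finite_PiE finite_GL_mod) auto

lemma \<rho>_closed: "\<phi> \<in> carrier AutF \<Longrightarrow> \<rho> \<phi> \<in> carrier \<G>"
  unfolding carrier_\<G> \<rho>_def using reduce_mat_in_GL[OF aut_mat_carrier aut_mat_inverse_mod] by auto

lemma \<rho>_hom: "group_hom AutF \<G> \<rho>"
proof (intro group_hom.intro group_AutF group_\<G> group_hom_axioms.intro homI)
  show "\<rho> (\<phi> \<otimes>\<^bsub>AutF\<^esub> \<psi>) = \<rho> \<phi> \<otimes>\<^bsub>\<G>\<^esub> \<rho> \<psi>" if "\<phi> \<in> carrier AutF" "\<psi> \<in> carrier AutF" for \<phi> \<psi>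
    using aut_mat_mult[OF that] GL_mod_mult_eq[OF aut_mat_carrier aut_mat_carrier]
    by (auto simp: \<rho>_def \<G>_def intro!: restrict_ext)
qed (rule \<rho>_closed)

sublocale H: group_hom AutF \<G> \<rho> by (rule \<rho>_hom)

sublocale W: finite_walk \<G> k "\<lambda>i. \<rho> (f i)"
  using finite_\<G> k1 f \<rho>_closed by unfold_locales auto

lemma \<rho>_words:
  assumes "\<phi> \<in> carrier AutF" shows "\<rho> \<phi> \<in> W.words"
proof -
  have "\<rho> ` carrier AutF = generate \<G> (\<rho> ` (f ` {1..k}))"
    using H.generate_img[OF f] gen by simp
  also have "\<rho> ` (f ` {1..k}) = (\<lambda>i. \<rho> (f i)) ` {1..k}" by (rule image_image)
  finally show ?thesis using W.generate_subset_words assms by blast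
qed

lemma \<rho>_commutator:
  assumes "\<sigma> \<in> carrier AutF" "\<iota> \<in> carrier AutF"
  shows "\<rho> (\<sigma> \<otimes>\<^bsub>AutF\<^esub> \<iota> \<otimes>\<^bsub>AutF\<^esub> inv\<^bsub>AutF\<^esub> \<sigma> \<otimes>\<^bsub>AutF\<^esub> inv\<^bsub>AutF\<^esub> \<iota>) \<in> W.return_subgroup"
  using W.commutator_in_return_subgroup[OF \<rho>_words[OF assms(1)] \<rho>_words[OF assms(2)]] assms by simp

lemma \<rho>_word: "set is \<subseteq> {1..k} \<Longrightarrow>
    word_prod AutF (map f is) \<in> carrier AutF \<and> \<rho> (word_prod AutF (map f is)) = W.word_val is"
proof (induction "is")
  case Nil then show ?case by (simp add: word_prod_def)
next
  case (Cons i "is")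
  then have "f i \<in> carrier AutF" using f by auto
  with Cons show ?case by (simp add: word_prod_def)
qed

text \<open>The factor \<open>SL\<^sub>n(\<int>/p)\<close> at the prime \<open>p\<close>.\<close>

definition special :: "nat \<Rightarrow> (nat \<Rightarrow> int mat) set" where
  "special p = {u \<in> carrier \<G>. (\<forall>q\<in>S. q \<noteq> p \<longrightarrow> u q = \<one>\<^bsub>\<G>\<^esub> q) \<and> [det (u p) = 1] (mod int p)}"

lemma \<G>_coord: "x \<in> carrier \<G> \<Longrightarrow> p \<in> S \<Longrightarrow> x p \<in> carrier (GL_mod n (int p))"
  by (auto simp: carrier_\<G>)

lemma \<G>_coord_mat: "x \<in> carrier \<G> \<Longrightarrow> p \<in> S \<Longrightarrow> x p \<in> carrier_mat n n \<and> reduce_mat n (int p) (x p) = x p"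
  using \<G>_coord by (auto simp: GL_mod_carrier)

lemma det_mult_\<G>:
  assumes "x \<in> carrier \<G>" "y \<in> carrier \<G>" "p \<in> S"
  shows "[det ((x \<otimes>\<^bsub>\<G>\<^esub> y) p) = det (x p) * det (y p)] (mod int p)"
proof -
  have c: "x p \<in> carrier_mat n n" "y p \<in> carrier_mat n n" using \<G>_coord_mat assms by auto
  show ?thesis unfolding mult_\<G>[OF assms(3)] det_mult[OF c, symmetric]
    by (rule cong_mat_det[OF reduce_mat_carrier _ reduce_mat_cong]) (use c in simp)
qed

lemma mult_one_coord:
  assumes "x \<in> carrier \<G>" "q \<in> S" "y q = \<one>\<^bsub>\<G>\<^esub> q"
  shows "(x \<otimes>\<^bsub>\<G>\<^esub> y) q = x q"
proof -
  have "(x \<otimes>\<^bsub>\<G>\<^esub> y) q = (x \<otimes>\<^bsub>\<G>\<^esub> \<one>\<^bsub>\<G>\<^esub>) q" by (simp only: mult_\<G>[OF assms(2)] assms(3))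
  also have "x \<otimes>\<^bsub>\<G>\<^esub> \<one>\<^bsub>\<G>\<^esub> = x" by (rule H.H.r_one[OF assms(1)])
  finally show ?thesis .
qed

lemma subgroup_special:
  assumes p: "p \<in> S" shows "subgroup (special p) \<G>"
proof -
  have m1: "x \<otimes>\<^bsub>\<G>\<^esub> y \<in> special p" if "x \<in> special p" "y \<in> special p" for x y
  proof -
    have xy: "x \<in> carrier \<G>" "y \<in> carrier \<G>" using that by (auto simp: special_def)
    have "(x \<otimes>\<^bsub>\<G>\<^esub> y) q = \<one>\<^bsub>\<G>\<^esub> q" if q: "q \<in> S" "q \<noteq> p" for q
      using mult_one_coord[OF xy(1) q(1)] q \<open>x \<in> special p\<close> \<open>y \<in> special p\<close> by (simp add: special_def)
    moreover have "[det (x p) * det (y p) = 1 * 1] (mod int p)" using that by (intro cong_mult) (auto simp: special_def)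
    then have "[det ((x \<otimes>\<^bsub>\<G>\<^esub> y) p) = 1] (mod int p)" using det_mult_\<G>[OF xy p] cong_trans by fastforce
    ultimately show ?thesis using xy by (simp add: special_def)
  qed
  have one: "\<one>\<^bsub>\<G>\<^esub> \<in> special p"
  proof -
    have "[det (reduce_mat n (int p) (1\<^sub>m n)) = det (1\<^sub>m n)] (mod int p)"
      by (rule cong_mat_det[OF reduce_mat_carrier one_carrier_mat reduce_mat_cong])
    then show ?thesis by (simp add: special_def one_\<G>[OF p])
  qed
  show ?thesis
  proof (rule subgroup.intro)
    fix x assume x: "x \<in> special p"
    then have "x \<in> carrier \<G>" by (simp add: special_def)
    then show "inv\<^bsub>\<G>\<^esub> x \<in> special p"
      using W.inv_eq_pow W.pow_in_set[of "special p" x] one m1 x by simp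
  qed (use m1 one in \<open>auto simp: special_def\<close>)
qed

text \<open>By the Chinese remainder theorem there is a transvection with an even parameter that has a prescribed
  residue modulo \<open>p\<close> and is trivial modulo the other primes of \<open>S\<close>; by \<open>ex_commutator_transvection\<close> it is the
  image of a commutator.\<close>

lemma elementary_in_return_subgroup:
  assumes p: "p \<in> S" and P: "P \<in> elementary_products n"
  shows "\<exists>g\<in>W.return_subgroup. g p = reduce_mat n (int p) P \<and> (\<forall>q\<in>S. q \<noteq> p \<longrightarrow> g q = \<one>\<^bsub>\<G>\<^esub> q)"
  using P
proof induction
  case one
  show ?case using W.one_in_return_subgroup one_\<G>[OF p] by (intro bexI[of _ "\<one>\<^bsub>\<G>\<^esub>"]) auto
next
  case (step P k l a)
  then obtain g where g: "g \<in> W.return_subgroup" "g p = reduce_mat n (int p) P"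
    "\<forall>q\<in>S. q \<noteq> p \<longrightarrow> g q = \<one>\<^bsub>\<G>\<^esub> q" by blast
  have Pc: "P \<in> carrier_mat n n" by (rule elementary_products_carrier[OF step.hyps(1)])
  \<comment> \<open>The parameter \<open>2 * c\<close> below vanishes modulo the other primes and is congruent to \<open>a\<close> modulo \<open>p\<close>.\<close>
  define M where "M = (\<Prod>q\<in>S - {p}. int q)"
  have "coprime (int q) (int p)" if "q \<in> S - {p}" for q
    using that p primeS by (simp add: primes_coprime)
  then have "coprime M (int p)" unfolding M_def by (intro prod_coprime_left) auto
  moreover have "coprime (2::int) (int p)"
    using prime_odd_nat[OF primeS[OF p] oddS[OF p]] by simp
  ultimately have "coprime (2 * M) (int p)" by simp
  then obtain y where y: "[2 * M * y = 1] (mod int p)" using cong_solve_coprime_int by blast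
  define c where "c = M * y * a"
  have c_p: "[2 * c = a] (mod int p)"
    using cong_mult[OF y cong_refl[of a]] by (simp add: c_def mult_ac)
  have c_q: "[2 * c = 0] (mod int q)" if "q \<in> S" "q \<noteq> p" for q
  proof -
    have "int q dvd M" unfolding M_def using that finS by (intro dvd_prodI) auto
    then show ?thesis by (simp add: c_def cong_0_iff)
  qed
  obtain \<sigma> \<iota> where st: "\<sigma> \<in> carrier AutF" "\<iota> \<in> carrier AutF"
    "aut_mat (\<sigma> \<otimes>\<^bsub>AutF\<^esub> \<iota> \<otimes>\<^bsub>AutF\<^esub> inv\<^bsub>AutF\<^esub> \<sigma> \<otimes>\<^bsub>AutF\<^esub> inv\<^bsub>AutF\<^esub> \<iota>) = addrow_mat n (2 * c) k l"
    using ex_commutator_transvection[OF step.hyps(2-4)] by blast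
  define r where "r = \<rho> (\<sigma> \<otimes>\<^bsub>AutF\<^esub> \<iota> \<otimes>\<^bsub>AutF\<^esub> inv\<^bsub>AutF\<^esub> \<sigma> \<otimes>\<^bsub>AutF\<^esub> inv\<^bsub>AutF\<^esub> \<iota>)"
  have rN: "r \<in> W.return_subgroup" unfolding r_def by (rule \<rho>_commutator[OF st(1,2)])
  have r: "r q = reduce_mat n (int q) (addrow_mat n (2 * c) k l)" if "q \<in> S" for q
    using that st(3) by (simp add: r_def \<rho>_def)
  have rc: "r \<in> carrier \<G>" using rN W.return_subgroup_subset by blast
  have "(r \<otimes>\<^bsub>\<G>\<^esub> g) p = reduce_mat n (int p) (addrow_mat n a k l * P)"
  proof -
    have "(r \<otimes>\<^bsub>\<G>\<^esub> g) p = reduce_mat n (int p) (addrow_mat n (2 * c) k l * P)"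
      using GL_mod_mult_eq[OF addrow_mat_carrier Pc] by (simp add: mult_\<G>[OF p] r[OF p] g(2))
    also have "\<dots> = reduce_mat n (int p) (addrow_mat n a k l * P)"
      unfolding reduce_mat_eq_iff
    proof (rule cong_mat_mult[OF addrow_mat_carrier addrow_mat_carrier Pc Pc _ cong_mat_refl])
      show "cong_mat n (int p) (addrow_mat n (2 * c) k l) (addrow_mat n a k l)"
        using c_p by (auto simp: cong_mat_def intro!: cong_add)
    qed
    finally show ?thesis .
  qed
  moreover have "(r \<otimes>\<^bsub>\<G>\<^esub> g) q = \<one>\<^bsub>\<G>\<^esub> q" if q: "q \<in> S" "q \<noteq> p" for q
  proof -
    have "cong_mat n (int q) (addrow_mat n (2 * c) k l) (1\<^sub>m n)"
      using c_q[OF q] step.hyps(4) by (auto simp: cong_mat_def)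
    then show ?thesis using mult_one_coord[OF rc q(1)] g(3) q r[OF q(1)] one_\<G>[OF q(1)]
      by (simp add: reduce_mat_eq_iff)
  qed
  ultimately show ?case using W.return_subgroup_mult[OF rN g(1)] by blast
qed

lemma special_subset_return_subgroup:
  assumes p: "p \<in> S" shows "special p \<subseteq> W.return_subgroup"
proof
  fix u assume u: "u \<in> special p"
  then have uc: "u \<in> carrier \<G>" by (simp add: special_def)
  obtain P where P: "P \<in> elementary_products n" "cong_mat n (int p) (u p) P"
    using det_one_imp_elementary_product[of "int p" "u p" n] \<G>_coord_mat[OF uc p] u primeS[OF p]
    by (auto simp: special_def)
  obtain g where g: "g \<in> W.return_subgroup" "g p = reduce_mat n (int p) P"
    "\<forall>q\<in>S. q \<noteq> p \<longrightarrow> g q = \<one>\<^bsub>\<G>\<^esub> q" using elementary_in_return_subgroup[OF p P(1)] by blast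
  have gc: "g \<in> carrier \<G>" using g(1) W.return_subgroup_subset by blast
  have "u = g"
  proof (rule PiE_ext[OF uc[unfolded carrier_\<G>] gc[unfolded carrier_\<G>]])
    fix q assume q: "q \<in> S"
    show "u q = g q"
    proof (cases "q = p")
      case True
      have "u p = reduce_mat n (int p) (u p)" using \<G>_coord_mat[OF uc p] by simp
      also have "\<dots> = reduce_mat n (int p) P" using P(2) by (simp add: reduce_mat_eq_iff)
      finally show ?thesis using True g(2) by simp
    next
      case False then show ?thesis using u g(3) q by (simp add: special_def)
    qed
  qed
  then show "u \<in> W.return_subgroup" using g(1) by simp
qed

text \<open>The condition modulo \<open>p\<close> that is forced on words that are not strongly irreducible. The determinant
  is part of it because the density of irreducible matrices is controlled in these two cosets only.\<close>

definition bad_at :: "nat \<Rightarrow> nat \<Rightarrow> (nat \<Rightarrow> int mat) set" where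
  "bad_at e p = {g. ([det (g p) = 1] (mod int p) \<or> [det (g p) = -1] (mod int p)) \<and>
     reducible_mod n (int p) (g p ^\<^sub>m e)}"

text \<open>The \<open>p\<close>-coordinate maps the coset \<open>t \<otimes> special p\<close> bijectively to the matrices whose determinant is that
  of \<open>t p\<close>. If this is not \<open>\<plusminus>1\<close>, nothing is bad; otherwise \<open>irreducible_density\<close> applies.\<close>

lemma bad_density:
  assumes p: "p \<in> S" and n: "n > 0" and e: "e > 0" and big: "2 * n ^ 2 * e \<le> p"
    and z: "[z ^ n = -1] (mod int p)" and t: "t \<in> carrier \<G>"
  shows "real (card {u \<in> special p. t \<otimes>\<^bsub>\<G>\<^esub> u \<in> bad_at e p}) \<le> (1 - 1 / (2 * real n)) * real (card (special p))"
proof (cases "[det (t p) = 1] (mod int p) \<or> [det (t p) = -1] (mod int p)")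
  case False
  have "{u \<in> special p. t \<otimes>\<^bsub>\<G>\<^esub> u \<in> bad_at e p} = {}"
  proof (rule ccontr)
    assume "\<not> ?thesis"
    then obtain u where u: "u \<in> special p" "t \<otimes>\<^bsub>\<G>\<^esub> u \<in> bad_at e p" by blast
    have uc: "u \<in> carrier \<G>" "[det (u p) = 1] (mod int p)" using u by (auto simp: special_def)
    have "[det (t p) * det (u p) = det (t p) * 1] (mod int p)" using uc(2) by (intro cong_mult cong_refl)
    then have "[det ((t \<otimes>\<^bsub>\<G>\<^esub> u) p) = det (t p)] (mod int p)"
      using det_mult_\<G>[OF t uc(1) p] cong_trans by fastforce
    then show False using u(2) False unfolding bad_at_def by (metis (mono_tags, lifting) cong_sym cong_trans mem_Collect_eq)
  qed
  then show ?thesis using n by (simp only: card.empty) (simp add: divide_simps)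
next
  case True
  interpret Gp: group "GL_mod n (int p)" by (rule group_GL_mod)
  define \<tau> :: int where "\<tau> = (if [det (t p) = 1] (mod int p) then 1 else -1)"
  have \<tau>: "[det (t p) = \<tau>] (mod int p)" using True by (auto simp: \<tau>_def)
  have \<tau>': "\<tau> = 1 \<or> \<tau> = -1 \<and> [z ^ n = -1] (mod int p)" using z by (auto simp: \<tau>_def)
  define D where "D = {A \<in> carrier (GL_mod n (int p)). [det A = \<tau>] (mod int p)}"
  define m where "m u = t p \<otimes>\<^bsub>GL_mod n (int p)\<^esub> u p" for u :: "nat \<Rightarrow> int mat"
  have tp: "t p \<in> carrier (GL_mod n (int p))" using \<G>_coord[OF t p] .
  have m_eq: "m u = (t \<otimes>\<^bsub>\<G>\<^esub> u) p" for u by (simp add: m_def mult_\<G>[OF p])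
  have tpc: "t p \<in> carrier_mat n n" using tp by (simp add: GL_mod_carrier)
  obtain s where s: "inverse_mod n (int p) (t p) s" using tp unfolding GL_mod_carrier by blast
  have det_m: "[det (reduce_mat n (int p) (t p * A)) = det (t p) * det A] (mod int p)" if "A \<in> carrier_mat n n" for A
    unfolding det_mult[OF tpc that, symmetric]
    by (rule cong_mat_det[OF reduce_mat_carrier _ reduce_mat_cong]) (use tpc that in simp)
  have bij: "bij_betw m (special p) D"
  proof (rule bij_betwI[where g = "\<lambda>A. \<lambda>q\<in>S. if q = p then inv\<^bsub>GL_mod n (int p)\<^esub> (t p) \<otimes>\<^bsub>GL_mod n (int p)\<^esub> A else \<one>\<^bsub>\<G>\<^esub> q"])
    show "m \<in> special p \<rightarrow> D"
    proof
      fix u assume u: "u \<in> special p"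
      then have uc: "u \<in> carrier \<G>" "[det (u p) = 1] (mod int p)" by (auto simp: special_def)
      have up: "u p \<in> carrier (GL_mod n (int p))" using \<G>_coord[OF uc(1) p] .
      have "[det (t p) * det (u p) = \<tau> * 1] (mod int p)" using uc(2) \<tau> by (intro cong_mult)
      then have "[det ((t \<otimes>\<^bsub>\<G>\<^esub> u) p) = \<tau>] (mod int p)"
        using det_mult_\<G>[OF t uc(1) p] cong_trans by fastforce
      moreover have "m u \<in> carrier (GL_mod n (int p))" unfolding m_def by (rule Gp.m_closed[OF tp up])
      ultimately show "m u \<in> D" by (simp add: D_def m_eq)
    qed
    show "(\<lambda>A. \<lambda>q\<in>S. if q = p then inv\<^bsub>GL_mod n (int p)\<^esub> (t p) \<otimes>\<^bsub>GL_mod n (int p)\<^esub> A else \<one>\<^bsub>\<G>\<^esub> q) \<in> D \<rightarrow> special p"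
    proof
      fix A assume A: "A \<in> D"
      then have Ac: "A \<in> carrier (GL_mod n (int p))" "[det A = \<tau>] (mod int p)" by (auto simp: D_def)
      define B where "B = inv\<^bsub>GL_mod n (int p)\<^esub> (t p) \<otimes>\<^bsub>GL_mod n (int p)\<^esub> A"
      have B: "B \<in> carrier (GL_mod n (int p))" unfolding B_def using tp Ac(1) by (intro Gp.m_closed Gp.inv_closed)
      have Bc: "B \<in> carrier_mat n n" using B by (simp add: GL_mod_carrier)
      have "t p \<otimes>\<^bsub>GL_mod n (int p)\<^esub> B = A"
        unfolding B_def using tp Ac(1) by (simp add: Gp.m_assoc[symmetric] del: GL_mod_mult GL_mod_one)
      then have "reduce_mat n (int p) (t p * B) = A" by simp
      then have "[det A = det (t p) * det B] (mod int p)" using det_m[OF Bc] by simp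
      then have "[det (t p) * det B = det (t p) * 1] (mod int p)"
        using Ac(2) \<tau> by (metis cong_sym cong_trans mult.right_neutral)
      then have "[det B = 1] (mod int p)" using cong_mult_lcancel[OF det_inverse_mod[OF tpc s]] by blast
      moreover have "\<one>\<^bsub>\<G>\<^esub> q \<in> carrier (GL_mod n (int q))" if "q \<in> S" for q
        using \<G>_coord[OF H.H.one_closed that] .
      ultimately show "(\<lambda>q\<in>S. if q = p then inv\<^bsub>GL_mod n (int p)\<^esub> (t p) \<otimes>\<^bsub>GL_mod n (int p)\<^esub> A else \<one>\<^bsub>\<G>\<^esub> q) \<in> special p"
        using B p unfolding B_def[symmetric] by (auto simp: special_def carrier_\<G>)
    qed
    show "(\<lambda>q\<in>S. if q = p then inv\<^bsub>GL_mod n (int p)\<^esub> (t p) \<otimes>\<^bsub>GL_mod n (int p)\<^esub> m u else \<one>\<^bsub>\<G>\<^esub> q) = u"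
      if u: "u \<in> special p" for u
    proof -
      have uc: "u \<in> carrier \<G>" using u by (simp add: special_def)
      have "inv\<^bsub>GL_mod n (int p)\<^esub> (t p) \<otimes>\<^bsub>GL_mod n (int p)\<^esub> m u = u p"
        unfolding m_def using tp \<G>_coord[OF uc p] by (simp add: Gp.m_assoc[symmetric] del: GL_mod_mult GL_mod_one)
      then show ?thesis using u uc by (intro ext) (auto simp: special_def carrier_\<G> PiE_iff extensional_def)
    qed
    show "m (\<lambda>q\<in>S. if q = p then inv\<^bsub>GL_mod n (int p)\<^esub> (t p) \<otimes>\<^bsub>GL_mod n (int p)\<^esub> A else \<one>\<^bsub>\<G>\<^esub> q) = A"
      if A: "A \<in> D" for A
      using A tp p by (simp add: D_def m_def Gp.m_assoc[symmetric] del: GL_mod_mult GL_mod_one)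
  qed
  define Y where "Y = {A \<in> D. \<not> reducible_mod n (int p) (A ^\<^sub>m e)}"
  have finD: "finite D"
    unfolding D_def using finite_GL_mod[of "int p" n] primeS[OF p] prime_gt_0_nat by auto
  have "card D \<le> 2 * n * card Y"
    using irreducible_density[OF primeS[OF p] n e big \<tau>'] by (simp add: D_def Y_def conj_ac)
  then have Y: "real (card D) \<le> 2 * real n * real (card Y)"
    by (metis of_nat_le_iff of_nat_mult of_nat_numeral)
  have "card {u \<in> special p. t \<otimes>\<^bsub>\<G>\<^esub> u \<in> bad_at e p} \<le> card (D - Y)"
  proof (rule card_inj_on_le[of m])
    show "inj_on m {u \<in> special p. t \<otimes>\<^bsub>\<G>\<^esub> u \<in> bad_at e p}"
      using bij by (auto simp: bij_betw_def intro: inj_on_subset)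
    show "m ` {u \<in> special p. t \<otimes>\<^bsub>\<G>\<^esub> u \<in> bad_at e p} \<subseteq> D - Y"
      using bij by (auto simp: bij_betw_def Y_def bad_at_def m_eq)
  qed (use finD in simp)
  also have "card (D - Y) = card D - card Y" using finD by (intro card_Diff_subset) (auto simp: Y_def)
  finally have "real (card {u \<in> special p. t \<otimes>\<^bsub>\<G>\<^esub> u \<in> bad_at e p}) \<le> real (card D) - real (card Y)"
    using card_mono[OF finD, of Y] by (auto simp: Y_def of_nat_diff)
  also have "\<dots> \<le> (1 - 1 / (2 * real n)) * real (card D)" using Y n by (simp add: field_simps)
  finally show ?thesis using bij_betw_same_card[OF bij] by simp
qed

text \<open>Translation by \<open>special q\<close> leaves the condition at \<open>p \<noteq> q\<close> unchanged, so the conditions at the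
  different primes are independent on each coset of \<open>return_subgroup\<close>, and \<open>walk_limsup\<close> applies.\<close>

theorem eventually_few_reducible:
  assumes n: "n > 0" and e: "e > 0" and big: "\<And>p. p \<in> S \<Longrightarrow> 2 * n ^ 2 * e \<le> p"
    and z: "\<And>p. p \<in> S \<Longrightarrow> \<exists>z. [z ^ n = -1] (mod int p)"
    and e6: "\<And>\<phi>. \<phi> \<in> carrier AutF \<Longrightarrow> cong_mat n 6 (aut_mat \<phi> ^\<^sub>m e) (1\<^sub>m n)" and \<epsilon>: "\<epsilon> > 0"
  shows "\<exists>L0. \<forall>L\<ge>L0. real (card {is \<in> index_seqs k L. \<not> strongly_irreducible_aut F (word_prod AutF (map f is))})
     / real k ^ L \<le> (1 - 1 / (2 * real n)) ^ card S + \<epsilon>"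
proof -
  let ?c = "1 - 1 / (2 * real n)"
  have c0: "0 \<le> ?c" using n by (simp add: divide_simps)
  define B where "B = {g. \<forall>p\<in>S. g \<in> bad_at e p}"
  have dens: "real (card {y \<in> W.return_subgroup. t \<otimes>\<^bsub>\<G>\<^esub> y \<in> B}) \<le> ?c ^ card S * real (card W.return_subgroup)"
    if t: "t \<in> carrier \<G>" for t
    unfolding B_def mem_Collect_eq
  proof (rule H.H.independent_densities[OF finite_\<G> W.subgroup_return_subgroup finS, of special "bad_at e" ?c t])
    show "x \<otimes>\<^bsub>\<G>\<^esub> u \<in> bad_at e i \<longleftrightarrow> x \<in> bad_at e i"
      if "i \<in> S" "j \<in> S" "i \<noteq> j" "x \<in> carrier \<G>" "u \<in> special j" for i j x u
      using mult_one_coord[OF that(4,1), of u] that by (simp add: bad_at_def special_def)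
    show "real (card {u \<in> special i. t \<otimes>\<^bsub>\<G>\<^esub> u \<in> bad_at e i}) \<le> ?c * real (card (special i))"
      if i: "i \<in> S" and t: "t \<in> carrier \<G>" for i t
    proof -
      obtain z where "[z ^ n = -1] (mod int i)" using z[OF i] by blast
      then show ?thesis by (rule bad_density[OF i n e big[OF i] _ t])
    qed
  qed (use subgroup_special special_subset_return_subgroup c0 t in auto)
  obtain L0 where L0: "\<forall>L\<ge>L0. real (card {is \<in> index_seqs k L. W.word_val is \<in> B}) / real k ^ L \<le> ?c ^ card S + \<epsilon>"
    using W.walk_limsup[OF dens \<epsilon>] by blast
  have sub: "{is \<in> index_seqs k L. \<not> strongly_irreducible_aut F (word_prod AutF (map f is))}
      \<subseteq> {is \<in> index_seqs k L. W.word_val is \<in> B}" for L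
  proof clarify
    fix "is" assume i: "is \<in> index_seqs k L" "\<not> strongly_irreducible_aut F (word_prod AutF (map f is))"
    define \<phi> where "\<phi> = word_prod AutF (map f is)"
    have \<phi>: "\<phi> \<in> carrier AutF" "\<rho> \<phi> = W.word_val is"
      using \<rho>_word[of "is"] i(1) by (auto simp: \<phi>_def index_seqs_def)
    have "W.word_val is \<in> bad_at e p" if p: "p \<in> S" for p
    proof -
      have "prime (int p)" using primeS[OF p] by simp
      then have red: "reducible_mod n (int p) (aut_mat \<phi> ^\<^sub>m e)"
        using not_strongly_irreducible_imp_reducible_mod[OF \<phi>(1) _ e6[OF \<phi>(1)]] i(2) by (simp add: \<phi>_def)
      have val: "W.word_val is p = reduce_mat n (int p) (aut_mat \<phi>)"
        using \<phi>(2)[symmetric] p by (simp add: \<rho>_def)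
      have cong: "cong_mat n (int p) (reduce_mat n (int p) (aut_mat \<phi>) ^\<^sub>m e) (aut_mat \<phi> ^\<^sub>m e)"
        by (rule cong_mat_pow[OF reduce_mat_carrier aut_mat_carrier reduce_mat_cong])
      have "reducible_mod n (int p) (reduce_mat n (int p) (aut_mat \<phi>) ^\<^sub>m e)"
      proof -
        obtain V where V: "V \<subseteq> carrier_vec n" "\<forall>v\<in>V. \<forall>w\<in>V. v + w \<in> V" "\<forall>v\<in>carrier_vec n. int p \<cdot>\<^sub>v v \<in> V"
          "\<forall>v\<in>V. aut_mat \<phi> ^\<^sub>m e *\<^sub>v v \<in> V" "V \<noteq> carrier_vec n" "\<exists>w\<in>V. \<exists>i<n. \<not> int p dvd w $ i"
          using red unfolding reducible_mod_def by blast
        then have sub: "mod_subgroup n (int p) V" by (simp add: mod_subgroup_def)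
        have "reduce_mat n (int p) (aut_mat \<phi>) ^\<^sub>m e *\<^sub>v v \<in> V" if v: "v \<in> V" for v
        proof (rule mod_subgroup_cong[OF sub, of "aut_mat \<phi> ^\<^sub>m e *\<^sub>v v"])
          have vc: "v \<in> carrier_vec n" using v V by blast
          show "aut_mat \<phi> ^\<^sub>m e *\<^sub>v v \<in> V" using v V by blast
          show "reduce_mat n (int p) (aut_mat \<phi>) ^\<^sub>m e *\<^sub>v v \<in> carrier_vec n"
            by (rule mult_mat_vec_carrier[OF pow_carrier_mat[OF reduce_mat_carrier] vc])
          show "cong_vec n (int p) (aut_mat \<phi> ^\<^sub>m e *\<^sub>v v) (reduce_mat n (int p) (aut_mat \<phi>) ^\<^sub>m e *\<^sub>v v)"
            by (rule cong_mat_mult_vec[OF pow_carrier_mat[OF aut_mat_carrier] pow_carrier_mat[OF reduce_mat_carrier]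
                vc vc cong_mat_sym[OF cong] cong_vec_refl])
        qed
        with V show ?thesis unfolding reducible_mod_def by (intro exI[of _ V]) blast
      qed
      moreover have "[det (reduce_mat n (int p) (aut_mat \<phi>)) = det (aut_mat \<phi>)] (mod int p)"
        by (rule cong_mat_det[OF reduce_mat_carrier aut_mat_carrier reduce_mat_cong])
      ultimately show ?thesis using det_aut_mat[OF \<phi>(1)] val by (auto simp: bad_at_def)
    qed
    then show "W.word_val is \<in> B" by (simp add: B_def)
  qed
  have "real (card {is \<in> index_seqs k L. \<not> strongly_irreducible_aut F (word_prod AutF (map f is))})
     / real k ^ L \<le> real (card {is \<in> index_seqs k L. W.word_val is \<in> B}) / real k ^ L" for L
    using card_mono[OF _ sub[of L]] W.finite_index_seqs[of L] by (intro divide_right_mono) auto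
  then show ?thesis using L0 order_trans by blast
qed

end

section \<open>Random automorphisms are strongly irreducible\<close>

theorem theorem9p1:
  fixes F :: "('a, 'b) monoid_scheme" and n k :: nat and f :: "nat \<Rightarrow> 'a \<Rightarrow> 'a"
  assumes "free_group_of_rank F n"
    and "k \<ge> 1"
    and "f ` {1..k} \<subseteq> carrier (AutoGroup F)"
    and "generate (AutoGroup F) (f ` {1..k}) = carrier (AutoGroup F)"
  shows "((\<lambda>L. word_probability F k f L (irreducible_aut F)) \<longlonglongrightarrow> 1) \<and>
         ((\<lambda>L. word_probability F k f L (strongly_irreducible_aut F)) \<longlonglongrightarrow> 1)"
proof -
  obtain X where X: "group F" "finite X" "card X = n" "free_basis F X"
    using assms(1) by (auto simp: free_group_of_rank_def)
  obtain b where b: "bij_betw b {..<n} X"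
    using ex_bij_betw_nat_finite[OF X(2)] X(3) by (auto simp: atLeast0LessThan)
  interpret based_free_group F X n b
    by (intro based_free_group.intro free_group.intro free_group_axioms.intro based_free_group_axioms.intro X b)
  obtain e where e: "e > 0" and "\<forall>A\<in>carrier_mat n n. (\<exists>B. inverse_mod n 6 A B) \<longrightarrow> cong_mat n 6 (A ^\<^sub>m e) (1\<^sub>m n)"
    using ex_exponent_GL_mod[of 6 n] by auto
  then have e6: "cong_mat n 6 (aut_mat \<phi> ^\<^sub>m e) (1\<^sub>m n)" if "\<phi> \<in> carrier AutF" for \<phi>
    using aut_mat_inverse_mod[OF that] aut_mat_carrier by blast
  let ?bad = "\<lambda>L. {is \<in> index_seqs k L. \<not> strongly_irreducible_aut F (word_prod AutF (map f is))}"
  have few: "\<exists>L0. \<forall>L\<ge>L0. real (card (?bad L)) / real k ^ L \<le> \<delta>" if \<delta>: "\<delta> > 0" for \<delta>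
  \<comment> \<open>In rank \<open>0\<close> there is no room for a proper nonzero subspace.\<close>
  proof (cases "n = 0")
    case True
    have "?bad L = {}" for L
    proof (rule ccontr)
      assume "?bad L \<noteq> {}"
      then obtain "is" where i: "is \<in> index_seqs k L" "\<not> strongly_irreducible_aut F (word_prod AutF (map f is))" by blast
      interpret R: random_automorphism F X n b k f "{}"
        using assms by unfold_locales auto
      have "word_prod AutF (map f is) \<in> carrier AutF" using R.\<rho>_word[of "is"] i(1) by (simp add: index_seqs_def)
      then have "reducible_mod n 2 (aut_mat (word_prod AutF (map f is)) ^\<^sub>m e)"
        using not_strongly_irreducible_imp_reducible_mod[OF _ i(2) e6] by simp
      then show False using True by (simp add: reducible_mod_def)
    qed
    then show ?thesis using \<delta> by (simp only: card.empty) auto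
  next
    case False
    let ?c = "1 - 1 / (2 * real n)"
    have c: "0 \<le> ?c" "?c < 1" using False by (auto simp: divide_simps)
    have "(\<lambda>r. ?c ^ r) \<longlonglongrightarrow> 0" using c by (intro LIMSEQ_realpow_zero)
    then have "eventually (\<lambda>r. ?c ^ r < \<delta> / 2) sequentially" using \<delta> by (intro order_tendstoD(2)) auto
    then obtain r where r: "?c ^ r < \<delta> / 2" by (auto simp: eventually_sequentially)
    \<comment> \<open>Omitting the primes up to \<open>2 + 2 * n ^ 2 * e\<close> makes the remaining ones odd and large enough for \<open>irreducible_density\<close>.\<close>
    let ?P = "{p::nat. prime p \<and> (\<exists>z. [z ^ n = -1] (mod int p))}"
    have "infinite (?P - {..2 + 2 * n ^ 2 * e})"
      using infinite_primes_with_root_of_minus_one[of n] False by (intro Diff_infinite_finite) auto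
    from infinite_arbitrarily_large[OF this, of r]
    obtain S where S: "finite S" "card S = r" "S \<subseteq> ?P - {..2 + 2 * n ^ 2 * e}" by (elim exE conjE)
    interpret R: random_automorphism F X n b k f S
      using assms S by unfold_locales auto
    have le: "?c ^ card S + \<delta> / 2 \<le> \<delta>" using r S(2) by simp
    have "\<exists>L0. \<forall>L\<ge>L0. real (card (?bad L)) / real k ^ L \<le> ?c ^ card S + \<delta> / 2"
      by (rule R.eventually_few_reducible[OF _ e]) (use False S \<delta> e6 in auto)
    then obtain L0 where L0: "\<forall>L\<ge>L0. real (card (?bad L)) / real k ^ L \<le> ?c ^ card S + \<delta> / 2" ..
    show ?thesis
    proof (intro exI[of _ L0] allI impI)
      fix L assume "L \<ge> L0"
      with L0 have "real (card (?bad L)) / real k ^ L \<le> ?c ^ card S + \<delta> / 2" by simp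
      also note le
      finally show "real (card (?bad L)) / real k ^ L \<le> \<delta>" .
    qed
  qed
  have fin: "finite (index_seqs k L)" and card: "card (index_seqs k L) = k ^ L" for L
    using finite_lists_length_eq[of "{1..k}" L] card_lists_length_eq[of "{1..k}" L]
    by (simp_all add: index_seqs_def conj_commute)
  have ne: "index_seqs k L \<noteq> {}" for L using card[of L] fin[of L] assms(2) by auto
  have prob: "word_probability F k f L Q = real (card {is \<in> index_seqs k L. Q (word_prod AutF (map f is))}) / real k ^ L"
    for L Q
    unfolding word_probability_def using measure_pmf_of_set[OF ne fin] card by (simp add: Int_def)
  have strong: "word_probability F k f L (strongly_irreducible_aut F) = 1 - real (card (?bad L)) / real k ^ L" for L
  proof -
    have "{is \<in> index_seqs k L. strongly_irreducible_aut F (word_prod AutF (map f is))} = index_seqs k L - ?bad L" by blast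
    then have "card {is \<in> index_seqs k L. strongly_irreducible_aut F (word_prod AutF (map f is))} = k ^ L - card (?bad L)"
      using card_Diff_subset[of "?bad L" "index_seqs k L"] fin[of L] card[of L] by simp
    moreover have "card (?bad L) \<le> k ^ L" using card_mono[OF fin[of L], of "?bad L"] card[of L] by auto
    ultimately show ?thesis using assms(2) by (simp add: prob of_nat_diff diff_divide_distrib)
  qed
  have le: "word_probability F k f L (strongly_irreducible_aut F) \<le> word_probability F k f L (irreducible_aut F)" for L
  proof -
    interpret R: random_automorphism F X n b k f "{}"
      using assms by unfold_locales auto
    have "{is \<in> index_seqs k L. strongly_irreducible_aut F (word_prod AutF (map f is))} \<subseteq>
        {is \<in> index_seqs k L. irreducible_aut F (word_prod AutF (map f is))}"
      using strongly_irreducible_imp_irreducible R.\<rho>_word by (auto simp: index_seqs_def)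
    then show ?thesis unfolding prob using fin[of L] by (intro divide_right_mono) (auto intro!: card_mono)
  qed
  have le1: "word_probability F k f L Q \<le> 1" for L Q
    unfolding word_probability_def by simp
  have lim: "(\<lambda>L. word_probability F k f L (strongly_irreducible_aut F)) \<longlonglongrightarrow> 1"
  proof (rule LIMSEQ_I)
    fix \<delta> :: real assume "\<delta> > 0"
    then obtain L0 where L0: "\<forall>L\<ge>L0. real (card (?bad L)) / real k ^ L \<le> \<delta> / 2" using few[of "\<delta> / 2"] by auto
    have "norm (word_probability F k f L (strongly_irreducible_aut F) - 1) < \<delta>" if "L \<ge> L0" for L
    proof -
      have "real (card (?bad L)) / real k ^ L \<le> \<delta> / 2" using L0 that by blast
      moreover have "real (card (?bad L)) / real k ^ L \<ge> 0" by simp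
      ultimately show ?thesis unfolding strong real_norm_def using \<open>\<delta> > 0\<close> by arith
    qed
    then show "\<exists>L0. \<forall>L\<ge>L0. norm (word_probability F k f L (strongly_irreducible_aut F) - 1) < \<delta>" by blast
  qed
  moreover have "(\<lambda>L. word_probability F k f L (irreducible_aut F)) \<longlonglongrightarrow> 1"
    by (rule tendsto_sandwich[OF _ _ lim tendsto_const]) (use le le1 in auto)
  ultimately show ?thesis by blast
qed

end
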